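(* Let $\varphi^*$ be the unitary totient function, and let $F_{\varphi^*}(X)$ denote the number of $\varphi^*$-practical positive integers $n\le X$. There exist positive constants $l$ and $u$ such that $$ l\,\frac{X}{\log X}\le F_{\varphi^*}(X)\le u\,\frac{X}{\log X}$$ for all real $X\ge 2$.
   Context: The unitary totient function $\varphi^*$ is the multiplicative function with $\varphi^*(1)=1$ and $\varphi^*(p^k)=p^k-1$ for every prime $p$ and integer $k\ge1$. For a multiplicative $f$ put $S_f(n)=\sum_{d\mid n}f(d)$. A positive integer $n$ is $f$-practical if every positive integer $m\le S_f(n)$ can be written as $\sum_{d\in\mathcal{D}} f(d)$ for some set $\mathcal{D}$ of distinct positive divisors of $n$. *)

theory Defs
  imports "HOL-Analysis.Analysis" "HOL-Computational_Algebra.Primes"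
begin

definition unitary_totient :: "nat \<Rightarrow> nat" where
  "unitary_totient n = (\<Prod>p\<in>prime_factors n. p ^ multiplicity p n - 1)"

definition divisor_sum :: "(nat \<Rightarrow> nat) \<Rightarrow> nat \<Rightarrow> nat" where
  "divisor_sum f n = (\<Sum>d | d dvd n. f d)"

definition f_practical :: "(nat \<Rightarrow> nat) \<Rightarrow> nat \<Rightarrow> bool" where
  "f_practical f n \<longleftrightarrow> n > 0 \<and>
     (\<forall>m. 1 \<le> m \<and> m \<le> divisor_sum f n \<longrightarrow>
        (\<exists>D. D \<subseteq> {d. d dvd n} \<and> sum f D = m))"

definition practical_count :: "(nat \<Rightarrow> nat) \<Rightarrow> real \<Rightarrow> nat" where
  "practical_count f X = card {n::nat. 1 \<le> n \<and> real n \<le> X \<and> f_practical f n}"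

end

theory Submission
  imports Defs "HOL-Number_Theory.Prime_Powers" "HOL-Real_Asymp.Real_Asymp"
begin

text \<open>
  For a bound \<open>\<theta>\<close>, let \<open>B\<close> be the set of integers whose prime factors \<open>p\<^sub>1 \<le> p\<^sub>2 \<le> \<dots>\<close> satisfy
  \<open>p\<^bsub>i+1\<^esub> \<le> \<theta> (p\<^sub>1 \<dots> p\<^sub>i)\<close>. Practical numbers lie in \<open>B\<close> for \<open>\<theta> m = 3 m (1 + ln m)\<close>; conversely, if
  \<open>n\<close> is in \<open>B\<close> for \<open>\<theta> m = K m\<close> and coprime to 15, then \<open>15 \<cdot> 2\<^sup>k n\<close> is practical as soon as \<open>2\<^sup>k \<ge> K\<close>.

  Every integer is uniquely \<open>m r\<close> with \<open>m \<in> B\<close> and \<open>r\<close> free of primes up to \<open>\<theta> m\<close>, hence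
  \<open>\<Sum>m\<in>B. m\<^bsup>-s\<^esup> \<Prod>p\<le>\<theta> m. (1 - p\<^bsup>-s\<^esup>) = 1\<close>. Comparing this identity at \<open>s = 1\<close> and \<open>s = 1 + \<epsilon>\<close>,
  the terms with \<open>ln m\<close> well above \<open>1/\<epsilon>\<close> decrease by a fixed proportion, while by Mertens' theorem the
  others increase by a factor \<open>1 + O(\<epsilon> ln (\<theta> m / m))\<close> at most. This forces
  \<open>\<Sum>1/m = O(1)\<close> over the \<open>m \<in> B\<close> with \<open>V \<le> ln m \<le> 4 V\<close>, which is the upper bound on logarithmic
  average. Doing the same at \<open>s = 1 - 1 / ln Y\<close> among \<open>Y\<close>-smooth integers shows that the smooth \<open>m\<close>
  contribute exponentially little, and then writing \<open>ln r\<close> as a sum of von Mangoldt values turns the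
  average bound into a pointwise one. For \<open>\<theta> m = K m\<close> with large \<open>K\<close> the terms with small \<open>m\<close> increase
  by at least a factor \<open>1 + \<epsilon>\<close>, so some \<open>m\<close> with \<open>ln m\<close> of order \<open>1/\<epsilon>\<close> must compensate; multiplying
  these by primes below \<open>m\<close> gives the pointwise lower bound.
\<close>

section \<open>Chebyshev and Mertens estimates\<close>

text \<open>The partition of unity is always used among \<open>Y\<close>-smooth integers: with the
  Euler factors cut off at \<open>Y\<close> the total is exactly 1 for every \<open>s > 0\<close>,
  also for \<open>s < 1\<close>, and all constants have to be uniform in \<open>Y\<close>. The
  obstacle in the upper bound is the factor \<open>1 + ln m\<close> in theta. It lets a single term
  grow by \<open>1 + O(eps ln ln m)\<close>, so a tail estimate involves a moment of
  \<open>ln (1 + ln m)\<close>, which in turn is bounded through tail estimates. A crude bound for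
  the moment gives tails \<open>O(k / 2^k)\<close> beyond \<open>ln m = 2^k\<close>; these suffice
  to sum the moment, and then the tail is \<open>O(1 / V)\<close>. In the lower bound theta is
  linear and \<open>ln K\<close> exceeds the Mertens error by 1, so that small terms really grow.
  The factor 15 is there because powers of 2 alone fail: the divisors of 8 have values 1, 1, 3, 7,
  which miss 6, whereas those of 15 have values 1, 2, 4, 8. The primes 3 and 5 are therefore removed
  from the prime set, which shifts Mertens' sum by a constant only.\<close>

lemma card_multiples_upto:
  fixes n d :: nat
  assumes "d > 0"
  shows "card {k\<in>{1..n}. d dvd k} = n div d"
proof -
  have "{k\<in>{1..n}. d dvd k} = (\<lambda>j. d * j) ` {1..n div d}"
  proof (intro set_eqI iffI)
    fix k assume "k \<in> {k\<in>{1..n}. d dvd k}"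
    then obtain j where "k = d * j" "1 \<le> k" "k \<le> n" by auto
    moreover from this have "j \<le> n div d" "j \<ge> 1"
      using assms by (auto simp: less_eq_div_iff_mult_less_eq mult.commute Suc_le_eq intro!: Nat.gr0I)
    ultimately show "k \<in> (\<lambda>j. d * j) ` {1..n div d}" by auto
  next
    fix k assume "k \<in> (\<lambda>j. d * j) ` {1..n div d}"
    then show "k \<in> {k\<in>{1..n}. d dvd k}"
      using assms by (auto simp: less_eq_div_iff_mult_less_eq mult.commute Suc_le_eq)
  qed
  moreover have "inj_on (\<lambda>j. d * j) {1..n div d}"
    using assms by (auto intro: inj_onI)
  ultimately show ?thesis by (simp add: card_image)
qed

text \<open>Legendre's identity: expand each \<open>ln k\<close> over the divisors of
  \<open>k\<close> and swap the sums. Chebyshev's bound and Mertens' estimate are both read off from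
  it.\<close>

lemma ln_fact_eq_sum_mangoldt:
  "ln (fact n) = (\<Sum>d=1..n. mangoldt d * real (n div d))"
proof -
  have "ln (fact n :: real) = (\<Sum>k=1..n. ln (real k))"
    by (induction n) (auto simp: ln_mult)
  also have "\<dots> = (\<Sum>k=1..n. \<Sum>d | d \<in> {1..n} \<and> d dvd k. mangoldt d)"
  proof (intro sum.cong refl)
    fix k assume k: "k \<in> {1..n}"
    have "{d. d \<in> {1..n} \<and> d dvd k} = {d. d dvd k}"
      using k by (auto dest: dvd_imp_le intro: Nat.gr0I simp: Suc_le_eq)
    then show "ln (real k) = (\<Sum>d | d \<in> {1..n} \<and> d dvd k. mangoldt d)"
      using mangoldt_sum[of k, where ?'a = real] k by simp
  qed
  also have "\<dots> = (\<Sum>d=1..n. \<Sum>k | k \<in> {1..n} \<and> d dvd k. mangoldt d)"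
    by (rule sum.swap_restrict) auto
  also have "\<dots> = (\<Sum>d=1..n. mangoldt d * real (n div d))"
  proof (intro sum.cong refl)
    fix d assume "d \<in> {1..n}"
    then show "(\<Sum>k | k \<in> {1..n} \<and> d dvd k. mangoldt d) = mangoldt d * real (n div d)"
      using card_multiples_upto[of d n] by simp
  qed
  finally show ?thesis .
qed

definition chebyshev_psi :: "nat \<Rightarrow> real" where
  "chebyshev_psi n = (\<Sum>d=1..n. mangoldt d)"

text \<open>Chebyshev's argument: \<open>2 n div d - 2 (n div d)\<close> is never negative and
  equals 1 for \<open>n < d \<le> 2 n\<close>, while the central binomial coefficient is at most
  \<open>4 ^ n\<close>.\<close>

lemma chebyshev_psi_double: "chebyshev_psi (2 * n) - chebyshev_psi n \<le> 2 * real n * ln 2"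
proof -
  have split: "{1..2*n} = {1..n} \<union> {n+1..2*n}" by auto
  \<comment> \<open>The terms with \<open>d > n\<close> vanish since \<open>n div d = 0\<close>, so
    both factorials are summed over one range.\<close>
  have "ln (fact n) = (\<Sum>d=1..2*n. mangoldt d * real (n div d))"
    unfolding ln_fact_eq_sum_mangoldt by (intro sum.mono_neutral_left) auto
  then have "ln (fact (2*n)) - 2 * ln (fact n) =
        (\<Sum>d=1..2*n. mangoldt d * (real (2*n div d) - 2 * real (n div d)))"
    unfolding ln_fact_eq_sum_mangoldt[of "2*n"]
    by (simp add: algebra_simps sum_subtractf sum_distrib_left)
  moreover have "(\<Sum>d=n+1..2*n. mangoldt d)
      \<le> (\<Sum>d=1..2*n. mangoldt d * (real (2*n div d) - 2 * real (n div d)))"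
  proof -
    have "(\<Sum>d=n+1..2*n. mangoldt d) =
          (\<Sum>d=n+1..2*n. mangoldt d * (real (2*n div d) - 2 * real (n div d)))"
    proof (intro sum.cong refl)
      fix d assume d: "d \<in> {n+1..2*n}"
      then have "2*n div d = 1" by (intro div_nat_eqI) auto
      with d show "mangoldt d = mangoldt d * (real (2*n div d) - 2 * real (n div d))" by simp
    qed
    also have "\<dots> \<le> (\<Sum>d=1..2*n. mangoldt d * (real (2*n div d) - 2 * real (n div d)))"
    proof (intro sum_mono2 mult_nonneg_nonneg mangoldt_nonneg)
      fix d
      have "2 * (n div d) \<le> 2 * n div d"
        using div_mult1_eq[of 2 n d] by simp
      then show "0 \<le> real (2*n div d) - 2 * real (n div d)" by linarith
    qed auto
    finally show ?thesis .
  qed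
  moreover have "chebyshev_psi (2*n) - chebyshev_psi n = (\<Sum>d=n+1..2*n. mangoldt d)"
    unfolding chebyshev_psi_def split by (subst sum.union_disjoint) auto
  moreover have "ln (fact (2*n)) - 2 * ln (fact n) \<le> 2 * real n * ln (2::real)"
  proof -
    have "real ((2*n) choose n) = fact (2*n) / (fact n * fact n)"
      by (subst binomial_fact) (auto simp: mult_2)
    then have "ln (real ((2*n) choose n)) = ln (fact (2*n)) - 2 * ln (fact n)"
      by (simp add: ln_div ln_mult)
    moreover have "real ((2*n) choose n) \<le> 2 ^ (2*n)"
      using binomial_le_pow2[of "2*n" n] by (metis of_nat_le_iff of_nat_numeral of_nat_power)
    then have "ln (real ((2*n) choose n)) \<le> ln (2 ^ (2*n))"
      by (subst ln_le_cancel_iff) auto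
    ultimately show ?thesis by (simp add: ln_realpow)
  qed
  ultimately show ?thesis by linarith
qed

text \<open>Halving the argument, the induction has to absorb \<open>2 m ln 2\<close> and one extra
  term at odd \<open>n\<close>; the constant 4 leaves room for the crude bounds
  \<open>ln 2 < 1\<close> and \<open>ln n \<le> n\<close>.\<close>

lemma chebyshev_psi_le: "chebyshev_psi n \<le> 4 * real n"
proof (induction n rule: less_induct)
  case (less n)
  show ?case
  proof (cases "n = 0")
    case True
    then show ?thesis by (simp add: chebyshev_psi_def)
  next
    case False
    define m where "m = n div 2"
    have n: "n = 2 * m \<or> n = Suc (2 * m)" unfolding m_def by presburger
    have "m < n" using False unfolding m_def by simp
    have "chebyshev_psi n \<le> chebyshev_psi (2*m) + ln (real n)"
    proof (cases "n = 2 * m")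
      case True
      then show ?thesis using False by simp
    next
      case odd: False
      with n have "n = Suc (2*m)" by simp
      moreover have "mangoldt n \<le> ln (real n)" using mangoldt_le[of n] False by simp
      ultimately show ?thesis by (simp add: chebyshev_psi_def)
    qed
    also have "\<dots> \<le> chebyshev_psi m + 2 * real m * ln 2 + ln (real n)"
      using chebyshev_psi_double[of m] by simp
    also have "\<dots> \<le> 4 * real m + 2 * real m * 1 + real n"
      using less[OF \<open>m < n\<close>] ln_le_minus_one[of "real n"] False ln_2_less_1
      by (intro add_mono mult_left_mono) auto
    also have "\<dots> \<le> 4 * real n" using n by auto
    finally show ?thesis .
  qed
qed

text \<open>\<open>n ^ n / n!\<close> is a single term of the series of
  \<open>exp n\<close>.\<close>

lemma ln_fact_ge: "real n * ln (real n) - real n \<le> ln (fact n)"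
proof (cases "n = 0")
  case False
  have "real n ^ n / fact n \<le> (\<Sum>k<Suc n. real n ^ k / fact k)"
    by (rule member_le_sum[of n]) auto
  also have "\<dots> \<le> exp (real n)"
    unfolding exp_def using summable_exp[of "real n"]
    by (intro order.trans[OF sum_le_suminf[of "\<lambda>k. real n ^ k / fact k" "{..<Suc n}"]])
       (auto simp: scaleR_conv_of_real field_simps)
  finally have "ln (real n ^ n / fact n) \<le> real n"
    using False by (metis exp_gt_zero ln_exp ln_le_cancel_iff divide_pos_pos fact_gt_zero of_nat_0_less_iff neq0_conv zero_less_power)
  then show ?thesis using False by (simp add: ln_div ln_realpow)
qed auto

lemma ln_fact_le: "ln (fact n) \<le> real n * ln (real n)"
proof (cases "n = 0")
  case False
  have "fact n \<le> real n ^ n" using fact_le_power[of n, where ?'a = real] by simp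
  then have "ln (fact n) \<le> ln (real n ^ n)" using False by (subst ln_le_cancel_iff) auto
  then show ?thesis using False by (simp add: ln_realpow)
qed auto

text \<open>Replacing \<open>n div d\<close> by \<open>n / d\<close> in Legendre's identity costs at
  most \<open>chebyshev_psi n\<close>; after division by \<open>n\<close> the linear error is a
  constant.\<close>

lemma sum_mangoldt_over:
  assumes "n > 0"
  shows "(\<Sum>d=1..n. mangoldt d / real d) \<le> ln (real n) + 4"
    and "ln (real n) - 1 \<le> (\<Sum>d=1..n. mangoldt d / real d)"
proof -
  have "(\<Sum>d=1..n. mangoldt d * (real n / real d)) - chebyshev_psi n \<le> ln (fact n)"
    unfolding ln_fact_eq_sum_mangoldt chebyshev_psi_def sum_subtractf[symmetric]
  proof (intro sum_mono)
    fix d assume "d \<in> {1..n}"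
    have "real n / real d - 1 \<le> real (n div d)"
      using floor_divide_of_nat_eq[of n d, where ?'a = real] by linarith
    from mult_left_mono[OF this mangoldt_nonneg[of d]]
    show "mangoldt d * (real n / real d) - mangoldt d \<le> mangoldt d * real (n div d)"
      by (simp add: algebra_simps)
  qed
  then have "real n * (\<Sum>d=1..n. mangoldt d / real d) \<le> real n * ln (real n) + 4 * real n"
    using ln_fact_le[of n] chebyshev_psi_le[of n] by (simp add: sum_distrib_left field_simps)
  then have "real n * (\<Sum>d=1..n. mangoldt d / real d) \<le> real n * (ln (real n) + 4)"
    by (simp add: algebra_simps)
  then show "(\<Sum>d=1..n. mangoldt d / real d) \<le> ln (real n) + 4"
    using assms by simp
  have "ln (fact n) \<le> (\<Sum>d=1..n. mangoldt d * (real n / real d))"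
    unfolding ln_fact_eq_sum_mangoldt
    by (intro sum_mono mult_left_mono mangoldt_nonneg of_nat_div_le_of_nat)
  then have "real n * ln (real n) - real n \<le> real n * (\<Sum>d=1..n. mangoldt d / real d)"
    using ln_fact_ge[of n] by (simp add: sum_distrib_left field_simps)
  then have "real n * (ln (real n) - 1) \<le> real n * (\<Sum>d=1..n. mangoldt d / real d)"
    by (simp add: algebra_simps)
  then show "ln (real n) - 1 \<le> (\<Sum>d=1..n. mangoldt d / real d)"
    using assms by simp
qed

text \<open>Controls the higher prime powers, to which a prime \<open>p\<close> contributes at most
  \<open>ln p / (p (p - 1))\<close>.\<close>

lemma bounded_sum_ln_over_square:
  "\<exists>C>0. \<forall>F::nat set. finite F \<longrightarrow> F \<subseteq> {2..} \<longrightarrow> (\<Sum>k\<in>F. ln (real k) / (real k * (real k - 1))) \<le> C"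
proof -
  define g where "g = (\<lambda>k::nat. ln (real k) / (real k * (real k - 1)))"
  have "summable g"
  proof (rule summable_comparison_test_bigo)
    show "summable (\<lambda>k. norm (real k powr (-3/2)))"
      by (simp add: summable_real_powr_iff)
    show "g \<in> O(\<lambda>k. real k powr (-3/2))"
      unfolding g_def by real_asymp
  qed
  moreover have "0 \<le> g k" for k
    unfolding g_def by (cases "k = 0") auto
  ultimately have "sum g F \<le> suminf g" if "finite F" for F
    using that by (intro sum_le_suminf) auto
  moreover have "0 \<le> suminf g"
    using \<open>summable g\<close> \<open>\<And>k. 0 \<le> g k\<close> by (intro suminf_nonneg)
  ultimately show ?thesis
    unfolding g_def by (intro exI[of _ "suminf (\<lambda>k::nat. ln (real k) / (real k * (real k - 1))) + 1"])
      (force)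
qed

lemma sum_inverse_powers_le:
  fixes x :: real
  assumes "x > 1"
  shows "(\<Sum>k=2..n. 1 / x ^ k) \<le> 1 / (x * (x - 1))"
proof -
  have "(\<Sum>k=2..n. 1 / x ^ k) = 1 / (x * (x - 1)) - 1 / (x ^ n * (x - 1))" if "n \<ge> 1"
    using that
  proof (induction n rule: nat_induct_at_least)
    case (Suc n)
    then have "(\<Sum>k=2..Suc n. 1 / x ^ k) = (\<Sum>k=2..n. 1 / x ^ k) + 1 / x ^ Suc n"
      by simp
    moreover have "1 / x ^ Suc n = 1 / (x ^ n * (x - 1)) - 1 / (x ^ Suc n * (x - 1))"
    proof -
      have "1 / (c * x) = 1 / (c * (x - 1)) - 1 / (c * x * (x - 1))" if "c \<noteq> 0" for c
      proof -
        have "1 / (c * (x - 1)) - 1 / (c * x * (x - 1)) = (x - 1) / (c * x * (x - 1))"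
          using that assms by (simp add: diff_divide_distrib)
        then show ?thesis using that assms by simp
      qed
      from this[of "x ^ n"] show ?thesis using assms by (simp only: power_Suc2) simp
    qed
    ultimately show ?case using Suc.IH by simp
  qed auto
  then show ?thesis using assms by (cases "n \<ge> 1") (auto simp: not_le)
qed

lemma finite_primes_le [simp, intro]: "finite {p. prime p \<and> real p \<le> y}"
  by (rule finite_subset[of _ "{..nat \<lfloor>y\<rfloor>}"]) (auto simp: le_nat_floor)

text \<open>Mertens' first theorem at integers: the von Mangoldt sum exceeds the prime sum only by
  the powers \<open>p ^ k\<close> with \<open>k \<ge> 2\<close>, a bounded amount by the geometric
  series.\<close>

lemma sum_ln_prime_over_nat:
  "\<exists>C. \<forall>n\<ge>1. \<bar>(\<Sum>p | prime p \<and> p \<le> n. ln (real p) / real p) - ln (real n)\<bar> \<le> C"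
proof -
  obtain C where C: "\<And>F::nat set. finite F \<Longrightarrow> F \<subseteq> {2..} \<Longrightarrow>
      (\<Sum>k\<in>F. ln (real k) / (real k * (real k - 1))) \<le> C"
    using bounded_sum_ln_over_square by blast
  have "\<bar>(\<Sum>p | prime p \<and> p \<le> n. ln (real p) / real p) - ln (real n)\<bar> \<le> max 4 (C + 1)"
    if "n \<ge> 1" for n
  proof -
    let ?P = "{p. prime p \<and> p \<le> n}"
    have fin: "finite ?P" by (rule finite_subset[of _ "{..n}"]) auto
    have P1: "?P \<subseteq> {1..n}" using prime_gt_0_nat by (auto simp: Suc_le_eq)
    have A: "(\<Sum>p\<in>?P. ln (real p) / real p) = (\<Sum>p\<in>?P. mangoldt p / real p)"
      by (intro sum.cong) auto
    have "(\<Sum>d=1..n. mangoldt d / real d) - (\<Sum>p\<in>?P. mangoldt p / real p)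
        = (\<Sum>d\<in>{1..n}-?P. mangoldt d / real d)"
      using P1 by (subst sum_diff) auto
    also have "\<dots> = (\<Sum>d\<in>{d\<in>{1..n}-?P. primepow d}. mangoldt d / real d)"
      by (intro sum.mono_neutral_right) (auto simp: mangoldt_def)
    \<comment> \<open>Enlarging to all pairs is harmless as the terms are nonnegative;
      \<open>k < p ^ k\<close> keeps the exponents up to \<open>n\<close>.\<close>
    also have "\<dots> \<le> (\<Sum>d\<in>(\<lambda>(p,k). p ^ k) ` (?P \<times> {2..n}). mangoldt d / real d)"
    proof (intro sum_mono2)
      show "{d\<in>{1..n}-?P. primepow d} \<subseteq> (\<lambda>(p,k). p ^ k) ` (?P \<times> {2..n})"
      proof
        fix d assume d: "d \<in> {d\<in>{1..n}-?P. primepow d}"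
        then obtain p k where pk: "prime p" "k > 0" "d = p ^ k"
          by (auto simp: primepow_def)
        have "k \<noteq> 1" using pk d by auto
        moreover have "p \<le> n" using pk d self_le_power[of p k] prime_gt_0_nat[of p] by force
        moreover have "k < p ^ k" using pk prime_gt_1_nat[of p] by (simp add: power_gt_expt)
        ultimately show "d \<in> (\<lambda>(p,k). p ^ k) ` (?P \<times> {2..n})"
          using pk d by (intro image_eqI[of _ _ "(p,k)"]) auto
      qed
    qed (use fin in \<open>auto simp: mangoldt_nonneg\<close>)
    also have "\<dots> \<le> (\<Sum>(p,k)\<in>?P \<times> {2..n}. mangoldt (p ^ k) / real (p ^ k))"
      using sum_image_le[of "?P \<times> {2..n}" "\<lambda>d. mangoldt d / real d" "\<lambda>(p,k). p ^ k"] fin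
      by (auto simp: mangoldt_nonneg case_prod_unfold o_def)
    also have "\<dots> = (\<Sum>p\<in>?P. \<Sum>k=2..n. ln (real p) * (1 / real p ^ k))"
      using fin by (subst sum.cartesian_product[symmetric]) (auto intro!: sum.cong)
    also have "\<dots> \<le> (\<Sum>p\<in>?P. ln (real p) / (real p * (real p - 1)))"
    proof (intro sum_mono)
      fix p assume "p \<in> ?P"
      then have "p > 1" using prime_gt_1_nat by auto
      then show "(\<Sum>k=2..n. ln (real p) * (1 / real p ^ k)) \<le> ln (real p) / (real p * (real p - 1))"
        unfolding sum_distrib_left[symmetric]
        using mult_left_mono[OF sum_inverse_powers_le[of "real p" n], of "ln (real p)"] by simp
    qed
    also have "\<dots> \<le> C" using fin prime_ge_2_nat by (intro C) auto
    finally have B: "(\<Sum>d=1..n. mangoldt d / real d) \<le> (\<Sum>p\<in>?P. ln (real p) / real p) + C"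
      unfolding A by linarith
    have D: "(\<Sum>p\<in>?P. ln (real p) / real p) \<le> (\<Sum>d=1..n. mangoldt d / real d)"
      unfolding A using P1 by (intro sum_mono2) (auto simp: mangoldt_nonneg)
    show ?thesis using B D sum_mangoldt_over[of n] that by (simp add: abs_le_iff) linarith
  qed
  then show ?thesis by blast
qed

theorem sum_ln_prime_over:
  "\<exists>C. \<forall>y\<ge>1. \<bar>(\<Sum>p | prime p \<and> real p \<le> y. ln (real p) / real p) - ln y\<bar> \<le> C"
proof -
  obtain C where C: "\<And>n. n \<ge> 1 \<Longrightarrow>
      \<bar>(\<Sum>p | prime p \<and> p \<le> n. ln (real p) / real p) - ln (real n)\<bar> \<le> C"
    using sum_ln_prime_over_nat by blast
  have "\<bar>(\<Sum>p | prime p \<and> real p \<le> y. ln (real p) / real p) - ln y\<bar> \<le> C + 1" if "y \<ge> 1" for y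
  proof -
    define n where "n = nat \<lfloor>y\<rfloor>"
    have n1: "n \<ge> 1" using that unfolding n_def by linarith
    have n: "n \<ge> 1" "real n \<ge> 1" "real n \<le> y" "y < real n + 1"
      using that n1 unfolding n_def by linarith+
    have "{p. prime p \<and> real p \<le> y} = {p. prime p \<and> p \<le> n}"
      using that unfolding n_def by (auto simp: le_nat_floor le_floor_iff nat_le_iff le_nat_iff)
    moreover have "ln (real n) \<le> ln y" using n that by simp
    moreover have "ln y \<le> ln (real n) + 1"
    proof -
      have "y \<le> 2 * real n" using n by linarith
      then have "ln y \<le> ln (2 * real n)" by (rule iffD2[OF ln_le_cancel_iff, rotated 2]) (use n that in linarith)+
      also have "\<dots> = ln 2 + ln (real n)" using n by (simp add: ln_mult)
      finally show ?thesis using ln_2_less_1 by linarith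
    qed
    ultimately show ?thesis using C[OF n(1)] by (simp add: abs_le_iff)
  qed
  then show ?thesis by blast
qed

section \<open>Chain sets and the partition of unity\<close>

text \<open>In the sorted factorization of \<open>n\<close> this is the initial segment before the
  first copy of \<open>p\<close>, with which \<open>p\<close> is compared.\<close>

definition low_part :: "nat \<Rightarrow> nat \<Rightarrow> nat" where
  "low_part p n = (\<Prod>q | q \<in> prime_factors n \<and> q < p. q ^ multiplicity q n)"

text \<open>When \<open>\<theta> m \<ge> m\<close> and \<open>\<theta>\<close> is monotone, testing only the products of full prime powers below \<open>p\<close>
  amounts to testing all initial products of the sorted prime factorization with multiplicity.\<close>

definition chain_set :: "nat set \<Rightarrow> (nat \<Rightarrow> real) \<Rightarrow> nat set" where
  "chain_set P \<theta> = {n. n > 0 \<and> (\<forall>p\<in>prime_factors n. p \<in> P \<and> real p \<le> \<theta> (low_part p n))}"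

text \<open>The smooth truncation, indexed by a natural number so that the partition of unity can be
  proved by adding one candidate prime at a time.\<close>

definition chain_upto :: "nat set \<Rightarrow> (nat \<Rightarrow> real) \<Rightarrow> nat \<Rightarrow> nat set" where
  "chain_upto P \<theta> Y = {n \<in> chain_set P \<theta>. \<forall>p\<in>prime_factors n. p \<le> Y}"

text \<open>Reciprocal of a truncated Euler product; at \<open>s = 1\<close> it is the density of
  the integers without prime factors from \<open>P\<close> up to \<open>y\<close>.\<close>

definition euler_prod :: "nat set \<Rightarrow> real \<Rightarrow> real \<Rightarrow> real" where
  "euler_prod P s y = (\<Prod>p | p \<in> P \<and> prime p \<and> real p \<le> y. 1 - real p powr (-s))"

lemma multiplicity_low_part:
  assumes "prime q"
  shows "multiplicity q (low_part p n) = (if q < p then multiplicity q n else 0)"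
proof -
  have "multiplicity q (low_part p n) =
      (if q \<in> {q. q \<in> prime_factors n \<and> q < p} then multiplicity q n else 0)"
    unfolding low_part_def using assms
    by (intro multiplicity_prod_prime_powers) auto
  also have "\<dots> = (if q < p then multiplicity q n else 0)"
    using assms by (auto simp: prime_factors_multiplicity)
  finally show ?thesis .
qed

lemma low_part_pos [simp]: "low_part p n > 0"
  unfolding low_part_def by (intro prod_pos) (auto simp: prime_factors_gt_0_nat)

lemma low_part_dvd_mono:
  assumes "m dvd n" "n > 0"
  shows "low_part p m dvd low_part p n"
proof (rule multiplicity_le_imp_dvd)
  fix q :: nat assume "prime q"
  then show "multiplicity q (low_part p m) \<le> multiplicity q (low_part p n)"
    using assms by (auto simp: multiplicity_low_part intro: dvd_imp_multiplicity_le)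
qed auto

lemma low_part_cong:
  assumes "\<And>q. prime q \<Longrightarrow> q < p \<Longrightarrow> multiplicity q m = multiplicity q n"
  shows "low_part p m = low_part p n"
  by (rule multiplicity_eq_nat) (auto simp: multiplicity_low_part assms)

lemma low_part_dvd: "n > 0 \<Longrightarrow> low_part p n dvd n"
  by (rule multiplicity_le_imp_dvd) (auto simp: multiplicity_low_part)

lemma low_part_eq_self:
  assumes "n > 0" "\<And>q. q \<in> prime_factors n \<Longrightarrow> q < p"
  shows "low_part p n = n"
proof (rule multiplicity_eq_nat)
  fix q :: nat assume "prime q"
  then show "multiplicity q (low_part p n) = multiplicity q n"
    using assms(2)[of q] by (auto simp: multiplicity_low_part prime_factors_multiplicity)
qed (use assms in auto)

lemma low_part_mult_top:
  assumes "n > 0" "prime q" "\<And>p. p \<in> prime_factors n \<Longrightarrow> p \<le> q"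
  shows "low_part q n * q ^ multiplicity q n = n"
proof (rule multiplicity_eq_nat)
  fix p :: nat assume p: "prime p"
  show "multiplicity p (low_part q n * q ^ multiplicity q n) = multiplicity p n"
  proof (cases "p = q")
    case True
    then show ?thesis using p
      by (subst prime_elem_multiplicity_mult_distrib)
         (auto simp: multiplicity_low_part multiplicity_same_power)
  next
    case False
    then have "\<not> p dvd q ^ multiplicity q n"
      using assms p by (metis prime_dvd_power primes_dvd_imp_eq)
    then have "multiplicity p (low_part q n * q ^ multiplicity q n) = multiplicity p (low_part q n)"
      using p assms by (subst prime_elem_multiplicity_mult_distrib) (auto simp: not_dvd_imp_multiplicity_0)
    also have "\<dots> = multiplicity p n"
      using False p assms(3)[of p]
      by (cases "multiplicity p n = 0") (auto simp: multiplicity_low_part prime_factors_multiplicity)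
    finally show ?thesis .
  qed
qed (use assms prime_gt_0_nat in auto)

lemma low_part_dvdI:
  assumes "n > 0" "d dvd n" "\<And>q. q \<in> prime_factors d \<Longrightarrow> q < p"
  shows "d dvd low_part p n"
proof -
  have "d > 0" using assms by (auto intro: Nat.gr0I)
  then have "d = low_part p d" using assms by (simp add: low_part_eq_self)
  also have "\<dots> dvd low_part p n" using assms by (intro low_part_dvd_mono) auto
  finally show ?thesis .
qed

lemma prime_factors_low_part: "prime_factors (low_part p n) = {q \<in> prime_factors n. q < p}"
  by (auto simp: prime_factors_multiplicity multiplicity_low_part split: if_splits)

lemma low_part_low_part: "q \<le> p \<Longrightarrow> low_part q (low_part p n) = low_part q n"
  by (rule low_part_cong) (auto simp: multiplicity_low_part)

text \<open>The primes of an initial segment are tested against the same smaller segments as in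
  \<open>n\<close>.\<close>

lemma low_part_mem_chain_set: "n \<in> chain_set P \<theta> \<Longrightarrow> low_part p n \<in> chain_set P \<theta>"
  unfolding chain_set_def by (auto simp: prime_factors_low_part low_part_low_part)

lemma one_mem_chain_upto [simp]: "Suc 0 \<in> chain_upto P \<theta> Y"
  by (auto simp: chain_upto_def chain_set_def)

lemma chain_upto_0: "chain_upto P \<theta> 0 = {1}"
proof -
  have "n = 1" if "n \<in> chain_upto P \<theta> 0" for n
  proof (rule ccontr)
    assume "n \<noteq> 1"
    then obtain p where "prime p" "p dvd n" using prime_factor_nat by blast
    then have "p \<in> prime_factors n"
      using that by (auto simp: chain_upto_def chain_set_def in_prime_factors_iff)
    with that have "p \<le> 0" unfolding chain_upto_def by blast
    with \<open>prime p\<close> show False by simp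
  qed
  then show ?thesis by auto
qed

lemma chain_upto_Suc_not_prime:
  assumes "\<not> (prime (Suc Y) \<and> Suc Y \<in> P)"
  shows "chain_upto P \<theta> (Suc Y) = chain_upto P \<theta> Y"
  using assms by (auto simp: chain_upto_def chain_set_def le_Suc_eq)

text \<open>The inductive step on \<open>Y\<close>: a new largest prime \<open>q\<close> may be
  attached to \<open>m\<close> with any exponent if \<open>q \<le> \<theta> m\<close>, and not at
  all otherwise. The exponent is free because all copies of \<open>q\<close> share one test.\<close>

lemma bij_betw_chain_upto_Suc:
  assumes q: "prime (Suc Y)" "Suc Y \<in> P"
  shows "bij_betw (\<lambda>(m, k). m * Suc Y ^ k)
     (Sigma (chain_upto P \<theta> Y) (\<lambda>m. if real (Suc Y) \<le> \<theta> m then UNIV else {0}))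
     (chain_upto P \<theta> (Suc Y))"
proof (rule bij_betwI[where g = "\<lambda>n. (low_part (Suc Y) n, multiplicity (Suc Y) n)"])
  let ?q = "Suc Y"
  let ?S = "Sigma (chain_upto P \<theta> Y) (\<lambda>m. if real ?q \<le> \<theta> m then UNIV else {0})"
  have A: "low_part ?q (m * ?q ^ k) = m \<and> multiplicity ?q (m * ?q ^ k) = k"
    if "m \<in> chain_upto P \<theta> Y" for m k
  proof
    have m: "m > 0" "\<And>p. p \<in> prime_factors m \<Longrightarrow> p \<le> Y"
      using that by (auto simp: chain_upto_def chain_set_def)
    have "\<not> ?q dvd m" using m(2)[of ?q] m(1) q by (auto simp: in_prime_factors_iff)
    then show "multiplicity ?q (m * ?q ^ k) = k"
      using q m by (subst prime_elem_multiplicity_mult_distrib)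
        (auto simp: multiplicity_same_power not_dvd_imp_multiplicity_0)
    have "low_part ?q (m * ?q ^ k) = low_part ?q m"
    proof (rule low_part_cong)
      fix p assume "prime p" "p < ?q"
      then have "\<not> p dvd ?q ^ k" using q by (metis nat_neq_iff prime_dvd_power primes_dvd_imp_eq)
      then show "multiplicity p (m * ?q ^ k) = multiplicity p m"
        using \<open>prime p\<close> m by (subst prime_elem_multiplicity_mult_distrib)
          (auto simp: not_dvd_imp_multiplicity_0)
    qed
    also have "\<dots> = m" using m by (intro low_part_eq_self) (auto simp: less_Suc_eq_le)
    finally show "low_part ?q (m * ?q ^ k) = m" .
  qed
  have B: "low_part ?q n * ?q ^ multiplicity ?q n = n" if "n \<in> chain_upto P \<theta> ?q" for n
    using that q by (intro low_part_mult_top) (auto simp: chain_upto_def chain_set_def)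
  show "(\<lambda>(m, k). m * ?q ^ k) \<in> ?S \<rightarrow> chain_upto P \<theta> ?q"
  proof safe
    fix m k :: nat assume m: "m \<in> chain_upto P \<theta> Y" and k: "k \<in> (if real ?q \<le> \<theta> m then UNIV else {0})"
    have m': "m > 0" "\<And>p. p \<in> prime_factors m \<Longrightarrow> p \<le> Y"
      "\<And>p. p \<in> prime_factors m \<Longrightarrow> p \<in> P \<and> real p \<le> \<theta> (low_part p m)"
      using m by (auto simp: chain_upto_def chain_set_def)
    have "p \<le> ?q \<and> p \<in> P \<and> real p \<le> \<theta> (low_part p (m * ?q ^ k))"
      if p: "p \<in> prime_factors (m * ?q ^ k)" for p
    proof (cases "p = ?q")
      case True
      have "k \<noteq> 0" using p m'(2)[of p] True by (intro notI) auto
      then show ?thesis using k A[OF m, of k] True q by (auto split: if_splits)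
    next
      case False
      have "prime p" "p dvd m * ?q ^ k" using p by auto
      then have "p dvd m" using False q by (metis prime_dvd_mult_iff prime_dvd_power primes_dvd_imp_eq)
      then have "p \<in> prime_factors m" using \<open>prime p\<close> m' by (auto simp: in_prime_factors_iff)
      moreover from this have "p < ?q" using m' by (auto simp: less_Suc_eq_le)
      moreover have "low_part p (m * ?q ^ k) = low_part p m"
        using low_part_low_part[of p ?q "m * ?q ^ k"] A[OF m, of k] \<open>p < ?q\<close> by simp
      ultimately show ?thesis using m' by auto
    qed
    moreover have "m * ?q ^ k > 0" using m' by simp
    ultimately show "m * ?q ^ k \<in> chain_upto P \<theta> ?q"
      unfolding chain_upto_def chain_set_def by blast
  qed
  show "(\<lambda>n. (low_part ?q n, multiplicity ?q n)) \<in> chain_upto P \<theta> ?q \<rightarrow> ?S"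
  proof
    fix n assume n: "n \<in> chain_upto P \<theta> ?q"
    have "low_part ?q n \<in> chain_upto P \<theta> Y"
      using n low_part_mem_chain_set[of n P \<theta> ?q]
      by (auto simp: chain_upto_def prime_factors_low_part less_Suc_eq_le)
    moreover have "real ?q \<le> \<theta> (low_part ?q n)" if "multiplicity ?q n \<noteq> 0"
    proof -
      have "?q \<in> prime_factors n" using that q by (auto simp: prime_factors_multiplicity)
      then show ?thesis using n by (auto simp: chain_upto_def chain_set_def)
    qed
    ultimately show "(low_part ?q n, multiplicity ?q n) \<in> ?S" by auto
  qed
  show "(low_part ?q (case x of (m, k) \<Rightarrow> m * ?q ^ k), multiplicity ?q (case x of (m, k) \<Rightarrow> m * ?q ^ k)) = x"
    if "x \<in> ?S" for x using that A by (cases x) auto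
  show "(case (low_part ?q n, multiplicity ?q n) of (m, k) \<Rightarrow> m * ?q ^ k) = n"
    if "n \<in> chain_upto P \<theta> ?q" for n using B[OF that] by simp
qed

lemma finite_euler_set [simp, intro]: "finite {p. p \<in> P \<and> prime p \<and> real p \<le> y}"
  by (rule finite_subset[OF _ finite_primes_le[of y]]) auto

lemma powr_minus_less_1:
  assumes "p > 1" "s > 0"
  shows "0 < real p powr (-s)" "real p powr (-s) < 1"
proof -
  show "0 < real p powr (-s)" using assms by simp
  have "real p powr (-s) < real p powr 0" using assms by (intro powr_less_mono) auto
  then show "real p powr (-s) < 1" using assms by simp
qed

lemma euler_prod_pos: "s > 0 \<Longrightarrow> euler_prod P s y > 0"
  unfolding euler_prod_def using prime_gt_1_nat powr_minus_less_1(2)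
  by (intro prod_pos) (simp add: prime_gt_Suc_0_nat)

lemma euler_prod_Suc:
  assumes "prime (Suc Y)" "Suc Y \<in> P"
  shows "euler_prod P s (real (Suc Y)) = (1 - real (Suc Y) powr (-s)) * euler_prod P s (real Y)"
proof -
  have "{p. p \<in> P \<and> prime p \<and> real p \<le> real (Suc Y)} =
        insert (Suc Y) {p. p \<in> P \<and> prime p \<and> real p \<le> real Y}"
    using assms by (auto simp: le_Suc_eq)
  then show ?thesis unfolding euler_prod_def by simp
qed

lemma has_sum_geometric_powr:
  assumes "p > 1" "s > 0"
  shows "((\<lambda>k. real (p ^ k) powr (-s)) has_sum (1 / (1 - real p powr (-s)))) UNIV"
proof -
  have "(\<lambda>k. (real p powr (-s)) ^ k) sums (1 / (1 - real p powr (-s)))"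
    using powr_minus_less_1[OF assms] by (intro geometric_sums) auto
  moreover have "real (p ^ k) powr (-s) = (real p powr (-s)) ^ k" for k
    using assms by (simp add: powr_realpow[symmetric] powr_powr mult.commute)
  ultimately show ?thesis
    by (intro sums_nonneg_imp_has_sum) auto
qed

text \<open>If every integer is split as \<open>m r\<close> with \<open>m\<close> its longest initial segment in the chain set,
  then \<open>r\<close> runs over the integers free of primes up to \<open>\<theta> m\<close>; dividing the resulting decomposition
  of the Euler product by that product gives this partition of unity, valid for all \<open>s > 0\<close>.\<close>

theorem has_sum_chain_upto:
  assumes mono: "\<And>m k. m > 0 \<Longrightarrow> k > 0 \<Longrightarrow> \<theta> m \<le> \<theta> (m * k)" and s: "s > 0"
  shows "((\<lambda>m. real m powr (-s) * euler_prod P s (min (\<theta> m) (real Y))) has_sum 1) (chain_upto P \<theta> Y)"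
proof (induction Y)
  case 0
  have "euler_prod P s (min (\<theta> 1) 0) = 1"
    unfolding euler_prod_def by (intro prod.neutral) (auto dest: prime_gt_0_nat)
  then show ?case unfolding chain_upto_0 by (intro has_sum_finiteI) auto
next
  case (Suc Y)
  have low: "euler_prod P s (min t (real (Suc Y))) = euler_prod P s (min t (real Y))"
    if "\<not> (prime (Suc Y) \<and> Suc Y \<in> P \<and> real (Suc Y) \<le> t)" for t
  proof -
    have "{p. p \<in> P \<and> prime p \<and> real p \<le> min t (real (Suc Y))} =
          {p. p \<in> P \<and> prime p \<and> real p \<le> min t (real Y)}"
    proof -
      have "real p \<le> real (Suc Y) \<longleftrightarrow> real p \<le> real Y \<or> p = Suc Y" for p
        by (simp only: of_nat_le_iff le_Suc_eq)
      then show ?thesis using that by auto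
    qed
    then show ?thesis unfolding euler_prod_def by simp
  qed
  show ?case
  proof (cases "prime (Suc Y) \<and> Suc Y \<in> P")
    case False
    then have "euler_prod P s (min t (real (Suc Y))) = euler_prod P s (min t (real Y))" for t
      using low by blast
    then show ?thesis using Suc False by (simp add: chain_upto_Suc_not_prime del: of_nat_Suc)
  next
    case True
    define q where "q = Suc Y"
    have q: "prime q" "q \<in> P" "q > 1" using True prime_gt_1_nat unfolding q_def by auto
    define F where "F = (\<lambda>m. real m powr (-s) * euler_prod P s (min (\<theta> m) (real q)))"
    define B where "B = (\<lambda>m. if real q \<le> \<theta> m then UNIV else {0::nat})"
    \<comment> \<open>Each \<open>m\<close> passes its old weight on to its extensions: if
      \<open>q \<le> \<theta> m\<close>, monotonicity of \<open>\<theta>\<close> makes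
      \<open>q\<close> the cut-off for every \<open>m q ^ k\<close>, and the geometric series in
      \<open>k\<close> cancels the new Euler factor; otherwise nothing changes.\<close>
    have inner: "((\<lambda>k. F (m * q ^ k)) has_sum
        (real m powr (-s) * euler_prod P s (min (\<theta> m) (real Y)))) (B m)"
      if m: "m \<in> chain_upto P \<theta> Y" for m
    proof (cases "real q \<le> \<theta> m")
      case False
      then show ?thesis using low[of "\<theta> m"]
        by (intro has_sum_finiteI) (auto simp: B_def F_def q_def)
    next
      case True
      have "m > 0" using m by (auto simp: chain_upto_def chain_set_def)
      have "F (m * q ^ k) = (real m powr (-s) * euler_prod P s (real q)) * real (q ^ k) powr (-s)" for k
      proof -
        have "\<theta> m \<le> \<theta> (m * q ^ k)" using mono[of m "q ^ k"] \<open>m > 0\<close> q by simp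
        then have "min (\<theta> (m * q ^ k)) (real q) = real q" using True by simp
        then show ?thesis by (simp add: F_def powr_mult)
      qed
      moreover have "((\<lambda>k. (real m powr (-s) * euler_prod P s (real q)) * real (q ^ k) powr (-s)) has_sum
          ((real m powr (-s) * euler_prod P s (real q)) * (1 / (1 - real q powr (-s))))) UNIV"
        by (intro has_sum_cmult_right has_sum_geometric_powr q s)
      moreover have "euler_prod P s (real q) = (1 - real q powr (-s)) * euler_prod P s (real Y)"
        using q euler_prod_Suc[of Y P s] unfolding q_def by blast
      moreover have "1 - real q powr (-s) \<noteq> 0" using powr_minus_less_1[of q s] q s by simp
      moreover have "min (\<theta> m) (real Y) = real Y" using True unfolding q_def by simp
      ultimately show ?thesis using True by (simp add: B_def)
    qed
    have "((\<lambda>x. F (case x of (m, k) \<Rightarrow> m * q ^ k)) has_sum 1) (Sigma (chain_upto P \<theta> Y) B)"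
    proof (rule has_sum_SigmaI)
      show "((\<lambda>k. F (case (m, k) of (m, k) \<Rightarrow> m * q ^ k)) has_sum
          (real m powr (-s) * euler_prod P s (min (\<theta> m) (real Y)))) (B m)"
        if "m \<in> chain_upto P \<theta> Y" for m using inner[OF that] by simp
      show "((\<lambda>m. real m powr (-s) * euler_prod P s (min (\<theta> m) (real Y))) has_sum 1) (chain_upto P \<theta> Y)"
        by (rule Suc)
      show "(\<lambda>x. F (case x of (m, k) \<Rightarrow> m * q ^ k)) summable_on Sigma (chain_upto P \<theta> Y) B"
      proof (rule summable_on_SigmaI)
        show "((\<lambda>k. F (case (m, k) of (m, k) \<Rightarrow> m * q ^ k)) has_sum
            (real m powr (-s) * euler_prod P s (min (\<theta> m) (real Y)))) (B m)"
          if "m \<in> chain_upto P \<theta> Y" for m using inner[OF that] by simp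
        show "(\<lambda>m. real m powr (-s) * euler_prod P s (min (\<theta> m) (real Y))) summable_on chain_upto P \<theta> Y"
          using Suc by (rule has_sum_imp_summable)
        show "0 \<le> F (case (m, k) of (m, k) \<Rightarrow> m * q ^ k)" for m k
          unfolding F_def using euler_prod_pos[OF s] by (simp add: less_imp_le)
      qed
    qed
    then have "(F has_sum 1) (chain_upto P \<theta> q)"
      using has_sum_reindex_bij_betw[OF bij_betw_chain_upto_Suc[of Y P \<theta>], of F 1] True
      unfolding q_def B_def by blast
    then show ?thesis unfolding F_def q_def .
  qed
qed

section \<open>Euler products over a set of primes of full density\<close>

lemma ln_diff_bounds:
  fixes a b :: real
  assumes "0 < b" "b \<le> a"
  shows "(a - b) / a \<le> ln a - ln b" "ln a - ln b \<le> (a - b) / b"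
proof -
  have "ln (b / a) \<le> b / a - 1" using assms by (intro ln_le_minus_one) auto
  then show "(a - b) / a \<le> ln a - ln b" using assms by (simp add: ln_div diff_divide_distrib)
  have "ln (a / b) \<le> a / b - 1" using assms by (intro ln_le_minus_one) auto
  then show "ln a - ln b \<le> (a - b) / b" using assms by (simp add: ln_div diff_divide_distrib)
qed

lemma one_minus_exp_ge:
  fixes x :: real
  assumes "x \<ge> 0"
  shows "x - x\<^sup>2 / 2 \<le> 1 - exp (-x)"
proof -
  have "((\<lambda>x. 1 - exp (-x) - x + x\<^sup>2 / 2) has_real_derivative (exp (-t) - 1 + t)) (at t)" for t :: real
    by (auto intro!: derivative_eq_intros)
  moreover have "exp (-t) - 1 + t \<ge> 0" for t :: real using exp_ge_add_one_self[of "-t"] by linarith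
  ultimately have "\<exists>y. ((\<lambda>x. 1 - exp (-x) - x + x\<^sup>2 / 2) has_real_derivative y) (at t) \<and> y \<ge> 0" for t :: real
    by blast
  from DERIV_nonneg_imp_nondecreasing[OF assms this] show ?thesis by simp
qed

text \<open>Mertens' estimate is all that is assumed about \<open>P\<close>, so the same arguments
  serve for all primes and for the primes other than 3 and 5.\<close>

locale prime_density =
  fixes P :: "nat set" and C\<^sub>1 :: real
  assumes C1_nonneg: "C\<^sub>1 \<ge> 0"
    and mertens: "\<And>y. y \<ge> 1 \<Longrightarrow>
      \<bar>(\<Sum>p | p \<in> P \<and> prime p \<and> real p \<le> y. ln (real p) / real p) - ln y\<bar> \<le> C\<^sub>1"
begin

abbreviation primes_le :: "real \<Rightarrow> nat set" where
  "primes_le y \<equiv> {p. p \<in> P \<and> prime p \<and> real p \<le> y}"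

lemma primes_leD: "p \<in> primes_le y \<Longrightarrow> real p \<ge> 2 \<and> real p \<le> y \<and> p > 1"
  using prime_ge_2_nat[of p] prime_gt_1_nat[of p] by simp

lemma sum_ln_over_le: "y \<ge> 1 \<Longrightarrow> (\<Sum>p\<in>primes_le y. ln (real p) / real p) \<le> ln y + C\<^sub>1"
  and sum_ln_over_ge: "y \<ge> 1 \<Longrightarrow> ln y - C\<^sub>1 \<le> (\<Sum>p\<in>primes_le y. ln (real p) / real p)"
  using mertens[of y] by (auto simp: abs_le_iff)

lemma sum_ln_over_pred_le:
  "\<exists>C\<ge>0. \<forall>y\<ge>1. (\<Sum>p\<in>primes_le y. ln (real p) / (real p - 1)) \<le> ln y + C"
proof -
  obtain C where C: "C > 0" "\<And>F::nat set. finite F \<Longrightarrow> F \<subseteq> {2..} \<Longrightarrow>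
      (\<Sum>k\<in>F. ln (real k) / (real k * (real k - 1))) \<le> C"
    using bounded_sum_ln_over_square by blast
  have "(\<Sum>p\<in>primes_le y. ln (real p) / (real p - 1)) \<le> ln y + (C\<^sub>1 + C)" if "y \<ge> 1" for y
  proof -
    have "(\<Sum>p\<in>primes_le y. ln (real p) / (real p - 1)) =
      (\<Sum>p\<in>primes_le y. ln (real p) / real p + ln (real p) / (real p * (real p - 1)))"
    proof (intro sum.cong refl)
      fix p assume "p \<in> primes_le y"
      then have "real p \<ge> 2" using primes_leD by blast
      then show "ln (real p) / (real p - 1) = ln (real p) / real p + ln (real p) / (real p * (real p - 1))"
        by (simp add: field_simps)
    qed
    also have "\<dots> \<le> (ln y + C\<^sub>1) + C"
      unfolding sum.distrib using that C(2)[of "primes_le y"] prime_ge_2_nat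
      by (intro add_mono sum_ln_over_le) auto
    finally show ?thesis by simp
  qed
  then show ?thesis using C(1) C1_nonneg by (intro exI[of _ "C\<^sub>1 + C"]) auto
qed

section \<open>Mertens' second and third theorems for the prime set\<close>

lemma primes_le_Suc:
  "primes_le (real (Suc n)) = (if prime (Suc n) \<and> Suc n \<in> P then insert (Suc n) (primes_le (real n))
     else primes_le (real n))"
  by (simp only: of_nat_le_iff le_Suc_eq) auto

text \<open>Partial summation as an induction: a step adds
  \<open>(s (n + 1) - s n) / ln (n + 1)\<close>, and with \<open>s n = ln n + e\<close> the errors
  telescope in \<open>1 / ln n\<close>. Bounding the increment of \<open>ln ln\<close> by
  \<open>(a - b) / a\<close> from above costs a further \<open>1 / b - 1 / a\<close>, hence
  \<open>C\<^sub>1 + 1\<close> in the lower bound.\<close>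

lemma sum_inverse_primes_aux:
  fixes s T :: "nat \<Rightarrow> real"
  defines "s \<equiv> \<lambda>n. \<Sum>p\<in>primes_le (real n). ln (real p) / real p"
    and "T \<equiv> \<lambda>n. \<Sum>p\<in>primes_le (real n). 1 / real p"
  assumes "n \<ge> 2"
  shows "T n \<le> ln (ln n) + (s n - ln n) / ln n + C\<^sub>1 * (1 / ln 2 - 1 / ln n)
            + (1 / 2 - ln (ln 2) + C\<^sub>1 / ln 2)" (is "?U n")
    and "T n \<ge> ln (ln n) + (s n - ln n) / ln n - (C\<^sub>1 + 1) * (1 / ln 2 - 1 / ln n)
            - (ln (ln 2) + C\<^sub>1 / ln 2)" (is "?L n")
proof -
  have "?U n \<and> ?L n" using \<open>n \<ge> 2\<close>
  proof (induction n rule: nat_induct_at_least)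
    case base
    have "primes_le (real 2) \<subseteq> {2}" using prime_ge_2_nat by (auto intro: antisym)
    then have "T 2 \<le> (\<Sum>p\<in>{2::nat}. 1 / real p)" unfolding T_def by (intro sum_mono2) auto
    then have "T 2 \<le> 1 / 2" by simp
    moreover have "T 2 \<ge> 0" unfolding T_def by (intro sum_nonneg) auto
    moreover have "\<bar>s 2 - ln 2\<bar> \<le> C\<^sub>1" using mertens[of 2] unfolding s_def by simp
    then have "s 2 - ln 2 \<le> C\<^sub>1" "- C\<^sub>1 \<le> s 2 - ln 2" by linarith+
    then have "(s 2 - ln 2) / ln 2 \<le> C\<^sub>1 / ln 2" "- C\<^sub>1 / ln 2 \<le> (s 2 - ln 2) / ln 2"
      by (intro divide_right_mono; simp)+
    ultimately show ?case by auto
  next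
    case (Suc n)
    define a b where "a = ln (real (Suc n))" and "b = ln (real n)"
    have b: "b > 0" and ab: "b \<le> a" using Suc.hyps unfolding a_def b_def by auto
    have ab1: "a - b \<le> 1"
    proof -
      have "a - b \<le> (real (Suc n) - real n) / real n"
        unfolding a_def b_def using Suc.hyps by (intro ln_diff_bounds) auto
      also have "\<dots> \<le> 1" using Suc.hyps by simp
      finally show ?thesis .
    qed
    have T: "T (Suc n) = T n + (s (Suc n) - s n) / a"
      unfolding T_def s_def a_def using Suc.hyps
      by (subst (1 2) primes_le_Suc) auto
    define e e' where "e = s n - b" and "e' = s (Suc n) - a"
    have e: "\<bar>e\<bar> \<le> C\<^sub>1" using mertens[of "real n"] Suc.hyps unfolding e_def s_def b_def by simp
    have r: "0 \<le> 1 / b - 1 / a" using b ab by (simp add: frac_le)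
    have T': "T (Suc n) = T n + (a - b) / a + e' / a - e / a"
      using b ab unfolding T e_def e'_def by (simp add: field_simps)
    have "e * (1 / b - 1 / a) \<le> C\<^sub>1 * (1 / b - 1 / a)" "- (C\<^sub>1 * (1 / b - 1 / a)) \<le> e * (1 / b - 1 / a)"
      using mult_right_mono[OF _ r, of e C\<^sub>1] mult_right_mono[OF _ r, of "-C\<^sub>1" e] e by auto
    then have ee: "e / b - e / a \<le> C\<^sub>1 / b - C\<^sub>1 / a" "- (C\<^sub>1 / b - C\<^sub>1 / a) \<le> e / b - e / a"
      by (simp_all add: algebra_simps)
    have l1: "(a - b) / a \<le> ln a - ln b" by (intro ln_diff_bounds) (use b ab in auto)
    have "ln a - ln b \<le> (a - b) / b" by (intro ln_diff_bounds) (use b ab in auto)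
    also have "\<dots> = (a - b) / a + (a - b) * (1 / b - 1 / a)" using b ab by (simp add: field_simps)
    also have "\<dots> \<le> (a - b) / a + 1 * (1 / b - 1 / a)"
      using ab1 r by (intro add_left_mono mult_right_mono) auto
    finally have l2: "ln a - ln b \<le> (a - b) / a + (1 / b - 1 / a)" by simp
    have IH: "T n \<le> ln b + e / b + (C\<^sub>1 / ln 2 - C\<^sub>1 / b) + (1 / 2 - ln (ln 2) + C\<^sub>1 / ln 2)"
      "T n \<ge> ln b + e / b - ((C\<^sub>1 + 1) / ln 2 - C\<^sub>1 / b - 1 / b) - (ln (ln 2) + C\<^sub>1 / ln 2)"
      using Suc.IH unfolding e_def b_def by (simp_all add: algebra_simps add_divide_distrib)
    have "T (Suc n) \<le> ln a + e' / a + (C\<^sub>1 / ln 2 - C\<^sub>1 / a) + (1 / 2 - ln (ln 2) + C\<^sub>1 / ln 2)"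
      using T' IH l1 ee by linarith
    moreover have "T (Suc n) \<ge> ln a + e' / a - ((C\<^sub>1 + 1) / ln 2 - C\<^sub>1 / a - 1 / a) - (ln (ln 2) + C\<^sub>1 / ln 2)"
      using T' IH l2 ee by linarith
    ultimately show ?case unfolding e'_def a_def
      by (simp_all add: algebra_simps add_divide_distrib)
  qed
  then show "?U n" "?L n" by auto
qed

lemma sum_inverse_primes:
  "\<exists>C. \<forall>n\<ge>2. \<bar>(\<Sum>p\<in>primes_le (real n). 1 / real p) - ln (ln (real n))\<bar> \<le> C"
proof -
  define K where "K = 1 / 2 + \<bar>ln (ln 2)\<bar> + (3 * C\<^sub>1 + 1) / ln (2::real)"
  have "\<bar>(\<Sum>p\<in>primes_le (real n). 1 / real p) - ln (ln (real n))\<bar> \<le> K" if n: "n \<ge> 2" for n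
  proof -
    define s where "s = (\<Sum>p\<in>primes_le (real n). ln (real p) / real p)"
    define T where "T = (\<Sum>p\<in>primes_le (real n). 1 / real p)"
    define a where "a = ln (real n)"
    have a: "a \<ge> ln 2" "a > 0" using n unfolding a_def by auto
    have ia: "0 < 1 / a" "1 / a \<le> 1 / ln 2" using a by (auto simp: frac_le)
    have "\<bar>s - a\<bar> \<le> C\<^sub>1" using mertens[of "real n"] n unfolding s_def a_def by simp
    then have "\<bar>(s - a) / a\<bar> \<le> C\<^sub>1 / a" using a by (simp add: divide_right_mono)
    also have "\<dots> \<le> C\<^sub>1 / ln 2" using a C1_nonneg by (intro divide_left_mono) auto
    finally have e: "\<bar>(s - a) / a\<bar> \<le> C\<^sub>1 / ln 2" .
    have "C\<^sub>1 * (1 / ln 2 - 1 / a) \<le> C\<^sub>1 * (1 / ln 2)"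
      "(C\<^sub>1 + 1) * (1 / ln 2 - 1 / a) \<le> (C\<^sub>1 + 1) * (1 / ln 2)"
      using ia C1_nonneg by (intro mult_left_mono; simp)+
    then have "C\<^sub>1 * (1 / ln 2 - 1 / a) \<le> C\<^sub>1 / ln 2"
      "(C\<^sub>1 + 1) * (1 / ln 2 - 1 / a) \<le> C\<^sub>1 / ln 2 + 1 / ln 2" by (simp_all add: add_divide_distrib)
    moreover have "T \<le> ln a + (s - a) / a + C\<^sub>1 * (1 / ln 2 - 1 / a) + (1 / 2 - ln (ln 2) + C\<^sub>1 / ln 2)"
      "T \<ge> ln a + (s - a) / a - (C\<^sub>1 + 1) * (1 / ln 2 - 1 / a) - (ln (ln 2) + C\<^sub>1 / ln 2)"
      using sum_inverse_primes_aux[OF n] unfolding T_def s_def a_def by auto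
    moreover have "K = 1 / 2 + \<bar>ln (ln 2)\<bar> + 3 * (C\<^sub>1 / ln 2) + 1 / ln 2"
      unfolding K_def by (simp add: add_divide_distrib)
    moreover have "1 / ln (2::real) > 0" "C\<^sub>1 / ln 2 \<ge> 0" using C1_nonneg by auto
    ultimately have "\<bar>T - ln a\<bar> \<le> K" using e by linarith
    then show ?thesis unfolding T_def a_def .
  qed
  then show ?thesis by blast
qed

text \<open>\<open>1 - x \<le> exp (-x)\<close> gives the upper bound. For the lower one,
  \<open>1 - 1 / p\<close> is the inverse of \<open>1 + 1 / (p - 1)\<close>, and
  \<open>1 / (p - 1)\<close> exceeds \<open>1 / p\<close> by a summable amount.\<close>

lemma euler_prod_1_bounds_exp:
  shows "euler_prod P 1 y \<le> exp (- (\<Sum>p\<in>primes_le y. 1 / real p))"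
    and "\<exists>C. \<forall>y. exp (- (\<Sum>p\<in>primes_le y. 1 / real p) - C) \<le> euler_prod P 1 y"
proof -
  have "euler_prod P 1 y \<le> (\<Prod>p\<in>primes_le y. exp (- (1 / real p)))"
    unfolding euler_prod_def
  proof (intro prod_mono conjI)
    fix p assume "p \<in> primes_le y"
    then have p: "real p \<ge> 2" using primes_leD by blast
    then show "0 \<le> 1 - real p powr (- 1)" by (simp add: powr_minus_divide)
    show "1 - real p powr (- 1) \<le> exp (- (1 / real p))"
      using exp_ge_add_one_self[of "- (1 / real p)"] p by (simp add: powr_minus_divide)
  qed
  then show "euler_prod P 1 y \<le> exp (- (\<Sum>p\<in>primes_le y. 1 / real p))"
    by (simp add: exp_sum sum_negf[symmetric] del: sum_negf)
  obtain C where C: "C > 0" "\<And>F::nat set. finite F \<Longrightarrow> F \<subseteq> {2..} \<Longrightarrow>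
      (\<Sum>k\<in>F. ln (real k) / (real k * (real k - 1))) \<le> C"
    using bounded_sum_ln_over_square by blast
  have "exp (- (\<Sum>p\<in>primes_le y. 1 / real p) - C / ln 2) \<le> euler_prod P 1 y" for y
  proof -
    have "(\<Sum>p\<in>primes_le y. 1 / (real p * (real p - 1))) \<le>
          (\<Sum>p\<in>primes_le y. ln (real p) / (real p * (real p - 1)) / ln 2)"
    proof (intro sum_mono)
      fix p assume "p \<in> primes_le y"
      then have p: "real p \<ge> 2" using primes_leD by blast
      then have "ln (real p) / ln 2 \<ge> 1" by simp
      then have "1 / (real p * (real p - 1)) \<le> (ln (real p) / ln 2) / (real p * (real p - 1))"
        using p by (intro divide_right_mono) auto
      then show "1 / (real p * (real p - 1)) \<le> ln (real p) / (real p * (real p - 1)) / ln 2"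
        by (simp add: mult.commute)
    qed
    also have "\<dots> \<le> C / ln 2"
      unfolding sum_divide_distrib[symmetric] using prime_ge_2_nat
      by (intro divide_right_mono C) auto
    finally have "exp (- (\<Sum>p\<in>primes_le y. 1 / real p) - C / ln 2) \<le>
      exp (\<Sum>p\<in>primes_le y. - (1 / real p) - 1 / (real p * (real p - 1)))"
      by (simp add: sum_subtractf sum_negf)
    also have "\<dots> = (\<Prod>p\<in>primes_le y. exp (- (1 / real p) - 1 / (real p * (real p - 1))))"
      by (simp add: exp_sum)
    also have "\<dots> \<le> euler_prod P 1 y"
      unfolding euler_prod_def
    proof (intro prod_mono conjI)
      fix p assume "p \<in> primes_le y"
      then have p: "real p \<ge> 2" using primes_leD by blast
      have "- (1 / real p) - 1 / (real p * (real p - 1)) = - (1 / (real p - 1))"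
        using p by (simp add: field_simps)
      moreover have "real p / (real p - 1) \<le> exp (1 / (real p - 1))"
        using exp_ge_add_one_self[of "1 / (real p - 1)"] p by (simp add: field_simps)
      then have "exp (- (1 / (real p - 1))) \<le> inverse (real p / (real p - 1))"
        unfolding exp_minus using p by (intro le_imp_inverse_le) auto
      moreover have "inverse (real p / (real p - 1)) = 1 - real p powr (-1)"
        using p by (simp add: field_simps powr_minus_divide)
      ultimately show "exp (- (1 / real p) - 1 / (real p * (real p - 1))) \<le> 1 - real p powr (-1)"
        by simp
    qed auto
    finally show ?thesis .
  qed
  then show "\<exists>C. \<forall>y. exp (- (\<Sum>p\<in>primes_le y. 1 / real p) - C) \<le> euler_prod P 1 y" by blast
qed

text \<open>Mertens' third theorem up to constants; \<open>1 + ln y\<close> in place of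
  \<open>ln y\<close> makes it valid from \<open>y = 1\<close> on, where the product is
  empty.\<close>

theorem euler_prod_1_bounds:
  "\<exists>c C. 0 < c \<and> c \<le> 1 \<and> 0 < C \<and> (\<forall>y\<ge>1. c / (1 + ln y) \<le> euler_prod P 1 y \<and> euler_prod P 1 y \<le> C / (1 + ln y))"
proof -
  obtain K where K: "\<And>n. n \<ge> 2 \<Longrightarrow> \<bar>(\<Sum>p\<in>primes_le (real n). 1 / real p) - ln (ln (real n))\<bar> \<le> K"
    using sum_inverse_primes by blast
  obtain D where D: "\<And>y. exp (- (\<Sum>p\<in>primes_le y. 1 / real p) - D) \<le> euler_prod P 1 y"
    using euler_prod_1_bounds_exp(2) by blast
  have K0: "K \<ge> 0" using K[of 2] by linarith
  define C where "C = 4 * exp K"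
  define c where "c = min 1 (exp (-K - D))"
  have "c / (1 + ln y) \<le> euler_prod P 1 y \<and> euler_prod P 1 y \<le> C / (1 + ln y)" if y: "y \<ge> 1" for y
  proof (cases "y < 2")
    case True
    have "p \<notin> primes_le y" for p using True primes_leD[of p y] by linarith
    then have empty: "primes_le y = {}" by blast
    have "euler_prod P 1 y = 1" unfolding euler_prod_def empty by simp
    moreover have "c \<le> 1" "ln y \<ge> 0" unfolding c_def using y by auto
    then have "c / (1 + ln y) \<le> 1" by simp
    moreover have "ln y \<le> y - 1" using y by (intro ln_le_minus_one) auto
    then have "1 + ln y \<le> C" using True K0 unfolding C_def
      by (intro order.trans[of "1 + ln y" "4 * 1" "4 * exp K"] mult_left_mono) auto
    moreover have "1 + ln y > 0" using y by (simp add: add_pos_nonneg)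
    ultimately show ?thesis by (simp add: le_divide_eq)
  next
    case False
    \<comment> \<open>The set of primes does not change between \<open>n\<close> and
      \<open>y\<close>, and \<open>ln n\<close> and \<open>1 + ln y\<close> agree up to the factor 4
      for \<open>n \<ge> 2\<close>.\<close>
    define n where "n = nat \<lfloor>y\<rfloor>"
    have n2: "n \<ge> 2" using False unfolding n_def by linarith
    have n: "real n \<le> y" "y < real n + 1" using y n2 unfolding n_def by linarith+
    have eq: "primes_le y = primes_le (real n)" using n by force
    define a where "a = ln (real n)"
    have a0: "a > 0" and a2: "a \<ge> ln 2" using n2 unfolding a_def by auto
    have T: "\<bar>(\<Sum>p\<in>primes_le y. 1 / real p) - ln a\<bar> \<le> K" unfolding eq a_def by (rule K[OF n2])
    have a1: "a \<le> 1 + ln y"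
    proof -
      have "a \<le> ln y" using n n2 unfolding a_def by simp
      then show ?thesis by simp
    qed
    have a4: "1 + ln y \<le> 4 * a"
    proof -
      have "y \<le> 2 * real n" using n n2 by linarith
      then have "ln y \<le> ln (2 * real n)"
        by (rule iffD2[OF ln_le_cancel_iff, rotated 2]) (use y n n2 in linarith)+
      then have "ln y \<le> ln 2 + a" using n2 by (simp add: ln_mult a_def)
      moreover have "ln 2 \<ge> (2/3 :: real)" using ln2_ge_two_thirds by simp
      ultimately show ?thesis using a2 by linarith
    qed
    have "c / (1 + ln y) \<le> exp (- K - D) / a"
      using a0 a1 unfolding c_def by (intro frac_le) auto
    also have "\<dots> = exp (- (ln a + K) - D)"
      using a0 by (simp add: exp_diff exp_minus exp_add field_simps)
    also have "\<dots> \<le> exp (- (\<Sum>p\<in>primes_le y. 1 / real p) - D)" using T by (simp add: abs_le_iff)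
    also have "\<dots> \<le> euler_prod P 1 y" by (rule D)
    finally have "c / (1 + ln y) \<le> euler_prod P 1 y" .
    moreover have "euler_prod P 1 y \<le> exp (- (\<Sum>p\<in>primes_le y. 1 / real p))"
      by (rule euler_prod_1_bounds_exp)
    moreover have "\<dots> \<le> exp (- (ln a - K))" using T by (simp add: abs_le_iff)
    moreover have "exp (- (ln a - K)) = exp K / a" using a0 by (simp add: exp_diff)
    moreover have "exp K / a \<le> C / (1 + ln y)"
    proof -
      have "1 + ln y > 0" using y by (simp add: add_pos_nonneg)
      then have "4 * exp K / (4 * a) \<le> 4 * exp K / (1 + ln y)"
        using a0 a4 by (intro divide_left_mono) auto
      then show ?thesis unfolding C_def by simp
    qed
    ultimately show ?thesis by linarith
  qed
  moreover have "0 < c" "c \<le> 1" "0 < C" unfolding c_def C_def by auto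
  ultimately show ?thesis by blast
qed

section \<open>Euler products near s = 1 compared with s = 1\<close>

lemma euler_prod_ratio_le:
  assumes "\<epsilon> \<ge> 0"
  shows "euler_prod P (1 + \<epsilon>) y \<le>
    euler_prod P 1 y * exp (\<Sum>p\<in>primes_le y. (1 - exp (- (\<epsilon> * ln (real p)))) / (real p - 1))"
proof -
  have "euler_prod P (1 + \<epsilon>) y \<le> (\<Prod>p\<in>primes_le y. (1 - real p powr (-1)) *
      exp ((1 - exp (- (\<epsilon> * ln (real p)))) / (real p - 1)))"
    unfolding euler_prod_def
  proof (intro prod_mono conjI)
    fix p assume "p \<in> primes_le y"
    then have p: "real p \<ge> 2" "p > 1" using primes_leD by blast+
    define x where "x = exp (- (\<epsilon> * ln (real p)))"
    have e: "real p powr (- (1 + \<epsilon>)) = x / real p"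
      using p by (simp add: powr_def x_def distrib_right exp_diff exp_minus field_simps)
    show "0 \<le> 1 - real p powr (- (1 + \<epsilon>))"
      using powr_minus_less_1[OF p(2), of "1 + \<epsilon>"] assms by simp
    \<comment> \<open>With \<open>x = p powr (-\<epsilon>)\<close> the factor at
      \<open>1 + \<epsilon>\<close> is exactly the factor at 1 times a correction.\<close>
    have "1 - x / real p = (1 - 1 / real p) * (1 + (1 - x) / (real p - 1))"
      using p by (simp add: field_simps)
    also have "\<dots> \<le> (1 - 1 / real p) * exp ((1 - x) / (real p - 1))"
      using p exp_ge_add_one_self[of "(1 - x) / (real p - 1)"] by (intro mult_left_mono) auto
    finally show "1 - real p powr (- (1 + \<epsilon>)) \<le> (1 - real p powr (-1)) *
      exp ((1 - exp (- (\<epsilon> * ln (real p)))) / (real p - 1))"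
      using p unfolding e x_def[symmetric] by (simp add: powr_minus_divide)
  qed
  then show ?thesis by (simp add: prod.distrib exp_sum euler_prod_def)
qed

lemma euler_prod_ratio_ge:
  assumes "\<epsilon> \<ge> 0"
  shows "euler_prod P 1 y * exp (\<Sum>p\<in>primes_le y. (1 - exp (- (\<epsilon> * ln (real p)))) / real p)
    \<le> euler_prod P (1 + \<epsilon>) y"
proof -
  have "(\<Prod>p\<in>primes_le y. (1 - real p powr (-1)) *
      exp ((1 - exp (- (\<epsilon> * ln (real p)))) / real p)) \<le> euler_prod P (1 + \<epsilon>) y"
    unfolding euler_prod_def
  proof (intro prod_mono conjI)
    fix p assume "p \<in> primes_le y"
    then have p: "real p \<ge> 2" "p > 1" using primes_leD by blast+
    define x where "x = exp (- (\<epsilon> * ln (real p)))"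
    have x: "0 < x" "x \<le> 1" using assms p unfolding x_def by auto
    have e: "real p powr (- (1 + \<epsilon>)) = x / real p"
      using p by (simp add: powr_def x_def distrib_right exp_diff exp_minus field_simps)
    show "0 \<le> (1 - real p powr (-1)) * exp ((1 - exp (- (\<epsilon> * ln (real p)))) / real p)"
      using powr_minus_less_1[OF p(2), of 1] by (intro mult_nonneg_nonneg) auto
    define t u where "t = (1 - x) / real p" and "u = 1 - 1 / real p"
    have t: "0 \<le> t" "t \<le> 1 / real p" using x p unfolding t_def by (auto simp: divide_right_mono)
    have u: "0 \<le> u" using p unfolding u_def by auto
    \<comment> \<open>As \<open>u = 1 - 1 / p\<close>, the right side is
      \<open>(1 - t) (u + t)\<close>; bounding \<open>1 - t\<close> by \<open>exp (-t)\<close> then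
      yields \<open>u exp t \<le> u + t\<close>.\<close>
    have "u \<le> u + t * (1 / real p - t)" using t by simp
    also have "\<dots> = (1 - t) * (u + t)" unfolding u_def by (simp add: algebra_simps diff_divide_distrib)
    also have "\<dots> \<le> exp (- t) * (u + t)"
      using exp_ge_add_one_self[of "-t"] t u by (intro mult_right_mono) auto
    finally have "u * exp t \<le> exp (-t) * (u + t) * exp t" by (intro mult_right_mono) auto
    also have "\<dots> = u + t" by (simp add: exp_minus field_simps)
    also have "\<dots> = 1 - x / real p" unfolding u_def t_def by (simp add: diff_divide_distrib)
    finally show "(1 - real p powr (-1)) * exp ((1 - exp (- (\<epsilon> * ln (real p)))) / real p) \<le>
      1 - real p powr (- (1 + \<epsilon>))"
      using p unfolding e x_def[symmetric] u_def t_def by (simp add: powr_minus_divide)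
  qed
  then show ?thesis by (simp add: prod.distrib exp_sum euler_prod_def)
qed

text \<open>Two bounds for two ranges of \<open>m\<close>. The first has the exact slope
  \<open>\<epsilon> ln y\<close> and serves small \<open>m\<close>; the second halves the slope at
  the price of a factor \<open>exp 1\<close> and makes the terms with large \<open>m\<close>
  decrease. They rest on \<open>1 - exp (-u) \<le> u\<close>, improved to \<open>u / 2\<close> once
  \<open>u \<ge> 2\<close>.\<close>

lemma euler_prod_right_upper:
  "\<exists>C\<ge>0. \<forall>y\<ge>1. \<forall>\<epsilon>>0. euler_prod P (1 + \<epsilon>) y \<le> euler_prod P 1 y * exp (\<epsilon> * (ln y + C)) \<and>
     euler_prod P (1 + \<epsilon>) y \<le> euler_prod P 1 y * exp (\<epsilon> * ln y / 2 + 1 + \<epsilon> * C)"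
proof -
  obtain C where C: "C \<ge> 0" "\<And>y. y \<ge> 1 \<Longrightarrow> (\<Sum>p\<in>primes_le y. ln (real p) / (real p - 1)) \<le> ln y + C"
    using sum_ln_over_pred_le by blast
  have "euler_prod P (1 + \<epsilon>) y \<le> euler_prod P 1 y * exp (\<epsilon> * (ln y + C)) \<and>
     euler_prod P (1 + \<epsilon>) y \<le> euler_prod P 1 y * exp (\<epsilon> * ln y / 2 + 1 + \<epsilon> * C)"
    if y: "y \<ge> 1" and \<epsilon>: "\<epsilon> > 0" for y \<epsilon>
  proof -
    let ?S = "\<Sum>p\<in>primes_le y. (1 - exp (- (\<epsilon> * ln (real p)))) / (real p - 1)"
    have pos: "euler_prod P 1 y > 0" by (rule euler_prod_pos) simp
    have "?S \<le> (\<Sum>p\<in>primes_le y. \<epsilon> * (ln (real p) / (real p - 1)))"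
    proof (intro sum_mono)
      fix p assume "p \<in> primes_le y"
      then have p: "real p \<ge> 2" using primes_leD by blast
      have "1 - exp (- (\<epsilon> * ln (real p))) \<le> \<epsilon> * ln (real p)"
        using exp_ge_add_one_self[of "- (\<epsilon> * ln (real p))"] by linarith
      then show "(1 - exp (- (\<epsilon> * ln (real p)))) / (real p - 1) \<le> \<epsilon> * (ln (real p) / (real p - 1))"
        using p by (simp add: divide_right_mono)
    qed
    also have "\<dots> \<le> \<epsilon> * (ln y + C)"
      unfolding sum_distrib_left[symmetric] using C(2)[OF y] \<epsilon> by (intro mult_left_mono) auto
    finally have 1: "?S \<le> \<epsilon> * (ln y + C)" .
    \<comment> \<open>The threshold where \<open>\<epsilon> ln p\<close> reaches 2. Primes below it
      have the full slope, but this adds only \<open>1 + O(\<epsilon>)\<close> to the half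
      slope.\<close>
    define z where "z = exp (2 / \<epsilon>)"
    have z: "z \<ge> 1" "ln z = 2 / \<epsilon>" using \<epsilon> unfolding z_def by auto
    have "?S \<le> (\<Sum>p\<in>primes_le y. \<epsilon> / 2 * (ln (real p) / (real p - 1)) +
              (if real p \<le> z then \<epsilon> / 2 * (ln (real p) / (real p - 1)) else 0))"
    proof (intro sum_mono)
      fix p assume "p \<in> primes_le y"
      then have p: "real p \<ge> 2" using primes_leD by blast
      show "(1 - exp (- (\<epsilon> * ln (real p)))) / (real p - 1) \<le> \<epsilon> / 2 * (ln (real p) / (real p - 1)) +
              (if real p \<le> z then \<epsilon> / 2 * (ln (real p) / (real p - 1)) else 0)"
      proof (cases "real p \<le> z")
        case True
        have "1 - exp (- (\<epsilon> * ln (real p))) \<le> \<epsilon> * ln (real p)"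
          using exp_ge_add_one_self[of "- (\<epsilon> * ln (real p))"] by linarith
        then have "(1 - exp (- (\<epsilon> * ln (real p)))) / (real p - 1) \<le> \<epsilon> * ln (real p) / (real p - 1)"
          using p by (simp add: divide_right_mono)
        moreover have "\<epsilon> * ln (real p) / (real p - 1) =
            \<epsilon> / 2 * (ln (real p) / (real p - 1)) + \<epsilon> / 2 * (ln (real p) / (real p - 1))"
          by (metis field_sum_of_halves distrib_right times_divide_eq_right)
        ultimately show ?thesis using True by simp
      next
        case False
        then have "ln z < ln (real p)" using z p by (intro ln_less_cancel_iff[THEN iffD2]) auto
        then have "2 / \<epsilon> < ln (real p)" using z by simp
        then have "2 \<le> \<epsilon> * ln (real p)" using \<epsilon> by (simp add: field_simps)
        then have "1 - exp (- (\<epsilon> * ln (real p))) \<le> \<epsilon> / 2 * ln (real p)"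
          using exp_gt_zero[of "- (\<epsilon> * ln (real p))"] by linarith
        then have "(1 - exp (- (\<epsilon> * ln (real p)))) / (real p - 1) \<le> (\<epsilon> / 2 * ln (real p)) / (real p - 1)"
          using p by (intro divide_right_mono) auto
        then show ?thesis using False by simp
      qed
    qed
    also have "\<dots> = \<epsilon> / 2 * (\<Sum>p\<in>primes_le y. ln (real p) / (real p - 1)) +
        \<epsilon> / 2 * (\<Sum>p\<in>{p\<in>primes_le y. real p \<le> z}. ln (real p) / (real p - 1))"
      unfolding sum.distrib sum_distrib_left by (intro arg_cong2[of _ _ _ _ "(+)"] refl sum.inter_filter[symmetric]) auto
    also have "\<dots> \<le> \<epsilon> / 2 * (ln y + C) + \<epsilon> / 2 * (2 / \<epsilon> + C)"
    proof (intro add_mono mult_left_mono C y)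
      have "(\<Sum>p\<in>{p\<in>primes_le y. real p \<le> z}. ln (real p) / (real p - 1)) \<le>
            (\<Sum>p\<in>primes_le z. ln (real p) / (real p - 1))"
      proof (intro sum_mono2)
        fix p assume "p \<in> primes_le z - {p \<in> primes_le y. real p \<le> z}"
        then have "real p \<ge> 2" using primes_leD by blast
        then show "0 \<le> ln (real p) / (real p - 1)" by simp
      qed auto
      also have "\<dots> \<le> 2 / \<epsilon> + C" using C(2)[OF z(1)] z(2) by simp
      finally show "(\<Sum>p\<in>{p\<in>primes_le y. real p \<le> z}. ln (real p) / (real p - 1)) \<le> 2 / \<epsilon> + C" .
    qed (use \<epsilon> in auto)
    also have "\<dots> = \<epsilon> * ln y / 2 + 1 + \<epsilon> * C" using \<epsilon> by (simp add: field_simps)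
    finally have 2: "?S \<le> \<epsilon> * ln y / 2 + 1 + \<epsilon> * C" .
    have "euler_prod P (1 + \<epsilon>) y \<le> euler_prod P 1 y * exp ?S"
      using \<epsilon> by (intro euler_prod_ratio_le) auto
    moreover have "euler_prod P 1 y * exp ?S \<le> euler_prod P 1 y * exp (\<epsilon> * (ln y + C))"
      using 1 pos by (intro mult_left_mono) auto
    moreover have "euler_prod P 1 y * exp ?S \<le> euler_prod P 1 y * exp (\<epsilon> * ln y / 2 + 1 + \<epsilon> * C)"
      using 2 pos by (intro mult_left_mono) auto
    ultimately show ?thesis by linarith
  qed
  then show ?thesis using C(1) by blast
qed

lemma sum_ln_square_over_le:
  assumes "y \<ge> 1"
  shows "(\<Sum>p\<in>primes_le y. (ln (real p))\<^sup>2 / real p) \<le> ln y * (ln y + C\<^sub>1)"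
proof -
  have "(\<Sum>p\<in>primes_le y. (ln (real p))\<^sup>2 / real p) \<le> (\<Sum>p\<in>primes_le y. ln y * (ln (real p) / real p))"
  proof (intro sum_mono)
    fix p assume "p \<in> primes_le y"
    then have p: "real p \<ge> 2" "real p \<le> y" using primes_leD by blast+
    have "ln (real p) * ln (real p) \<le> ln y * ln (real p)"
      using p by (intro mult_right_mono) auto
    then show "(ln (real p))\<^sup>2 / real p \<le> ln y * (ln (real p) / real p)"
      using p by (simp add: power2_eq_square divide_right_mono)
  qed
  also have "\<dots> \<le> ln y * (ln y + C\<^sub>1)"
    unfolding sum_distrib_left[symmetric] using assms by (intro mult_left_mono sum_ln_over_le) auto
  finally show ?thesis .
qed

text \<open>Keeping a quadratic term in the expansion of \<open>1 - exp (-u)\<close> isolates a gain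
  of first order in \<open>\<epsilon>\<close>, on which the lower bound for the counting function
  rests.\<close>

lemma euler_prod_right_lower:
  assumes "y \<ge> 1" "\<epsilon> \<ge> 0"
  shows "euler_prod P 1 y * exp (\<epsilon> * (ln y - C\<^sub>1) - \<epsilon>\<^sup>2 * (ln y * (ln y + C\<^sub>1))) \<le> euler_prod P (1 + \<epsilon>) y"
proof -
  let ?S = "\<Sum>p\<in>primes_le y. (1 - exp (- (\<epsilon> * ln (real p)))) / real p"
  have pos: "euler_prod P 1 y > 0" by (rule euler_prod_pos) simp
  have "\<epsilon> * (ln y - C\<^sub>1) - \<epsilon>\<^sup>2 * (ln y * (ln y + C\<^sub>1)) \<le>
     \<epsilon> * (\<Sum>p\<in>primes_le y. ln (real p) / real p) - \<epsilon>\<^sup>2 * (\<Sum>p\<in>primes_le y. (ln (real p))\<^sup>2 / real p)"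
    using assms by (intro diff_mono mult_left_mono sum_ln_over_ge sum_ln_square_over_le) auto
  also have "\<dots> = (\<Sum>p\<in>primes_le y. \<epsilon> * (ln (real p) / real p) - \<epsilon>\<^sup>2 * ((ln (real p))\<^sup>2 / real p))"
    by (simp add: sum_subtractf sum_distrib_left)
  also have "\<dots> \<le> ?S"
  proof (intro sum_mono)
    fix p assume "p \<in> primes_le y"
    then have p: "real p \<ge> 2" using primes_leD by blast
    have "\<epsilon> * ln (real p) - (\<epsilon> * ln (real p))\<^sup>2 \<le> \<epsilon> * ln (real p) - (\<epsilon> * ln (real p))\<^sup>2 / 2" by simp
    also have "\<dots> \<le> 1 - exp (- (\<epsilon> * ln (real p)))"
      using p assms by (intro one_minus_exp_ge) auto
    finally have "(\<epsilon> * ln (real p) - (\<epsilon> * ln (real p))\<^sup>2) / real p \<le> (1 - exp (- (\<epsilon> * ln (real p)))) / real p"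
      using p by (intro divide_right_mono) auto
    then show "\<epsilon> * (ln (real p) / real p) - \<epsilon>\<^sup>2 * ((ln (real p))\<^sup>2 / real p) \<le>
      (1 - exp (- (\<epsilon> * ln (real p)))) / real p"
      by (simp add: diff_divide_distrib power_mult_distrib)
  qed
  finally have "euler_prod P 1 y * exp (\<epsilon> * (ln y - C\<^sub>1) - \<epsilon>\<^sup>2 * (ln y * (ln y + C\<^sub>1))) \<le>
      euler_prod P 1 y * exp ?S" using pos by (intro mult_left_mono) auto
  also have "\<dots> \<le> euler_prod P (1 + \<epsilon>) y" using assms by (intro euler_prod_ratio_ge)
  finally show ?thesis .
qed

lemma bounded_sum_ln_powr:
  "\<exists>C\<ge>0. \<forall>F::nat set. finite F \<longrightarrow> (\<Sum>k\<in>F. ln (real k) * real k powr (-3/2)) \<le> C"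
proof -
  define g where "g = (\<lambda>k::nat. ln (real k) * real k powr (-3/2))"
  have "summable g"
  proof (rule summable_comparison_test_bigo)
    show "summable (\<lambda>k. norm (real k powr (-5/4)))" by (simp add: summable_real_powr_iff)
    show "g \<in> O(\<lambda>k. real k powr (-5/4))" unfolding g_def by real_asymp
  qed
  moreover have nonneg: "0 \<le> g k" for k unfolding g_def by (cases "k = 0") auto
  ultimately have "sum g F \<le> suminf g" if "finite F" for F
    using that by (intro sum_le_suminf) auto
  moreover have "0 \<le> suminf g" using \<open>summable g\<close> nonneg by (intro suminf_nonneg)
  ultimately show ?thesis unfolding g_def by blast
qed

text \<open>\<open>\<eta> ln y \<le> 1\<close> keeps every \<open>p powr \<eta>\<close> within reach
  of a quadratic expansion; \<open>\<eta> \<le> 1/4\<close> makes the remainder from replacing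
  \<open>p - p powr \<eta>\<close> by \<open>p\<close> part of a convergent series.\<close>

lemma euler_prod_left_lower:
  "\<exists>C\<ge>0. \<forall>y\<ge>1. \<forall>\<eta>. 0 \<le> \<eta> \<longrightarrow> \<eta> \<le> 1/4 \<longrightarrow> \<eta> * ln y \<le> 1 \<longrightarrow>
    euler_prod P 1 y * exp (- (\<eta> * (ln y + C) + \<eta>\<^sup>2 * (ln y * (ln y + C)))) \<le> euler_prod P (1 - \<eta>) y"
proof -
  obtain D where D: "D \<ge> 0" "\<And>F::nat set. finite F \<Longrightarrow> (\<Sum>k\<in>F. ln (real k) * real k powr (-3/2)) \<le> D"
    using bounded_sum_ln_powr by blast
  have "euler_prod P 1 y * exp (- (\<eta> * (ln y + (C\<^sub>1 + 4 * D)) + \<eta>\<^sup>2 * (ln y * (ln y + (C\<^sub>1 + 4 * D)))))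
      \<le> euler_prod P (1 - \<eta>) y"
    if y: "y \<ge> 1" and \<eta>: "0 \<le> \<eta>" "\<eta> \<le> 1/4" "\<eta> * ln y \<le> 1" for y \<eta>
  proof -
    let ?t = "\<lambda>p. (exp (\<eta> * ln (real p)) - 1) / (real p - exp (\<eta> * ln (real p)))"
    have pos: "euler_prod P 1 y > 0" by (rule euler_prod_pos) simp
    have fac: "exp (\<eta> * ln (real p)) = real p powr \<eta>" "1 \<le> real p powr \<eta>" "real p powr \<eta> \<le> 3/4 * real p"
      if "real p \<ge> 2" for p :: nat
    proof -
      show "exp (\<eta> * ln (real p)) = real p powr \<eta>" using that by (simp add: powr_def)
      show "1 \<le> real p powr \<eta>" using that \<eta> by (intro ge_one_powr_ge_zero) auto
      have "real p powr \<eta> \<le> real p powr (1/2)" using that \<eta> by (intro powr_mono) auto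
      also have "\<dots> = sqrt (real p)" using that by (simp add: powr_half_sqrt)
      also have "\<dots> \<le> 3/4 * real p"
      proof (rule real_le_lsqrt)
        have "16 \<le> 9 * real p" using that by simp
        then have "16 * real p \<le> 9 * real p * real p" using that by (intro mult_right_mono) auto
        then show "real p \<le> (3/4 * real p)\<^sup>2" by (simp add: power2_eq_square)
      qed (use that in auto)
      finally show "real p powr \<eta> \<le> 3/4 * real p" .
    qed
    have "(\<Sum>p\<in>primes_le y. ?t p) \<le> (\<Sum>p\<in>primes_le y. \<eta> * (ln (real p) / real p) +
        \<eta>\<^sup>2 * ((ln (real p))\<^sup>2 / real p) + 4 * \<eta> * (ln (real p) * real p powr (-3/2)))"
    proof (intro sum_mono)
      fix p assume "p \<in> primes_le y"
      then have p: "real p \<ge> 2" "real p \<le> y" using primes_leD by blast+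
      define x where "x = \<eta> * ln (real p)"
      have x: "0 \<le> x" "x \<le> 1"
      proof -
        show "0 \<le> x" using p \<eta> unfolding x_def by simp
        have "x \<le> \<eta> * ln y" unfolding x_def using p \<eta> by (intro mult_left_mono) auto
        then show "x \<le> 1" using \<eta> by simp
      qed
      define w where "w = exp x"
      have w: "w = real p powr \<eta>" "1 \<le> w" "w \<le> 3/4 * real p"
        using fac[OF p(1)] unfolding w_def x_def by auto
      have w1: "w - 1 \<le> x + x\<^sup>2" using exp_bound[OF x] unfolding w_def by simp
      have w2: "w - 1 \<le> x * w"
      proof -
        have "1 - x \<le> exp (-x)" using exp_ge_add_one_self[of "-x"] by simp
        then have "(1 - x) * w \<le> exp (-x) * w" using w by (intro mult_right_mono) auto
        then show ?thesis unfolding w_def by (simp add: algebra_simps exp_minus)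
      qed
      \<comment> \<open>The main term gets the denominator \<open>p\<close>. In the rest
        \<open>p - w \<ge> p / 4\<close>, and \<open>w * w / (p * p)\<close> is at most
        \<open>p powr (-3/2)\<close> because \<open>\<eta> \<le> 1/4\<close>.\<close>
      have "(w - 1) / (real p - w) = (w - 1) / real p + (w - 1) * w / (real p * (real p - w))"
        using w p by (simp add: field_simps)
      also have "\<dots> \<le> (x + x\<^sup>2) / real p + (x * w) * w / (real p * (real p / 4))"
      proof (intro add_mono frac_le mult_mono)
        show "real p / 4 \<le> real p - w" using w by simp
      qed (use w w1 w2 p x in auto)
      also have "(x * w) * w / (real p * (real p / 4)) = 4 * x * real p powr (2 * \<eta> - 2)"
        using p w by (simp add: powr_diff powr_add[symmetric] field_simps power2_eq_square
            flip: powr_numeral) (simp add: mult_2 powr_add powr_numeral power2_eq_square)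
      also have "\<dots> \<le> 4 * x * real p powr (-3/2)"
        using p x \<eta> by (intro mult_left_mono powr_mono) auto
      finally show "?t p \<le> \<eta> * (ln (real p) / real p) +
        \<eta>\<^sup>2 * ((ln (real p))\<^sup>2 / real p) + 4 * \<eta> * (ln (real p) * real p powr (-3/2))"
        unfolding w_def x_def by (simp add: add_divide_distrib power_mult_distrib mult_ac)
    qed
    also have "\<dots> = \<eta> * (\<Sum>p\<in>primes_le y. ln (real p) / real p) +
        \<eta>\<^sup>2 * (\<Sum>p\<in>primes_le y. (ln (real p))\<^sup>2 / real p)
        + 4 * \<eta> * (\<Sum>p\<in>primes_le y. ln (real p) * real p powr (-3/2))"
      by (simp add: sum.distrib sum_distrib_left)
    also have "\<dots> \<le> \<eta> * (ln y + C\<^sub>1) + \<eta>\<^sup>2 * (ln y * (ln y + C\<^sub>1)) + 4 * \<eta> * D"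
      using y \<eta> by (intro add_mono mult_left_mono sum_ln_over_le sum_ln_square_over_le D) auto
    also have "\<dots> \<le> \<eta> * (ln y + (C\<^sub>1 + 4 * D)) + \<eta>\<^sup>2 * (ln y * (ln y + (C\<^sub>1 + 4 * D)))"
      using y \<eta> D(1) by (simp add: algebra_simps)
    finally have S: "(\<Sum>p\<in>primes_le y. ?t p) \<le> \<eta> * (ln y + (C\<^sub>1 + 4 * D)) + \<eta>\<^sup>2 * (ln y * (ln y + (C\<^sub>1 + 4 * D)))" .
    have "euler_prod P 1 y * exp (- (\<eta> * (ln y + (C\<^sub>1 + 4 * D)) + \<eta>\<^sup>2 * (ln y * (ln y + (C\<^sub>1 + 4 * D)))))
       \<le> euler_prod P 1 y * exp (\<Sum>p\<in>primes_le y. - ?t p)"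
      using pos S by (intro mult_left_mono) (auto simp: sum_negf)
    also have "\<dots> = (\<Prod>p\<in>primes_le y. (1 - real p powr (-1)) * exp (- ?t p))"
      by (simp add: euler_prod_def prod.distrib exp_sum)
    also have "\<dots> \<le> euler_prod P (1 - \<eta>) y"
      unfolding euler_prod_def
    proof (intro prod_mono conjI)
      fix p assume "p \<in> primes_le y"
      then have p: "real p \<ge> 2" using primes_leD by blast
      define w where "w = real p powr \<eta>"
      have w: "exp (\<eta> * ln (real p)) = w" "1 \<le> w" "w \<le> 3/4 * real p"
        using fac[OF p] unfolding w_def by auto
      have e: "1 - real p powr (- (1 - \<eta>)) = (real p - w) / real p"
        using p by (simp add: w_def powr_diff diff_divide_distrib)
      show "0 \<le> (1 - real p powr (-1)) * exp (- ?t p)"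
        using p by (simp add: powr_minus_divide)
      have "(real p - 1) / (real p - w) \<le> exp ((w - 1) / (real p - w))"
        using exp_ge_add_one_self[of "(w - 1) / (real p - w)"] w p by (simp add: field_simps)
      then have "exp (- ((w - 1) / (real p - w))) \<le> inverse ((real p - 1) / (real p - w))"
        unfolding exp_minus using w p by (intro le_imp_inverse_le) auto
      then have "(1 - 1 / real p) * exp (- ((w - 1) / (real p - w))) \<le>
        (1 - 1 / real p) * inverse ((real p - 1) / (real p - w))"
        using p by (intro mult_left_mono) auto
      also have "\<dots> = (real p - w) / real p" using p w by (simp add: field_simps)
      finally show "(1 - real p powr (-1)) * exp (- ?t p) \<le> 1 - real p powr (- (1 - \<eta>))"
        unfolding e w(1) using p by (simp add: powr_minus_divide)
    qed
    finally show ?thesis .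
  qed
  then show ?thesis using D(1) C1_nonneg by (intro exI[of _ "C\<^sub>1 + 4 * D"]) auto
qed

end

section \<open>Tails of the weighted sum over a chain set\<close>

text \<open>Dyadic summation by layers: an element with \<open>2 ^ k \<le> L x < 2 ^ (k + 1)\<close>
  is charged to layer \<open>k\<close>, and the layers are enlarged to tails.\<close>

lemma sum_layer_bound:
  fixes w L :: "'a \<Rightarrow> real" and g :: "real \<Rightarrow> real"
  assumes fin: "finite A" and w: "\<And>x. x \<in> A \<Longrightarrow> w x \<ge> 0"
    and L: "\<And>x. x \<in> A \<Longrightarrow> 0 \<le> L x \<and> L x < 2 ^ N"
    and g: "\<And>s t. 0 \<le> s \<Longrightarrow> s \<le> t \<Longrightarrow> g s \<le> g t" and g0: "g 0 \<ge> 0"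
  shows "(\<Sum>x\<in>A. w x * g (L x)) \<le>
     g 1 * (\<Sum>x\<in>A. w x) + (\<Sum>k<N. g (2 ^ (k + 1)) * (\<Sum>x | x \<in> A \<and> 2 ^ k \<le> L x. w x))"
proof -
  have gn: "g t \<ge> 0" if "t \<ge> 0" for t using g[of 0 t] g0 that by linarith
  have "(\<Sum>x\<in>A. w x * g (L x)) \<le> (\<Sum>x\<in>A. w x * (g 1 + (\<Sum>k<N. if 2 ^ k \<le> L x then g (2 ^ (k + 1)) else 0)))"
  proof (intro sum_mono mult_left_mono w)
    fix x assume x: "x \<in> A"
    have nn: "0 \<le> (if 2 ^ k \<le> L x then g (2 ^ (k + 1)) else 0)" for k using gn by simp
    show "g (L x) \<le> g 1 + (\<Sum>k<N. if 2 ^ k \<le> L x then g (2 ^ (k + 1)) else 0)"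
    proof (cases "L x \<le> 1")
      case True
      then have "g (L x) \<le> g 1" using L[OF x] by (intro g) auto
      then show ?thesis using sum_nonneg[of "{..<N}", OF nn] by (meson add_increasing2 order_trans)
    next
      case False
      define k where "k = (GREATEST k. 2 ^ k \<le> L x)"
      have b: "j \<le> N" if "2 ^ j \<le> L x" for j :: nat
      proof -
        have "(2::real) ^ j < 2 ^ N" using that L[OF x] by linarith
        then show ?thesis by simp
      qed
      have k: "2 ^ k \<le> L x" unfolding k_def
        by (rule GreatestI_nat[where P = "\<lambda>k. 2 ^ k \<le> L x" and k = 0 and b = N]) (use False b in auto)
      have "\<not> 2 ^ (k + 1) \<le> L x"
        using Greatest_le_nat[of "\<lambda>k. 2 ^ k \<le> L x" "k + 1" N] b unfolding k_def by auto
      then have "g (L x) \<le> g (2 ^ (k + 1))" using L[OF x] by (intro g) auto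
      moreover have "k < N"
      proof -
        have "(2::real) ^ k < 2 ^ N" using k L[OF x] by linarith
        then show ?thesis by simp
      qed
      then have "(if 2 ^ k \<le> L x then g (2 ^ (k + 1)) else 0) \<le>
         (\<Sum>k<N. if 2 ^ k \<le> L x then g (2 ^ (k + 1)) else 0)"
        using nn by (intro member_le_sum) auto
      ultimately show ?thesis using k gn[of 1] by simp
    qed
  qed
  also have "\<dots> = g 1 * (\<Sum>x\<in>A. w x) + (\<Sum>x\<in>A. \<Sum>k<N. g (2 ^ (k + 1)) * (if 2 ^ k \<le> L x then w x else 0))"
    by (simp add: distrib_left sum.distrib sum_distrib_left sum_distrib_right mult.commute
          if_distrib[of "\<lambda>t. _ * t"] cong: if_cong)
  also have "(\<Sum>x\<in>A. \<Sum>k<N. g (2 ^ (k + 1)) * (if 2 ^ k \<le> L x then w x else 0)) =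
     (\<Sum>k<N. g (2 ^ (k + 1)) * (\<Sum>x\<in>A. if 2 ^ k \<le> L x then w x else 0))"
    by (subst sum.swap) (simp add: sum_distrib_left)
  also have "\<dots> = (\<Sum>k<N. g (2 ^ (k + 1)) * (\<Sum>x | x \<in> A \<and> 2 ^ k \<le> L x. w x))"
    using fin by (simp add: sum.inter_filter[symmetric])
  finally show ?thesis .
qed

lemma exists_power_two_between:
  fixes W :: real
  assumes "W \<ge> 1"
  shows "\<exists>N. W \<le> 2 ^ N \<and> 2 ^ N \<le> 2 * W"
proof -
  obtain N0 where N0: "W < 2 ^ N0" using real_arch_pow[of 2 W] by auto
  define N where "N = (LEAST N. W \<le> 2 ^ N)"
  have N: "W \<le> 2 ^ N" unfolding N_def
    by (rule LeastI[where P = "\<lambda>N. W \<le> 2 ^ N", OF less_imp_le[OF N0]])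
  show ?thesis
  proof (cases N)
    case 0
    then show ?thesis using N assms by (intro exI[of _ 0]) auto
  next
    case (Suc j)
    then have "\<not> W \<le> 2 ^ j" using not_less_Least[of j "\<lambda>N. W \<le> 2 ^ N"] unfolding N_def by auto
    then show ?thesis using N Suc by (intro exI[of _ N]) auto
  qed
qed

lemma ln_one_plus_le: "L \<ge> 0 \<Longrightarrow> ln (1 + L) \<le> (L::real)"
  using ln_le_minus_one[of "1 + L"] by simp

text \<open>With slope 1/4, \<open>ln (\<theta> m)\<close> grows at most like
  \<open>5/4 ln m\<close>, of which the halved Euler bound takes \<open>5/8\<close>, safely below
  1.\<close>

lemma ln_one_plus_le_quarter:
  assumes "L \<ge> (0::real)"
  shows "ln (1 + L) \<le> L / 4 + 1"
proof -
  have "ln ((1 + L) / 4) \<le> (1 + L) / 4 - 1" using assms by (intro ln_le_minus_one) auto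
  moreover have "ln ((1 + L) / 4) = ln (1 + L) - ln 4" using assms by (simp add: ln_div)
  moreover have "ln 4 = 2 * ln (2::real)" using ln_realpow[of 2 2] by simp
  moreover have "ln 2 \<le> (25/36 :: real)" by (rule ln2_le_25_over_36)
  moreover have "(1 + L) / 4 = 1/4 + L / 4" by simp
  ultimately show ?thesis by linarith
qed

lemma finite_ln_le [simp, intro]: "finite {m::nat. 0 < m \<and> ln (real m) \<le> V}"
proof (rule finite_subset[of _ "{..nat \<lfloor>exp V\<rfloor>}"])
  show "{m::nat. 0 < m \<and> ln (real m) \<le> V} \<subseteq> {..nat \<lfloor>exp V\<rfloor>}"
  proof safe
    fix m :: nat assume "0 < m" "ln (real m) \<le> V"
    then have "real m \<le> exp V" by (metis exp_le_cancel_iff exp_ln of_nat_0_less_iff)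
    then show "m \<le> nat \<lfloor>exp V\<rfloor>" by (simp add: le_nat_floor)
  qed
qed auto

text \<open>\<open>\<theta>_ge\<close> puts the cut-off of every \<open>m \<ge> Y\<close> exactly at
  \<open>Y\<close>; the logarithm in \<open>\<theta>_le\<close> makes room for the divisor sums of
  practical numbers.\<close>

locale chain_density = prime_density +
  fixes \<theta> :: "nat \<Rightarrow> real" and K :: real
  assumes \<theta>_mono: "\<And>m k. m > 0 \<Longrightarrow> k > 0 \<Longrightarrow> \<theta> m \<le> \<theta> (m * k)"
    and \<theta>_ge: "\<And>m. m > 0 \<Longrightarrow> real m \<le> \<theta> m"
    and \<theta>_le: "\<And>m. m > 0 \<Longrightarrow> \<theta> m \<le> K * real m * (1 + ln (real m))"
    and K_ge: "K \<ge> 1"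
begin

abbreviation "B \<equiv> chain_set P \<theta>"
abbreviation "BY \<equiv> chain_upto P \<theta>"

section \<open>Weights of the partition of unity, split at ln m = V\<close>

definition cut :: "nat \<Rightarrow> nat \<Rightarrow> real" where "cut Y m = min (\<theta> m) (real Y)"

text \<open>The summand of the partition of unity at \<open>s = 1\<close>; \<open>twt\<close> is the
  summand at a general exponent, and both have total mass 1 over \<open>BY Y\<close>.\<close>

definition wt :: "nat \<Rightarrow> nat \<Rightarrow> real" where "wt Y m = euler_prod P 1 (cut Y m) / real m"

definition twt :: "real \<Rightarrow> nat \<Rightarrow> nat \<Rightarrow> real" where
  "twt s Y m = real m powr (-s) * euler_prod P s (cut Y m)"

definition near :: "nat \<Rightarrow> real \<Rightarrow> nat set" where "near Y V = {m \<in> BY Y. ln (real m) < V}"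
definition far :: "nat \<Rightarrow> real \<Rightarrow> nat set" where "far Y V = {m \<in> BY Y. V \<le> ln (real m)}"

lemma BY_pos: "m \<in> BY Y \<Longrightarrow> m > 0"
  by (auto simp: chain_upto_def chain_set_def)

lemma finite_near [simp, intro]: "finite (near Y V)"
  by (rule finite_subset[OF _ finite_ln_le[of V]]) (auto simp: near_def BY_pos)

lemma twt_has_sum: "s > 0 \<Longrightarrow> (twt s Y has_sum 1) (BY Y)"
  unfolding twt_def cut_def by (rule has_sum_chain_upto) (auto intro: \<theta>_mono)

lemma twt_1: "m > 0 \<Longrightarrow> twt 1 Y m = wt Y m"
  by (simp add: twt_def wt_def powr_minus_divide)

lemma wt_has_sum: "(wt Y has_sum 1) (BY Y)"
  using twt_has_sum[of 1 Y] by (rule has_sum_cong[THEN iffD1, rotated]) (auto simp: twt_1 BY_pos)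

lemma wt_nonneg: "wt Y m \<ge> 0"
  unfolding wt_def using euler_prod_pos[of 1 P "cut Y m"] by simp

lemma twt_nonneg: "s > 0 \<Longrightarrow> twt s Y m \<ge> 0"
  unfolding twt_def using euler_prod_pos[of s P "cut Y m"] by simp

lemma far_near_split:
  assumes "(f has_sum S) (BY Y)"
  shows "infsum f (far Y V) + sum f (near Y V) = (S::real)" "f summable_on far Y V"
proof -
  have s: "f summable_on BY Y" using assms by (rule has_sum_imp_summable)
  show s1: "f summable_on far Y V" by (rule summable_on_subset[OF s]) (auto simp: far_def)
  have "infsum f (far Y V \<union> near Y V) = infsum f (far Y V) + infsum f (near Y V)"
    by (rule infsum_Un_disjoint[OF s1 summable_on_finite[OF finite_near]]) (auto simp: far_def near_def)
  moreover have "far Y V \<union> near Y V = BY Y" by (auto simp: far_def near_def)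
  ultimately show "infsum f (far Y V) + sum f (near Y V) = S"
    using infsumI[OF assms] by simp
qed

lemma wt_summable_far: "wt Y summable_on far Y V"
  by (rule far_near_split(2)[OF wt_has_sum])

lemma sum_far_le: "finite F \<Longrightarrow> F \<subseteq> far Y V \<Longrightarrow> sum (wt Y) F \<le> infsum (wt Y) (far Y V)"
  by (rule finite_sum_le_infsum) (auto simp: wt_nonneg wt_summable_far)

lemma infsum_far_bounds: "0 \<le> infsum (wt Y) (far Y V)" "infsum (wt Y) (far Y V) \<le> 1"
  "sum (wt Y) (near Y V) \<le> 1"
proof -
  show 1: "0 \<le> infsum (wt Y) (far Y V)" by (intro infsum_nonneg wt_nonneg)
  have 2: "0 \<le> sum (wt Y) (near Y V)" by (intro sum_nonneg wt_nonneg)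
  from far_near_split(1)[OF wt_has_sum, of Y V] 1 2
  show "infsum (wt Y) (far Y V) \<le> 1" "sum (wt Y) (near Y V) \<le> 1" by linarith+
qed

lemma cut_bounds:
  assumes "m > 0" "Y \<ge> 1"
  shows "1 \<le> cut Y m" "cut Y m \<le> real Y"
    "ln (cut Y m) \<le> ln (real m) + ln K + ln (1 + ln (real m))" "0 \<le> ln (cut Y m)"
    "ln (cut Y m) \<le> ln (real Y)"
proof -
  have L: "ln (real m) \<ge> 0" using assms by simp
  show 1: "1 \<le> cut Y m" using \<theta>_ge[OF assms(1)] assms by (simp add: cut_def)
  then show "0 \<le> ln (cut Y m)" by simp
  show 2: "cut Y m \<le> real Y" by (simp add: cut_def)
  then show "ln (cut Y m) \<le> ln (real Y)" using 1 assms by simp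
  have "cut Y m \<le> K * real m * (1 + ln (real m))" using \<theta>_le[OF assms(1)] by (simp add: cut_def)
  then have "ln (cut Y m) \<le> ln (K * real m * (1 + ln (real m)))"
    using 1 by (intro ln_mono) auto
  also have "\<dots> = ln K + ln (real m) + ln (1 + ln (real m))"
    using assms K_ge add_pos_nonneg[OF zero_less_one L] by (simp add: ln_mult)
  finally show "ln (cut Y m) \<le> ln (real m) + ln K + ln (1 + ln (real m))" by simp
qed

text \<open>Turns a comparison of Euler products into one of summands; \<open>(s - 1) * ln m\<close>
  stems from \<open>m powr (-s)\<close>.\<close>

lemma twt_ratio: 
  assumes "m > 0"
  shows "euler_prod P s (cut Y m) \<le> euler_prod P 1 (cut Y m) * exp z \<Longrightarrow>
      twt s Y m \<le> wt Y m * exp (z - (s - 1) * ln (real m))"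
    and "euler_prod P 1 (cut Y m) * exp z \<le> euler_prod P s (cut Y m) \<Longrightarrow>
      wt Y m * exp (z - (s - 1) * ln (real m)) \<le> twt s Y m"
proof -
  have e: "real m powr (-s) = exp (- ((s - 1) * ln (real m))) / real m"
    using assms by (simp add: powr_def algebra_simps exp_diff exp_minus exp_add field_simps)
  have eq: "wt Y m * exp (z - (s - 1) * ln (real m)) =
      real m powr (-s) * (euler_prod P 1 (cut Y m) * exp z)" for z
    unfolding e wt_def by (simp add: exp_diff exp_minus divide_inverse mult_ac)
  show "euler_prod P s (cut Y m) \<le> euler_prod P 1 (cut Y m) * exp z \<Longrightarrow>
      twt s Y m \<le> wt Y m * exp (z - (s - 1) * ln (real m))"
    unfolding eq twt_def by (intro mult_left_mono) auto
  show "euler_prod P 1 (cut Y m) * exp z \<le> euler_prod P s (cut Y m) \<Longrightarrow>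
      wt Y m * exp (z - (s - 1) * ln (real m)) \<le> twt s Y m"
    unfolding eq twt_def by (intro mult_left_mono) auto
qed

text \<open>At \<open>s = 1 + \<epsilon>\<close> the far summands shrink by a fixed factor, the near
  ones grow by at most \<open>1 + O(\<epsilon> (1 + ln (1 + ln m)))\<close>. Since both systems have
  total 1, the loss of the far part is at most the gain of the near part.\<close>

lemma tail_recursion:
  "\<exists>\<epsilon>\<^sub>0>0. \<exists>C>0. \<forall>Y\<ge>1. \<forall>\<epsilon>. 0 < \<epsilon> \<longrightarrow> \<epsilon> \<le> \<epsilon>\<^sub>0 \<longrightarrow>
     infsum (wt Y) (far Y (4 / \<epsilon>)) \<le> C * \<epsilon> * (\<Sum>m\<in>near Y (4 / \<epsilon>). wt Y m * (1 + ln (1 + ln (real m))))"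
proof -
  obtain C where C: "C \<ge> 0" "\<And>y \<epsilon>. y \<ge> 1 \<Longrightarrow> \<epsilon> > 0 \<Longrightarrow>
      euler_prod P (1 + \<epsilon>) y \<le> euler_prod P 1 y * exp (\<epsilon> * (ln y + C))"
     "\<And>y \<epsilon>. y \<ge> 1 \<Longrightarrow> \<epsilon> > 0 \<Longrightarrow> euler_prod P (1 + \<epsilon>) y \<le> euler_prod P 1 y * exp (\<epsilon> * ln y / 2 + 1 + \<epsilon> * C)"
    using euler_prod_right_upper by blast
  define D where "D = 1 + ln K + C"
  have lK: "ln K \<ge> 0" using K_ge by simp
  have D: "D \<ge> 1" using C(1) lK unfolding D_def by linarith
  have "((\<lambda>\<epsilon>::real. \<epsilon> * (1 + ln (1 + 4 / \<epsilon>))) \<longlongrightarrow> 0) (at_right 0)" by real_asymp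
  then have "((\<lambda>\<epsilon>::real. D * (\<epsilon> * (1 + ln (1 + 4 / \<epsilon>)))) \<longlongrightarrow> D * 0) (at_right 0)"
    by (intro tendsto_intros)
  then have "eventually (\<lambda>\<epsilon>. D * (\<epsilon> * (1 + ln (1 + 4 / \<epsilon>))) < 1) (at_right 0)"
    by (rule order_tendstoD(2)) auto
  then obtain \<epsilon>\<^sub>1 where \<epsilon>1: "\<epsilon>\<^sub>1 > 0" "\<And>\<epsilon>. 0 < \<epsilon> \<Longrightarrow> \<epsilon> < \<epsilon>\<^sub>1 \<Longrightarrow> D * (\<epsilon> * (1 + ln (1 + 4 / \<epsilon>))) < 1"
    unfolding eventually_at_right_field by auto
  \<comment> \<open>The first bound keeps the exponents of near summands below 1, the second makes
    \<open>\<epsilon> D\<close> at most 1/4.\<close>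
  define \<epsilon>\<^sub>0 where "\<epsilon>\<^sub>0 = min (\<epsilon>\<^sub>1 / 2) (1 / (4 * D))"
  define c where "c = 1 - exp (-1/4 :: real)"
  have c: "c > 0" unfolding c_def by simp
  have "infsum (wt Y) (far Y (4 / \<epsilon>)) \<le> (2 * D / c) * \<epsilon> * (\<Sum>m\<in>near Y (4 / \<epsilon>). wt Y m * (1 + ln (1 + ln (real m))))"
    if Y: "Y \<ge> 1" and \<epsilon>: "0 < \<epsilon>" "\<epsilon> \<le> \<epsilon>\<^sub>0" for Y \<epsilon>
  proof -
    let ?V = "4 / \<epsilon>"
    have \<epsilon>D: "\<epsilon> * D \<le> 1 / 4" using \<epsilon> D unfolding \<epsilon>\<^sub>0_def by (simp add: field_simps)
    have \<epsilon>1': "D * (\<epsilon> * (1 + ln (1 + 4 / \<epsilon>))) < 1"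
      using \<epsilon> \<epsilon>1 unfolding \<epsilon>\<^sub>0_def by (intro \<epsilon>1(2)) auto
    have far: "twt (1 + \<epsilon>) Y m \<le> wt Y m * exp (-1/4)" if m: "m \<in> far Y ?V" for m
    proof -
      define L where "L = ln (real m)"
      have m0: "m > 0" using m BY_pos by (auto simp: far_def)
      have L: "L \<ge> ?V" "L \<ge> 0" using m m0 unfolding L_def far_def by auto
      then have \<epsilon>L: "\<epsilon> * L \<ge> 4" using \<epsilon> by (simp add: field_simps)
      note cb = cut_bounds[OF m0 Y]
      have "twt (1 + \<epsilon>) Y m \<le> wt Y m * exp ((\<epsilon> * ln (cut Y m) / 2 + 1 + \<epsilon> * C) - ((1 + \<epsilon>) - 1) * ln (real m))"
        using cb \<epsilon> m0 by (intro twt_ratio C(3)) auto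
      also have "\<dots> \<le> wt Y m * exp (-1/4)"
      proof (intro mult_left_mono wt_nonneg, unfold exp_le_cancel_iff)
        have "\<epsilon> * ln (cut Y m) \<le> \<epsilon> * (L + ln K + (L / 4 + 1))"
          using cb(3) ln_one_plus_le_quarter[OF L(2)] \<epsilon> unfolding L_def[symmetric]
          by (intro mult_left_mono) auto
        \<comment> \<open>As \<open>\<epsilon> ln m \<ge> 4\<close>, the exponent is at most
          \<open>-3/2 + 1 + 1/4 = -1/4\<close>; this is why the split is made at
          \<open>4 / \<epsilon>\<close>.\<close>
        then have "(\<epsilon> * ln (cut Y m) / 2 + 1 + \<epsilon> * C) - \<epsilon> * L \<le>
          - (3/8) * (\<epsilon> * L) + 1 + \<epsilon> * (ln K / 2 + 1/2 + C)" by (simp add: algebra_simps)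
        also have "\<epsilon> * (ln K / 2 + 1/2 + C) \<le> \<epsilon> * D"
          using \<epsilon> lK unfolding D_def by (intro mult_left_mono) auto
        also have "- (3/8) * (\<epsilon> * L) + 1 + \<epsilon> * D \<le> - (3/8) * 4 + 1 + \<epsilon> * D"
          using \<epsilon>L by simp
        finally show "(\<epsilon> * ln (cut Y m) / 2 + 1 + \<epsilon> * C) - ((1 + \<epsilon>) - 1) * ln (real m) \<le> -1/4"
          using \<epsilon>D unfolding L_def by simp
      qed
      finally show ?thesis .
    qed
    have near: "twt (1 + \<epsilon>) Y m \<le> wt Y m + 2 * D * \<epsilon> * (wt Y m * (1 + ln (1 + ln (real m))))"
      if m: "m \<in> near Y ?V" for m
    proof -
      define L where "L = ln (real m)"
      have m0: "m > 0" using m BY_pos by (auto simp: near_def)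
      have L: "L < ?V" "L \<ge> 0" using m m0 unfolding L_def near_def by auto
      note cb = cut_bounds[OF m0 Y]
      define E where "E = \<epsilon> * D * (1 + ln (1 + L))"
      have l0: "ln (1 + L) \<ge> 0" using L by simp
      have E0: "E \<ge> 0" unfolding E_def using \<epsilon> D l0 by simp
      have "ln (1 + L) \<le> ln (1 + 4 / \<epsilon>)" using L by (intro ln_mono) auto
      then have "E \<le> \<epsilon> * D * (1 + ln (1 + 4 / \<epsilon>))" unfolding E_def using \<epsilon> D
        by (intro mult_left_mono) auto
      with \<epsilon>1' have E1: "E \<le> 1" by (simp add: mult_ac)
      have "twt (1 + \<epsilon>) Y m \<le> wt Y m * exp (\<epsilon> * (ln (cut Y m) + C) - ((1 + \<epsilon>) - 1) * ln (real m))"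
        using cb \<epsilon> m0 by (intro twt_ratio C(2)) auto
      also have "\<dots> \<le> wt Y m * exp E"
      proof (intro mult_left_mono wt_nonneg, unfold exp_le_cancel_iff)
        have "\<epsilon> * (ln (cut Y m) + C - L) \<le> \<epsilon> * (ln K + C + ln (1 + L))"
          using cb(3) \<epsilon> unfolding L_def by (intro mult_left_mono) auto
        also have "\<dots> \<le> \<epsilon> * (D * (1 + ln (1 + L)))"
        proof (intro mult_left_mono)
          have "ln K + C + ln (1 + L) \<le> D * 1 + D * ln (1 + L)"
            using D l0 mult_right_mono[OF D l0] unfolding D_def by simp
          then show "ln K + C + ln (1 + L) \<le> D * (1 + ln (1 + L))" by (simp add: distrib_left)
        qed (use \<epsilon> in auto)
        finally show "\<epsilon> * (ln (cut Y m) + C) - ((1 + \<epsilon>) - 1) * ln (real m) \<le> E"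
          unfolding E_def L_def by (simp add: algebra_simps)
      qed
      also have "\<dots> \<le> wt Y m * (1 + 2 * E)"
      proof (intro mult_left_mono wt_nonneg)
        have "E\<^sup>2 \<le> E" using E0 E1 by (simp add: power2_eq_square mult_left_le)
        then show "exp E \<le> 1 + 2 * E" using exp_bound[OF E0 E1] by linarith
      qed
      finally show ?thesis unfolding E_def L_def by (simp add: algebra_simps)
    qed
    have t: "(twt (1 + \<epsilon>) Y has_sum 1) (BY Y)" using \<epsilon> by (intro twt_has_sum) auto
    have "1 = infsum (twt (1 + \<epsilon>) Y) (far Y ?V) + sum (twt (1 + \<epsilon>) Y) (near Y ?V)"
      using far_near_split(1)[OF t] by simp
    also have "infsum (twt (1 + \<epsilon>) Y) (far Y ?V) \<le> infsum (\<lambda>m. wt Y m * exp (-1/4)) (far Y ?V)"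
      by (intro infsum_mono far far_near_split(2)[OF t] summable_on_cmult_left wt_summable_far)
    also have "\<dots> = infsum (wt Y) (far Y ?V) * exp (-1/4)"
      by (rule infsum_cmult_left) (simp add: wt_summable_far)
    also have "sum (twt (1 + \<epsilon>) Y) (near Y ?V) \<le>
       (\<Sum>m\<in>near Y ?V. wt Y m + 2 * D * \<epsilon> * (wt Y m * (1 + ln (1 + ln (real m)))))"
      by (intro sum_mono near)
    also have "\<dots> = sum (wt Y) (near Y ?V) + 2 * D * \<epsilon> * (\<Sum>m\<in>near Y ?V. wt Y m * (1 + ln (1 + ln (real m))))"
      by (simp add: sum.distrib sum_distrib_left)
    also have "sum (wt Y) (near Y ?V) = 1 - infsum (wt Y) (far Y ?V)"
      using far_near_split(1)[OF wt_has_sum, of Y ?V] by simp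
    finally have "c * infsum (wt Y) (far Y ?V) \<le> 2 * D * \<epsilon> * (\<Sum>m\<in>near Y ?V. wt Y m * (1 + ln (1 + ln (real m))))"
      unfolding c_def by (simp add: algebra_simps)
    then show ?thesis using c by (simp add: field_simps)
  qed
  moreover have "2 * D / c > 0" "\<epsilon>\<^sub>0 > 0" using D c \<epsilon>1 unfolding \<epsilon>\<^sub>0_def by auto
  ultimately show ?thesis by blast
qed

text \<open>Below the threshold \<open>4 / \<epsilon>\<^sub>0\<close> the total mass 1 is already
  less than \<open>C / V\<close>; the \<open>max\<close> with 1 lets one formula cover both
  ranges.\<close>

lemma tail_weak:
  "\<exists>C>0. \<forall>Y\<ge>1. \<forall>V\<ge>1. infsum (wt Y) (far Y V) \<le>
      C / V * max 1 (\<Sum>m\<in>near Y V. wt Y m * (1 + ln (1 + ln (real m))))"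
proof -
  obtain \<epsilon>\<^sub>0 C where C: "\<epsilon>\<^sub>0 > 0" "C > 0" "\<And>Y \<epsilon>. Y \<ge> 1 \<Longrightarrow> 0 < \<epsilon> \<Longrightarrow> \<epsilon> \<le> \<epsilon>\<^sub>0 \<Longrightarrow>
     infsum (wt Y) (far Y (4 / \<epsilon>)) \<le> C * \<epsilon> * (\<Sum>m\<in>near Y (4 / \<epsilon>). wt Y m * (1 + ln (1 + ln (real m))))"
    using tail_recursion by blast
  define C' where "C' = max (4 * C) (4 / \<epsilon>\<^sub>0)"
  have C': "C' > 0" using C unfolding C'_def by auto
  have "infsum (wt Y) (far Y V) \<le> C' / V * max 1 (\<Sum>m\<in>near Y V. wt Y m * (1 + ln (1 + ln (real m))))"
    if Y: "Y \<ge> 1" and V: "V \<ge> 1" for Y V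
  proof (cases "V \<ge> 4 / \<epsilon>\<^sub>0")
    case True
    let ?S = "\<Sum>m\<in>near Y V. wt Y m * (1 + ln (1 + ln (real m)))"
    have "4 / V \<le> \<epsilon>\<^sub>0" using True V C(1) by (simp add: field_simps)
    then have "infsum (wt Y) (far Y V) \<le> C * (4 / V) * ?S"
      using C(3)[OF Y, of "4 / V"] V by simp
    also have "\<dots> \<le> C * (4 / V) * max 1 ?S" using C V by (intro mult_left_mono) auto
    also have "\<dots> \<le> C' / V * max 1 ?S"
      using V C'_def by (intro mult_right_mono) (auto simp: field_simps)
    finally show ?thesis .
  next
    case False
    have "infsum (wt Y) (far Y V) \<le> 1" by (rule infsum_far_bounds)
    also have "1 \<le> C' / V" using False V unfolding C'_def by (simp add: field_simps)
    also have "\<dots> \<le> C' / V * max 1 (\<Sum>m\<in>near Y V. wt Y m * (1 + ln (1 + ln (real m))))"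
      using mult_left_mono[of 1 "max 1 (\<Sum>m\<in>near Y V. wt Y m * (1 + ln (1 + ln (real m))))" "C' / V"] C' V
      by simp
    finally show ?thesis .
  qed
  with C' show ?thesis by blast
qed

text \<open>Expresses moments of the near part through tail masses, the quantities that the
  recursion bounds.\<close>

lemma sum_near_layer:
  assumes g: "\<And>s t. 0 \<le> s \<Longrightarrow> s \<le> t \<Longrightarrow> g s \<le> g t" and g0: "g 0 \<ge> 0" and V: "V \<le> 2 ^ N"
  shows "(\<Sum>m\<in>near Y V. wt Y m * g (ln (real m))) \<le> g 1 + (\<Sum>k<N. g (2 ^ (k + 1)) * infsum (wt Y) (far Y (2 ^ k)))"
proof -
  have "g 1 \<ge> 0" "\<And>k::nat. g (2 ^ k) \<ge> 0" using g0 g[of 0 1] g[of 0 "2 ^ k" for k] by (auto intro: order.trans)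
  have "(\<Sum>m\<in>near Y V. wt Y m * g (ln (real m))) \<le>
     g 1 * (\<Sum>m\<in>near Y V. wt Y m) + (\<Sum>k<N. g (2 ^ (k + 1)) * (\<Sum>m | m \<in> near Y V \<and> 2 ^ k \<le> ln (real m). wt Y m))"
    using g g0 V by (intro sum_layer_bound finite_near) (auto simp: wt_nonneg near_def dest: BY_pos)
  also have "\<dots> \<le> g 1 * 1 + (\<Sum>k<N. g (2 ^ (k + 1)) * infsum (wt Y) (far Y (2 ^ k)))"
  proof (intro add_mono mult_left_mono sum_mono)
    fix k :: nat
    have "finite {m. m \<in> near Y V \<and> 2 ^ k \<le> ln (real m)}"
      by (rule finite_subset[OF _ finite_near[of Y V]]) auto
    then show "(\<Sum>m | m \<in> near Y V \<and> 2 ^ k \<le> ln (real m). wt Y m) \<le> infsum (wt Y) (far Y (2 ^ k))"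
      by (rule sum_far_le) (auto simp: near_def far_def)
  qed (rule infsum_far_bounds \<open>g 1 \<ge> 0\<close> \<open>\<And>k::nat. g (2 ^ k) \<ge> 0\<close>)+
  finally show ?thesis by simp
qed

lemma ln_one_plus_power2: "ln (1 + 2 ^ k) \<le> real k + 1"
proof -
  have "(1::real) + 2 ^ k \<le> 2 ^ (k + 1)" using one_le_power[of "2::real" k] by simp
  then have "ln (1 + 2 ^ k) \<le> ln (2 ^ (k + 1) :: real)" by (intro ln_mono) (auto simp: add_pos_pos)
  also have "\<dots> = real (k + 1) * ln 2" by (rule ln_realpow)
  also have "\<dots> \<le> real (k + 1) * 1" using ln_2_less_1 by (intro mult_left_mono) auto
  finally show ?thesis by simp
qed

text \<open>A bootstrap: the trivial bound \<open>k + 2\<close> for the slowly growing factor gives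
  a tail \<open>O((k + 2) / 2 ^ k)\<close> beyond \<open>2 ^ k\<close>, and this already makes the
  layered sum of that same factor converge.\<close>

lemma sum_near_ln_bounded:
  "\<exists>C>0. \<forall>Y\<ge>1. \<forall>V. (\<Sum>m\<in>near Y V. wt Y m * (1 + ln (1 + ln (real m)))) \<le> C"
proof -
  obtain C where C: "C > 0" "\<And>Y V. Y \<ge> 1 \<Longrightarrow> V \<ge> 1 \<Longrightarrow> infsum (wt Y) (far Y V) \<le>
      C / V * max 1 (\<Sum>m\<in>near Y V. wt Y m * (1 + ln (1 + ln (real m))))"
    using tail_weak by blast
  define g where "g = (\<lambda>t::real. 1 + ln (1 + t))"
  have g: "g s \<le> g t" if "0 \<le> s" "s \<le> t" for s t using that unfolding g_def by simp
  have gk: "g (2 ^ k) \<le> real k + 2" for k using ln_one_plus_power2[of k] unfolding g_def by simp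
  have g1: "g t \<ge> 1" if "t \<ge> 0" for t using that unfolding g_def by simp
  have tail: "infsum (wt Y) (far Y (2 ^ k)) \<le> C * (real k + 2) / 2 ^ k" if Y: "Y \<ge> 1" for Y and k :: nat
  proof -
    have "(\<Sum>m\<in>near Y (2 ^ k). wt Y m * g (ln (real m))) \<le> (\<Sum>m\<in>near Y (2 ^ k). wt Y m * g (2 ^ k))"
      by (intro sum_mono mult_left_mono wt_nonneg g) (auto simp: near_def dest: BY_pos)
    also have "\<dots> = sum (wt Y) (near Y (2 ^ k)) * g (2 ^ k)" by (simp add: sum_distrib_right)
    also have "\<dots> \<le> 1 * g (2 ^ k)"
      using infsum_far_bounds(3) g1[of "2 ^ k"] by (intro mult_right_mono) auto
    also have "\<dots> \<le> real k + 2" using gk by simp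
    finally have "max 1 (\<Sum>m\<in>near Y (2 ^ k). wt Y m * g (ln (real m))) \<le> real k + 2" by simp
    then have "C / 2 ^ k * max 1 (\<Sum>m\<in>near Y (2 ^ k). wt Y m * g (ln (real m))) \<le> C / 2 ^ k * (real k + 2)"
      using C(1) by (intro mult_left_mono) auto
    then show ?thesis using C(2)[OF Y, of "2 ^ k"] unfolding g_def by simp
  qed
  define u where "u = (\<lambda>k::nat. (real k + 3) * (real k + 2) / 2 ^ k)"
  have u: "summable u"
  proof (rule summable_comparison_test_bigo)
    show "summable (\<lambda>k. norm (real k powr (-2)))" by (simp add: summable_real_powr_iff)
    show "u \<in> O(\<lambda>k. real k powr (-2))" unfolding u_def by real_asymp
  qed
  have u0: "u k \<ge> 0" for k unfolding u_def by simp
  have "(\<Sum>m\<in>near Y V. wt Y m * (1 + ln (1 + ln (real m)))) \<le> 2 + C * suminf u" if Y: "Y \<ge> 1" for Y V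
  proof -
    obtain N where N: "V < 2 ^ N" using real_arch_pow[of 2 V] by auto
    have "(\<Sum>m\<in>near Y V. wt Y m * g (ln (real m))) \<le> g 1 + (\<Sum>k<N. g (2 ^ (k + 1)) * infsum (wt Y) (far Y (2 ^ k)))"
      using g g1[of 0] N by (intro sum_near_layer) auto
    also have "\<dots> \<le> 2 + (\<Sum>k<N. C * u k)"
    proof (intro add_mono sum_mono)
      show "g 1 \<le> 2" using gk[of 0] by simp
      fix k :: nat
      have "g (2 ^ (k + 1)) * infsum (wt Y) (far Y (2 ^ k)) \<le> (real k + 3) * (C * (real k + 2) / 2 ^ k)"
        using gk[of "k + 1"] tail[OF Y] infsum_far_bounds(1) by (intro mult_mono) auto
      then show "g (2 ^ (k + 1)) * infsum (wt Y) (far Y (2 ^ k)) \<le> C * u k"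
        unfolding u_def by (simp add: mult_ac)
    qed
    also have "\<dots> \<le> 2 + C * suminf u"
      unfolding sum_distrib_left[symmetric] using C(1) u u0
      by (intro add_left_mono mult_left_mono sum_le_suminf) auto
    finally show ?thesis unfolding g_def .
  qed
  moreover have "2 + C * suminf u > 0" using C(1) u u0 by (intro add_pos_nonneg mult_nonneg_nonneg suminf_nonneg) auto
  ultimately show ?thesis by blast
qed

theorem tail_bound:
  "\<exists>C>0. \<forall>Y\<ge>1. \<forall>V\<ge>1. infsum (wt Y) (far Y V) \<le> C / V"
proof -
  obtain C where C: "C > 0" "\<And>Y V. Y \<ge> 1 \<Longrightarrow> V \<ge> 1 \<Longrightarrow> infsum (wt Y) (far Y V) \<le>
      C / V * max 1 (\<Sum>m\<in>near Y V. wt Y m * (1 + ln (1 + ln (real m))))"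
    using tail_weak by blast
  obtain D where D: "D > 0" "\<And>Y V. Y \<ge> 1 \<Longrightarrow> (\<Sum>m\<in>near Y V. wt Y m * (1 + ln (1 + ln (real m)))) \<le> D"
    using sum_near_ln_bounded by blast
  have "infsum (wt Y) (far Y V) \<le> (C * max 1 D) / V" if "Y \<ge> 1" "V \<ge> 1" for Y V
  proof -
    have "infsum (wt Y) (far Y V) \<le> C / V * max 1 (\<Sum>m\<in>near Y V. wt Y m * (1 + ln (1 + ln (real m))))"
      using C(2) that by blast
    also have "\<dots> \<le> C / V * max 1 D" using C(1) D(2)[OF that(1)] that by (intro mult_left_mono max.mono) auto
    finally show ?thesis by simp
  qed
  moreover have "C * max 1 D > 0" using C by simp
  ultimately show ?thesis by blast
qed

text \<open>By layers the square costs \<open>4 ^ k\<close> against tails of size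
  \<open>2 ^ (-k)\<close>, so the geometric sum is governed by its last term, of order
  \<open>V\<close>.\<close>

lemma sum_near_square:
  "\<exists>C>0. \<forall>Y\<ge>1. \<forall>V\<ge>1. (\<Sum>m\<in>near Y V. wt Y m * (1 + ln (real m))\<^sup>2) \<le> C * V"
proof -
  obtain C where C: "C > 0" "\<And>Y V. Y \<ge> 1 \<Longrightarrow> V \<ge> 1 \<Longrightarrow> infsum (wt Y) (far Y V) \<le> C / V"
    using tail_bound by blast
  have "(\<Sum>m\<in>near Y V. wt Y m * (1 + ln (real m))\<^sup>2) \<le> (4 + 18 * C) * V" if Y: "Y \<ge> 1" and V: "V \<ge> 1" for Y V
  proof -
    obtain N where N: "V \<le> 2 ^ N" "2 ^ N \<le> 2 * V" using exists_power_two_between[OF V] by blast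
    have "(\<Sum>m\<in>near Y V. wt Y m * (\<lambda>t. (1 + t)\<^sup>2) (ln (real m))) \<le> (\<lambda>t. (1 + t)\<^sup>2) 1 +
       (\<Sum>k<N. (\<lambda>t. (1 + t)\<^sup>2) (2 ^ (k + 1)) * infsum (wt Y) (far Y (2 ^ k)))"
      using N by (intro sum_near_layer) (auto intro: power_mono)
    also have "\<dots> \<le> 4 + (\<Sum>k<N. 9 * C * 2 ^ k)"
    proof (intro add_mono sum_mono)
      fix k :: nat
      have "(1 + 2 ^ (k + 1) :: real) \<le> 3 * 2 ^ k" using one_le_power[of "2::real" k] by simp
      then have "(1 + 2 ^ (k + 1) :: real)\<^sup>2 \<le> (3 * 2 ^ k)\<^sup>2" by (intro power_mono) auto
      moreover have "infsum (wt Y) (far Y (2 ^ k)) \<le> C / 2 ^ k" using C(2)[OF Y] by simp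
      ultimately have "(1 + 2 ^ (k + 1))\<^sup>2 * infsum (wt Y) (far Y (2 ^ k)) \<le> (3 * 2 ^ k)\<^sup>2 * (C / 2 ^ k)"
        using infsum_far_bounds(1) by (intro mult_mono) auto
      also have "\<dots> = 9 * C * 2 ^ k" by (simp add: power2_eq_square)
      finally show "(\<lambda>t. (1 + t)\<^sup>2) (2 ^ (k + 1)) * infsum (wt Y) (far Y (2 ^ k)) \<le> 9 * C * 2 ^ k" by simp
    qed auto
    also have "\<dots> = 4 + 9 * C * (2 ^ N - 1)"
    proof -
      have "(\<Sum>k<N. (2::real) ^ k) = 2 ^ N - 1" by (induction N) auto
      then show ?thesis unfolding sum_distrib_left[symmetric] by simp
    qed
    also have "\<dots> \<le> 4 * V + 9 * C * (2 * V)" using N V C(1) by (intro add_mono mult_left_mono) auto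
    finally show ?thesis by (simp add: algebra_simps)
  qed
  moreover have "4 + 18 * C > 0" using C by simp
  ultimately show ?thesis by blast
qed

end

section \<open>Smooth members of a chain set\<close>

context chain_density
begin

lemma B_pos: "m \<in> B \<Longrightarrow> m > 0"
  by (simp add: chain_set_def)

lemma mem_BY: "m \<in> B \<Longrightarrow> real m \<le> real Y \<Longrightarrow> m \<in> BY Y"
  unfolding chain_upto_def using B_pos
  by (auto dest!: in_prime_factors_imp_dvd dvd_imp_le intro: order.trans)

lemma finite_B_ln_le: "finite {m \<in> B. ln (real m) \<le> V}"
  by (rule finite_subset[OF _ finite_ln_le[of V]]) (auto simp: B_pos)

text \<open>In the window \<open>ln (cut Y m)\<close> is \<open>O(V)\<close>, so Mertens' product
  makes \<open>wt Y m\<close> at least of order \<open>1 / (m V)\<close>; the factor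
  \<open>V\<close> is repaid by the tail bound \<open>C / V\<close>.\<close>

theorem sum_window_le:
  "\<exists>C>0. \<forall>V\<ge>1. (\<Sum>m | m \<in> B \<and> V \<le> ln (real m) \<and> ln (real m) \<le> 4 * V. 1 / real m) \<le> C"
proof -
  obtain c where c: "c > 0" "\<And>y. y \<ge> 1 \<Longrightarrow> c / (1 + ln y) \<le> euler_prod P 1 y"
    using euler_prod_1_bounds by blast
  obtain C where C: "C > 0" "\<And>Y V. Y \<ge> 1 \<Longrightarrow> V \<ge> 1 \<Longrightarrow> infsum (wt Y) (far Y V) \<le> C / V"
    using tail_bound by blast
  have lK: "ln K \<ge> 0" using K_ge by simp
  define M where "M = (9 + ln K) / c"
  have M: "M > 0" unfolding M_def using lK c by (simp add: add_pos_nonneg)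
  have "(\<Sum>m | m \<in> B \<and> V \<le> ln (real m) \<and> ln (real m) \<le> 4 * V. 1 / real m) \<le> M * C" if V: "V \<ge> 1" for V
  proof -
    let ?F = "{m. m \<in> B \<and> V \<le> ln (real m) \<and> ln (real m) \<le> 4 * V}"
    \<comment> \<open>Large enough for every member of the window to be
      \<open>Y\<close>-smooth.\<close>
    define Y where "Y = nat \<lceil>exp (4 * V)\<rceil>"
    have Y: "Y \<ge> 1" "exp (4 * V) \<le> real Y" unfolding Y_def using exp_gt_zero[of "4 * V"]
      by (simp_all add: of_nat_ceiling Suc_le_eq)
    have fin: "finite ?F" by (rule finite_subset[OF _ finite_B_ln_le[of "4 * V"]]) auto
    have F: "?F \<subseteq> far Y V"
    proof safe
      fix m assume m: "m \<in> B" "V \<le> ln (real m)" "ln (real m) \<le> 4 * V"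
      have "real m = exp (ln (real m))" using B_pos[OF m(1)] by simp
      also have "\<dots> \<le> real Y" using m Y by (meson exp_le_cancel_iff order.trans)
      finally show "m \<in> far Y V" using m mem_BY by (auto simp: far_def)
    qed
    have "(\<Sum>m\<in>?F. 1 / real m) \<le> (\<Sum>m\<in>?F. (M * V) * wt Y m)"
    proof (intro sum_mono)
      fix m assume m: "m \<in> ?F"
      then have m0: "m > 0" using B_pos by blast
      define L where "L = ln (real m)"
      have L: "V \<le> L" "L \<le> 4 * V" "L \<ge> 0" using m V unfolding L_def by auto
      note cb = cut_bounds[OF m0 Y(1)]
      have "1 + ln (cut Y m) \<le> 1 + (L + ln K + L)"
        using cb(3) ln_one_plus_le[OF L(3)] unfolding L_def by linarith
      also have "\<dots> \<le> 9 * V + ln K * V"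
        using L V mult_left_mono[OF V lK] by simp
      finally have "c / (9 * V + ln K * V) \<le> c / (1 + ln (cut Y m))"
        using c cb(4) by (intro divide_left_mono mult_pos_pos) auto
      also have "\<dots> \<le> euler_prod P 1 (cut Y m)" by (rule c(2)[OF cb(1)])
      finally have "c / (9 * V + ln K * V) / real m \<le> wt Y m"
        unfolding wt_def by (intro divide_right_mono) auto
      then have "(M * V) * (c / (9 * V + ln K * V) / real m) \<le> (M * V) * wt Y m"
        using M V by (intro mult_left_mono) auto
      moreover have "(M * V) * (c / (9 * V + ln K * V) / real m) = 1 / real m"
      proof -
        have "9 + ln K > 0" using lK by simp
        moreover have "9 * V + ln K * V = (9 + ln K) * V" by (simp add: distrib_right)
        ultimately show ?thesis using c V unfolding M_def by simp
      qed
      ultimately show "1 / real m \<le> (M * V) * wt Y m" by simp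
    qed
    also have "\<dots> = (M * V) * sum (wt Y) ?F" by (simp add: sum_distrib_left)
    also have "\<dots> \<le> (M * V) * (C / V)"
      using M V order.trans[OF sum_far_le[OF fin F] C(2)[OF Y(1) V]] by (intro mult_left_mono) auto
    also have "\<dots> = M * C" using V by simp
    finally show ?thesis .
  qed
  moreover have "M * C > 0" using M C by simp
  ultimately show ?thesis by blast
qed

text \<open>Rankin's method on the partition of unity: with \<open>\<eta> = 1 / ln Y\<close> a far
  summand at \<open>s = 1 - \<eta>\<close> grows like \<open>exp (\<eta> ln m)\<close>. The total is
  unchanged, so the near summands pay for this, and they lose only \<open>O(\<eta>)\<close>; that
  \<open>\<eta>\<close> cancels against the Mertens product at \<open>Y\<close> inside
  \<open>wt\<close>.\<close>

theorem smooth_decay: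
  "\<exists>A\<ge>1. \<exists>C>0. \<exists>Y\<^sub>0\<ge>2. \<forall>Y\<ge>Y\<^sub>0. \<forall>F v. finite F \<longrightarrow> F \<subseteq> far Y v \<longrightarrow> A * ln (real Y) \<le> v \<longrightarrow>
     (\<Sum>m\<in>F. 1 / real m) \<le> C * exp (- v / ln (real Y))"
proof -
  obtain C where C: "C \<ge> 0" "\<And>y \<eta>. y \<ge> 1 \<Longrightarrow> 0 \<le> \<eta> \<Longrightarrow> \<eta> \<le> 1/4 \<Longrightarrow> \<eta> * ln y \<le> 1 \<Longrightarrow>
    euler_prod P 1 y * exp (- (\<eta> * (ln y + C) + \<eta>\<^sup>2 * (ln y * (ln y + C)))) \<le> euler_prod P (1 - \<eta>) y"
    using euler_prod_left_lower by blast
  obtain c where c: "c > 0" "\<And>y. y \<ge> 1 \<Longrightarrow> c / (1 + ln y) \<le> euler_prod P 1 y"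
    using euler_prod_1_bounds by blast
  obtain D1 where D1: "D1 > 0" "\<And>Y V. Y \<ge> 1 \<Longrightarrow> (\<Sum>m\<in>near Y V. wt Y m * (1 + ln (1 + ln (real m)))) \<le> D1"
    using sum_near_ln_bounded by blast
  obtain D2 where D2: "D2 > 0" "\<And>Y V. Y \<ge> 1 \<Longrightarrow> V \<ge> 1 \<Longrightarrow> (\<Sum>m\<in>near Y V. wt Y m * (1 + ln (real m))\<^sup>2) \<le> D2 * V"
    using sum_near_square by blast
  have lK: "ln K \<ge> 0" using K_ge by simp
  \<comment> \<open>\<open>C0\<close> bounds both correction terms of the exponent, as
    \<open>\<eta> ln (cut Y m) \<le> 1\<close>. Then \<open>A = C0 + 1\<close> makes the exponent at
    least 1 beyond \<open>A ln Y\<close>, so that far summands at least double.\<close>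
  define C0 where "C0 = 2 + 2 * C"
  define A where "A = C0 + 1"
  define M where "M = (2 + ln K + C)\<^sup>2"
  \<comment> \<open>\<open>ln Y \<ge> 4\<close> is the condition \<open>\<eta> \<le> 1/4\<close> of
    the Euler bound left of 1.\<close>
  define Y\<^sub>0 where "Y\<^sub>0 = nat \<lceil>exp (4::real)\<rceil>"
  define E where "E = 4 * M * (D1 + D2 * A) * exp C0 / c"
  have C0: "C0 \<ge> 2" and A: "A \<ge> 3" using C(1) unfolding C0_def A_def by auto
  have M1: "2 + ln K + C \<le> M"
    unfolding M_def power2_eq_square using lK C(1) mult_left_mono[of 1 "2 + ln K + C" "2 + ln K + C"] by simp
  have M0: "M > 0" using M1 lK C(1) by linarith
  have E0: "E > 0" unfolding E_def using M0 D1 D2 A c by (simp add: add_pos_pos)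
  have Y0: "exp 4 \<le> real Y\<^sub>0" unfolding Y\<^sub>0_def by (simp add: of_nat_ceiling)
  have "(1::real) + 4 \<le> exp 4" by (rule exp_ge_add_one_self)
  then have Y02: "Y\<^sub>0 \<ge> 2" using Y0 by linarith
  have "(\<Sum>m\<in>F. 1 / real m) \<le> E * exp (- v / ln (real Y))"
    if YY: "Y \<ge> Y\<^sub>0" and F: "finite F" "F \<subseteq> far Y v" and v: "A * ln (real Y) \<le> v" for Y F v
  proof -
    define lY where "lY = ln (real Y)"
    have Y: "Y \<ge> 1" "Y \<ge> 2" using YY Y02 by auto
    have "exp 4 \<le> real Y" using Y0 YY by (meson of_nat_le_iff order.trans)
    then have lY: "lY \<ge> 4" unfolding lY_def using Y by (metis exp_le_cancel_iff exp_ln of_nat_0_less_iff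
        less_le_trans zero_less_one)
    define \<eta> where "\<eta> = 1 / lY"
    have \<eta>: "0 < \<eta>" "\<eta> \<le> 1/4" "\<eta> * lY = 1" using lY unfolding \<eta>_def by (auto simp: field_simps)
    define V where "V = A * lY"
    have V1: "V \<ge> 1" unfolding V_def using A lY mult_mono[of 1 A 1 lY] by simp
    have lower: "wt Y m * exp (\<eta> * ln (real m) - (\<eta> * (ln (cut Y m) + C) + \<eta>\<^sup>2 * (ln (cut Y m) * (ln (cut Y m) + C))))
        \<le> twt (1 - \<eta>) Y m" and clY: "\<eta> * ln (cut Y m) \<le> 1" if m: "m > 0" for m
    proof -
      note cb = cut_bounds[OF m Y(1)]
      show *: "\<eta> * ln (cut Y m) \<le> 1"
        using mult_left_mono[OF cb(5), of \<eta>] \<eta> unfolding lY_def by simp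
      have "wt Y m * exp (- (\<eta> * (ln (cut Y m) + C) + \<eta>\<^sup>2 * (ln (cut Y m) * (ln (cut Y m) + C))) - ((1 - \<eta>) - 1) * ln (real m))
        \<le> twt (1 - \<eta>) Y m"
        using \<eta> cb * m by (intro twt_ratio C(2)) auto
      then show "wt Y m * exp (\<eta> * ln (real m) - (\<eta> * (ln (cut Y m) + C) + \<eta>\<^sup>2 * (ln (cut Y m) * (ln (cut Y m) + C))))
        \<le> twt (1 - \<eta>) Y m" by (simp add: algebra_simps)
    qed
    have far: "wt Y m * exp (\<eta> * ln (real m) - C0) / 2 \<le> twt (1 - \<eta>) Y m - wt Y m" if m: "m \<in> far Y V" for m
    proof -
      have m0: "m > 0" using m BY_pos by (auto simp: far_def)
      note cb = cut_bounds[OF m0 Y(1)]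
      have "\<eta> * (ln (cut Y m) + C) \<le> 1 + C"
        using clY[OF m0] mult_right_mono[of \<eta> 1 C] \<eta> C(1) by (simp add: distrib_left)
      moreover from this have "(\<eta> * ln (cut Y m)) * (\<eta> * (ln (cut Y m) + C)) \<le> 1 * (1 + C)"
        using clY[OF m0] \<eta> cb C(1) by (intro mult_mono) auto
      then have "\<eta>\<^sup>2 * (ln (cut Y m) * (ln (cut Y m) + C)) \<le> 1 + C"
        by (simp add: power2_eq_square mult_ac)
      ultimately have "wt Y m * exp (\<eta> * ln (real m) - C0) \<le> wt Y m * exp (\<eta> * ln (real m) -
          (\<eta> * (ln (cut Y m) + C) + \<eta>\<^sup>2 * (ln (cut Y m) * (ln (cut Y m) + C))))"
        unfolding C0_def by (intro mult_left_mono wt_nonneg) auto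
      also have "\<dots> \<le> twt (1 - \<eta>) Y m" by (rule lower[OF m0])
      finally have 1: "wt Y m * exp (\<eta> * ln (real m) - C0) \<le> twt (1 - \<eta>) Y m" .
      have "\<eta> * (A * lY) \<le> \<eta> * ln (real m)" using m \<eta> unfolding far_def V_def by (intro mult_left_mono) auto
      then have "A \<le> \<eta> * ln (real m)" using \<eta>(3) by (simp add: mult.left_commute)
      then have "1 \<le> \<eta> * ln (real m) - C0" unfolding A_def by simp
      then have "2 \<le> exp (\<eta> * ln (real m) - C0)"
        using exp_ge_add_one_self[of "\<eta> * ln (real m) - C0"] by linarith
      then have "wt Y m * 2 \<le> wt Y m * exp (\<eta> * ln (real m) - C0)" by (intro mult_left_mono wt_nonneg)
      with 1 show ?thesis by linarith
    qed
    \<comment> \<open>\<open>exp x \<ge> 1 + x\<close> holds for every \<open>x\<close>, however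
      negative. The two loss terms are shaped after the two moments bounded earlier.\<close>
    have near: "- (wt Y m * (\<eta> * M * (1 + ln (1 + ln (real m))) + \<eta>\<^sup>2 * M * (1 + ln (real m))\<^sup>2))
        \<le> twt (1 - \<eta>) Y m - wt Y m" if m: "m \<in> near Y V" for m
    proof -
      have m0: "m > 0" using m BY_pos by (auto simp: near_def)
      note cb = cut_bounds[OF m0 Y(1)]
      define L where "L = ln (real m)"
      define y where "y = ln (cut Y m)"
      have L: "L \<ge> 0" using m0 unfolding L_def by simp
      have l0: "ln (1 + L) \<ge> 0" "ln (1 + L) \<le> L" using L ln_one_plus_le[OF L] by auto
      have y: "y \<ge> 0" "y \<le> L + ln K + ln (1 + L)" using cb unfolding y_def L_def by auto
      have "y - L + C \<le> (2 + ln K + C) * 1 + (2 + ln K + C) * ln (1 + L)"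
        using y(2) l0 lK C(1) mult_right_mono[of 1 "2 + ln K + C" "ln (1 + L)"] by simp
      also have "\<dots> = (2 + ln K + C) * (1 + ln (1 + L))" by (simp add: distrib_left)
      also have "\<dots> \<le> M * (1 + ln (1 + L))" using M1 l0 by (intro mult_right_mono) auto
      finally have 1: "\<eta> * (y - L + C) \<le> \<eta> * (M * (1 + ln (1 + L)))" using \<eta> by (intro mult_left_mono) auto
      have "y + C \<le> (2 + ln K + C) + (2 + ln K + C) * L"
        using y(2) l0 lK C(1) L mult_right_mono[of 2 "2 + ln K + C" L] by simp
      then have yC: "y + C \<le> (2 + ln K + C) * (1 + L)" by (simp add: distrib_left)
      then have "y * (y + C) \<le> ((2 + ln K + C) * (1 + L)) * ((2 + ln K + C) * (1 + L))"
      proof (intro mult_mono)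
        show "y \<le> (2 + ln K + C) * (1 + L)" using yC C(1) by linarith
        show "0 \<le> (2 + ln K + C) * (1 + L)" using C(1) L lK by (intro mult_nonneg_nonneg) auto
      qed (use yC y C(1) in auto)
      then have "y * (y + C) \<le> M * (1 + L)\<^sup>2" unfolding M_def by (simp add: power2_eq_square mult_ac)
      then have 2: "\<eta>\<^sup>2 * (y * (y + C)) \<le> \<eta>\<^sup>2 * (M * (1 + L)\<^sup>2)" by (intro mult_left_mono) auto
      define x where "x = \<eta> * L - (\<eta> * (y + C) + \<eta>\<^sup>2 * (y * (y + C)))"
      have "- (\<eta> * M * (1 + ln (1 + L)) + \<eta>\<^sup>2 * M * (1 + L)\<^sup>2) \<le> x"
        using 1 2 unfolding x_def by (simp add: algebra_simps)
      then have "wt Y m * (- (\<eta> * M * (1 + ln (1 + L)) + \<eta>\<^sup>2 * M * (1 + L)\<^sup>2)) \<le> wt Y m * x"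
        by (intro mult_left_mono wt_nonneg)
      also have "\<dots> \<le> wt Y m * (exp x - 1)"
      proof (intro mult_left_mono wt_nonneg)
        show "x \<le> exp x - 1" using exp_ge_add_one_self[of x] by linarith
      qed
      also have "\<dots> \<le> twt (1 - \<eta>) Y m - wt Y m"
        using lower[OF m0] unfolding x_def y_def L_def by (simp add: right_diff_distrib)
      finally show ?thesis unfolding L_def by (simp only: mult_minus_right)
    qed
    have t: "(twt (1 - \<eta>) Y has_sum 1) (BY Y)" using \<eta> by (intro twt_has_sum) auto
    have d: "((\<lambda>m. twt (1 - \<eta>) Y m - wt Y m) has_sum (1 - 1)) (BY Y)"
      using has_sum_add[OF t has_sum_uminusI[OF wt_has_sum]] by simp
    have vV: "v \<ge> V" using v unfolding V_def lY_def .
    then have FV: "F \<subseteq> far Y V" using F unfolding far_def by auto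
    have "(\<Sum>m\<in>F. wt Y m * exp (\<eta> * ln (real m) - C0) / 2) \<le> (\<Sum>m\<in>F. twt (1 - \<eta>) Y m - wt Y m)"
      using FV by (intro sum_mono far) auto
    also have "\<dots> \<le> infsum (\<lambda>m. twt (1 - \<eta>) Y m - wt Y m) (far Y V)"
    proof (rule finite_sum_le_infsum)
      show "(\<lambda>m. twt (1 - \<eta>) Y m - wt Y m) summable_on far Y V" by (rule far_near_split(2)[OF d])
      fix m assume "m \<in> far Y V - F"
      then have "m \<in> far Y V" by simp
      from far[OF this] show "0 \<le> twt (1 - \<eta>) Y m - wt Y m"
        using mult_nonneg_nonneg[OF wt_nonneg[of Y m] exp_ge_zero[of "\<eta> * ln (real m) - C0"]] by linarith
    qed (use F FV in auto)
    also have "\<dots> = - (\<Sum>m\<in>near Y V. twt (1 - \<eta>) Y m - wt Y m)"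
      using far_near_split(1)[OF d, of V] by simp
    also have "\<dots> \<le> - (\<Sum>m\<in>near Y V. - (wt Y m * (\<eta> * M * (1 + ln (1 + ln (real m))) + \<eta>\<^sup>2 * M * (1 + ln (real m))\<^sup>2)))"
      by (intro le_imp_neg_le sum_mono near)
    also have "\<dots> = \<eta> * M * (\<Sum>m\<in>near Y V. wt Y m * (1 + ln (1 + ln (real m)))) +
        \<eta>\<^sup>2 * M * (\<Sum>m\<in>near Y V. wt Y m * (1 + ln (real m))\<^sup>2)"
      unfolding sum_negf minus_minus sum_distrib_left sum.distrib[symmetric]
      by (intro sum.cong) (auto simp: algebra_simps)
    also have "\<dots> \<le> \<eta> * M * D1 + \<eta>\<^sup>2 * M * (D2 * V)"
      using \<eta> M0 by (intro add_mono mult_left_mono D1 D2 Y V1) auto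
    \<comment> \<open>\<open>\<eta> V = A\<close> reduces the quadratic loss to the same order
      \<open>\<eta>\<close> as the linear one.\<close>
    also have "\<dots> = \<eta> * (M * (D1 + D2 * A))"
      using \<eta>(3) unfolding V_def by (simp add: power2_eq_square algebra_simps)
    finally have S: "(\<Sum>m\<in>F. wt Y m * exp (\<eta> * ln (real m) - C0) / 2) \<le> \<eta> * (M * (D1 + D2 * A))" .
    have "(\<Sum>m\<in>F. (\<eta> * c * exp (\<eta> * v - C0) / 4) * (1 / real m)) \<le> (\<Sum>m\<in>F. wt Y m * exp (\<eta> * ln (real m) - C0) / 2)"
    proof (intro sum_mono)
      fix m assume "m \<in> F"
      then have m: "m \<in> far Y v" "m \<in> far Y V" using F FV by auto
      then have m0: "m > 0" and L: "v \<le> ln (real m)" using BY_pos by (auto simp: far_def)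
      \<comment> \<open>Far elements are at least \<open>Y\<close>, so their cut-off is
        \<open>Y\<close> itself and the Euler product is at least of order
        \<open>1 / ln Y\<close>.\<close>
      have "lY \<le> V" unfolding V_def using A lY mult_right_mono[of 1 A lY] by simp
      then have "lY \<le> ln (real m)" using m(2) unfolding far_def by auto
      then have "real Y \<le> real m" unfolding lY_def using Y m0 by simp
      then have cut: "cut Y m = real Y" using \<theta>_ge[OF m0] unfolding cut_def by simp
      have "c / (2 * lY) \<le> c / (1 + lY)" using lY c by (intro divide_left_mono) auto
      also have "\<dots> \<le> euler_prod P 1 (cut Y m)" unfolding cut lY_def using Y by (intro c) auto
      finally have "c / (2 * lY) / real m \<le> wt Y m" unfolding wt_def by (intro divide_right_mono) auto
      moreover have "exp (\<eta> * v - C0) \<le> exp (\<eta> * ln (real m) - C0)"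
        using L \<eta> by (auto intro: mult_left_mono)
      ultimately have "c / (2 * lY) / real m * exp (\<eta> * v - C0) \<le> wt Y m * exp (\<eta> * ln (real m) - C0)"
        using c lY by (intro mult_mono) (auto simp: wt_nonneg)
      then show "(\<eta> * c * exp (\<eta> * v - C0) / 4) * (1 / real m) \<le> wt Y m * exp (\<eta> * ln (real m) - C0) / 2"
        unfolding \<eta>_def by simp
    qed
    also note S
    finally have "\<eta> * ((c * exp (\<eta> * v - C0) / 4) * (\<Sum>m\<in>F. 1 / real m)) \<le> \<eta> * (M * (D1 + D2 * A))"
      unfolding sum_distrib_left[symmetric] by (simp add: mult_ac)
    then have "(c * exp (\<eta> * v - C0) / 4) * (\<Sum>m\<in>F. 1 / real m) \<le> M * (D1 + D2 * A)"
      by (rule mult_le_cancel_left_pos[OF \<eta>(1), THEN iffD1])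
    then have "(\<Sum>m\<in>F. 1 / real m) \<le> M * (D1 + D2 * A) / (c * exp (\<eta> * v - C0) / 4)"
      using c by (simp add: pos_le_divide_eq mult_ac)
    also have "\<dots> = E * exp (- (\<eta> * v))"
      unfolding E_def exp_diff exp_minus using c(1) by (simp add: field_simps)
    also have "- (\<eta> * v) = - v / ln (real Y)" unfolding \<eta>_def lY_def by simp
    finally show ?thesis .
  qed
  then show ?thesis using A E0 Y02 by (intro exI[of _ A] conjI exI[of _ E] exI[of _ Y\<^sub>0]) auto
qed

text \<open>For \<open>v < A ln Y\<close> the exponential is bounded below, and the window bound
  without smoothness suffices.\<close>

lemma sum_window_smooth:
  "\<exists>C>0. \<exists>Y\<^sub>0\<ge>2. \<forall>Y\<ge>Y\<^sub>0. \<forall>v\<ge>1.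
     (\<Sum>m | m \<in> BY Y \<and> v \<le> ln (real m) \<and> ln (real m) \<le> 4 * v. 1 / real m) \<le> C * exp (- v / ln (real Y))"
proof -
  obtain C where C: "C > 0" "\<And>V. V \<ge> 1 \<Longrightarrow>
      (\<Sum>m | m \<in> B \<and> V \<le> ln (real m) \<and> ln (real m) \<le> 4 * V. 1 / real m) \<le> C"
    using sum_window_le by blast
  obtain A E Y\<^sub>0 where E: "A \<ge> 1" "E > 0" "Y\<^sub>0 \<ge> 2" "\<And>Y F v. Y \<ge> Y\<^sub>0 \<Longrightarrow> finite F \<Longrightarrow> F \<subseteq> far Y v \<Longrightarrow>
      A * ln (real Y) \<le> v \<Longrightarrow> (\<Sum>m\<in>F. 1 / real m) \<le> E * exp (- v / ln (real Y))"
    using smooth_decay by metis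
  have "(\<Sum>m | m \<in> BY Y \<and> v \<le> ln (real m) \<and> ln (real m) \<le> 4 * v. 1 / real m)
      \<le> max E (C * exp A) * exp (- v / ln (real Y))" if Y: "Y \<ge> Y\<^sub>0" and v: "v \<ge> 1" for Y v
  proof -
    let ?F = "{m. m \<in> BY Y \<and> v \<le> ln (real m) \<and> ln (real m) \<le> 4 * v}"
    have fin: "finite ?F" by (rule finite_subset[OF _ finite_B_ln_le[of "4 * v"]]) (auto simp: chain_upto_def)
    have lY: "ln (real Y) > 0" using Y E(3) by simp
    show ?thesis
    proof (cases "A * ln (real Y) \<le> v")
      case True
      then have "(\<Sum>m\<in>?F. 1 / real m) \<le> E * exp (- v / ln (real Y))"
        using Y fin by (intro E) (auto simp: far_def)
      also have "\<dots> \<le> max E (C * exp A) * exp (- v / ln (real Y))" by (intro mult_right_mono) auto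
      finally show ?thesis .
    next
      case False
      have "(\<Sum>m\<in>?F. 1 / real m) \<le> (\<Sum>m | m \<in> B \<and> v \<le> ln (real m) \<and> ln (real m) \<le> 4 * v. 1 / real m)"
        by (intro sum_mono2 finite_subset[OF _ finite_B_ln_le[of "4 * v"]]) (auto simp: chain_upto_def)
      also have "\<dots> \<le> C" by (rule C(2)[OF v])
      also have "C * 1 \<le> C * (exp A * exp (- v / ln (real Y)))"
      proof (intro mult_left_mono)
        have "v / ln (real Y) \<le> A" using False lY by (simp add: field_simps)
        then show "1 \<le> exp A * exp (- v / ln (real Y))" by (simp add: mult_exp_exp)
      qed (use C in auto)
      then have "C \<le> C * exp A * exp (- v / ln (real Y))" by (simp add: mult_ac)
      also have "\<dots> \<le> max E (C * exp A) * exp (- v / ln (real Y))" by (intro mult_right_mono) auto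
      finally show ?thesis .
    qed
  qed
  moreover have "max E (C * exp A) > 0" using E by simp
  ultimately show ?thesis using E(3) by blast
qed

text \<open>The members whose ratio of \<open>v\<close> to the logarithm of the largest prime is at
  least \<open>V\<close> are \<open>exp (v / V)\<close>-smooth and contribute
  \<open>O(exp (- d V))\<close>; this decay makes the layered sum of the ratio converge.\<close>

theorem sum_window_gpf:
  "\<exists>C>0. \<forall>v\<ge>1. (\<Sum>m | m \<in> B \<and> v \<le> ln (real m) \<and> ln (real m) \<le> 4 * v.
      1 / real m * (v / ln (real (Max (prime_factors m))))) \<le> C"
proof -
  obtain C Y\<^sub>0 where C: "C > 0" "Y\<^sub>0 \<ge> 2" "\<And>Y v. Y \<ge> Y\<^sub>0 \<Longrightarrow> v \<ge> 1 \<Longrightarrow>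
     (\<Sum>m | m \<in> BY Y \<and> v \<le> ln (real m) \<and> ln (real m) \<le> 4 * v. 1 / real m) \<le> C * exp (- v / ln (real Y))"
    using sum_window_smooth by blast
  obtain D where D: "D > 0" "\<And>V. V \<ge> 1 \<Longrightarrow>
      (\<Sum>m | m \<in> B \<and> V \<le> ln (real m) \<and> ln (real m) \<le> 4 * V. 1 / real m) \<le> D"
    using sum_window_le by blast
  define l0 where "l0 = ln (real Y\<^sub>0)"
  have l0: "l0 \<ge> ln 2" unfolding l0_def using C(2) by simp
  have l0p: "l0 > 0" using l0 ln_gt_zero[of "2::real"] by linarith
  \<comment> \<open>The smooth estimate starts at \<open>Y\<^sub>0\<close>, so smaller smoothness
    bounds are raised to it. As \<open>V \<le> v / ln 2\<close> in all nonempty cases, this only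
    weakens the decay rate from 1 to \<open>d\<close>.\<close>
  define d where "d = ln 2 / l0"
  have d: "0 < d" "d \<le> 1" unfolding d_def using l0 l0p by auto
  define E where "E = D + 8 * C / d\<^sup>2"
  have "(\<Sum>m | m \<in> B \<and> v \<le> ln (real m) \<and> ln (real m) \<le> 4 * v.
      1 / real m * (v / ln (real (Max (prime_factors m))))) \<le> E" if v: "v \<ge> 1" for v
  proof -
    let ?F = "{m. m \<in> B \<and> v \<le> ln (real m) \<and> ln (real m) \<le> 4 * v}"
    let ?L = "\<lambda>m. v / ln (real (Max (prime_factors m)))"
    have fin: "finite ?F" by (rule finite_subset[OF _ finite_B_ln_le[of "4 * v"]]) auto
    have gpf: "Max (prime_factors m) \<in> prime_factors m \<and> Max (prime_factors m) \<ge> 2" if "m \<in> ?F" for m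
    proof -
      have "m > 1"
      proof (rule ccontr)
        assume "\<not> m > 1"
        then have "m = 1" using that B_pos[of m] by auto
        then show False using that v by auto
      qed
      then have "prime_factors m \<noteq> {}" by (auto simp: prime_factorization_empty_iff)
      then have "Max (prime_factors m) \<in> prime_factors m" by (intro Max_in) auto
      moreover from this have "Max (prime_factors m) \<ge> 2" by (intro prime_ge_2_nat) auto
      ultimately show ?thesis by simp
    qed
    obtain N where N: "v / ln 2 < 2 ^ N" using real_arch_pow[of 2 "v / ln 2"] by auto
    have L: "0 \<le> ?L m \<and> ?L m \<le> v / ln 2" if "m \<in> ?F" for m
    proof -
      have "ln 2 \<le> ln (real (Max (prime_factors m)))" using gpf[OF that] by simp
      moreover from this have "0 < ln (real (Max (prime_factors m)))" using ln_gt_zero[of "2::real"] by linarith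
      ultimately show ?thesis using v
        by (intro conjI divide_nonneg_nonneg divide_left_mono mult_pos_pos) auto
    qed
    have tail: "(\<Sum>m | m \<in> ?F \<and> V \<le> ?L m. 1 / real m) \<le> C * exp (- (d * V))" if V: "V \<ge> 1" for V
    proof (cases "V \<le> v / ln 2")
      case False
      then have "{m. m \<in> ?F \<and> V \<le> ?L m} = {}" using L by fastforce
      then show ?thesis using C(1) by (simp only: sum.empty) simp
    next
      case True
      define Y where "Y = max Y\<^sub>0 (nat \<lfloor>exp (v / V)\<rfloor>)"
      have "Y \<ge> Y\<^sub>0" unfolding Y_def by simp
      have lY0: "ln (real Y) > 0" using \<open>Y \<ge> Y\<^sub>0\<close> C(2) by simp
      have sub: "{m. m \<in> ?F \<and> V \<le> ?L m} \<subseteq> {m. m \<in> BY Y \<and> v \<le> ln (real m) \<and> ln (real m) \<le> 4 * v}"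
      proof safe
        fix m assume m: "m \<in> B" "v \<le> ln (real m)" "ln (real m) \<le> 4 * v" "V \<le> ?L m"
        define q where "q = Max (prime_factors m)"
        have q: "q \<in> prime_factors m" "q \<ge> 2" using gpf[of m] m unfolding q_def by auto
        have "ln (real q) > 0" using q by simp
        then have "ln (real q) \<le> v / V" using m(4) V unfolding q_def by (simp add: field_simps)
        then have "real q \<le> exp (v / V)" using q by (metis exp_le_cancel_iff exp_ln of_nat_0_less_iff
              less_le_trans zero_less_numeral)
        then have "q \<le> Y" unfolding Y_def by (simp add: le_nat_floor max.coboundedI2)
        moreover have "p \<le> q" if "p \<in> prime_factors m" for p using that unfolding q_def by simp
        ultimately show "m \<in> BY Y" unfolding chain_upto_def using m(1) by (auto intro: order.trans)
      qed
      have "(\<Sum>m | m \<in> ?F \<and> V \<le> ?L m. 1 / real m) \<le>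
          (\<Sum>m | m \<in> BY Y \<and> v \<le> ln (real m) \<and> ln (real m) \<le> 4 * v. 1 / real m)"
        by (intro sum_mono2 finite_subset[OF _ finite_B_ln_le[of "4 * v"]] sub) (auto simp: chain_upto_def)
      also have "\<dots> \<le> C * exp (- v / ln (real Y))" using \<open>Y \<ge> Y\<^sub>0\<close> v by (intro C)
      also have "\<dots> \<le> C * exp (- (d * V))"
      proof (intro mult_left_mono, unfold exp_le_cancel_iff)
        have "d * V * ln (real Y) \<le> v"
        proof (cases "Y = Y\<^sub>0")
          case Y: True
          have "V * ln 2 \<le> v" using True ln_gt_zero[of "2::real"] by (simp add: field_simps)
          then show ?thesis unfolding Y d_def l0_def[symmetric] using l0p by (simp add: mult.commute)
        next
          case False
          then have Y: "Y = nat \<lfloor>exp (v / V)\<rfloor>" unfolding Y_def by linarith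
          then have "real Y \<le> exp (v / V)" by simp
          then have "ln (real Y) \<le> ln (exp (v / V))" using \<open>Y \<ge> Y\<^sub>0\<close> C(2) by (intro ln_mono) auto
          then have "V * ln (real Y) \<le> v" using V by (simp add: field_simps)
          moreover have "d * (V * ln (real Y)) \<le> 1 * (V * ln (real Y))"
            using d lY0 V by (intro mult_right_mono) auto
          ultimately show ?thesis by (simp add: mult_ac)
        qed
        then show "- v / ln (real Y) \<le> - (d * V)" using lY0 by (simp add: field_simps)
      qed (use C in auto)
      finally show ?thesis .
    qed
    have "(\<Sum>m\<in>?F. 1 / real m * (\<lambda>t. t) (?L m)) \<le> (\<lambda>t. t) 1 * (\<Sum>m\<in>?F. 1 / real m) +
      (\<Sum>k<N. (\<lambda>t. t) (2 ^ (k + 1)) * (\<Sum>m | m \<in> ?F \<and> 2 ^ k \<le> ?L m. 1 / real m))"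
    proof (rule sum_layer_bound[OF fin])
      show "0 \<le> ?L m \<and> ?L m < 2 ^ N" if "m \<in> ?F" for m using L[OF that] N by linarith
    qed auto
    also have "\<dots> \<le> D + (\<Sum>k<N. (4 * C / d\<^sup>2) * (1/2) ^ k)"
    proof (intro add_mono sum_mono)
      show "1 * (\<Sum>m\<in>?F. 1 / real m) \<le> D" using D(2)[OF v] by simp
      fix k :: nat
      define x where "x = d * 2 ^ k"
      have x: "x > 0" unfolding x_def using d by simp
      \<comment> \<open>Against the factor \<open>2 ^ (k + 1)\<close> a decay like
        \<open>2 / x\<^sup>2\<close> in place of \<open>exp (- x)\<close> leaves a geometric
        series.\<close>
      have "1 + x + x\<^sup>2 / 2 \<le> exp x" using exp_lower_Taylor_quadratic[of x] x by simp
      then have "x\<^sup>2 / 2 \<le> exp x" using x by linarith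
      then have "inverse (exp x) \<le> inverse (x\<^sup>2 / 2)" using x by (intro le_imp_inverse_le) auto
      then have ex: "exp (- x) \<le> 2 / x\<^sup>2" by (simp add: exp_minus field_simps)
      have "2 ^ (k + 1) * (\<Sum>m | m \<in> ?F \<and> 2 ^ k \<le> ?L m. 1 / real m) \<le> 2 ^ (k + 1) * (C * exp (- (d * 2 ^ k)))"
        by (intro mult_left_mono tail) auto
      also have "\<dots> \<le> 2 ^ (k + 1) * (C * (2 / x\<^sup>2))"
        using C(1) ex unfolding x_def by (intro mult_left_mono) auto
      also have "\<dots> = (4 * C / d\<^sup>2) * (1/2) ^ k"
        unfolding x_def by (simp add: power2_eq_square field_simps)
      finally show "(\<lambda>t. t) (2 ^ (k + 1)) * (\<Sum>m | m \<in> ?F \<and> 2 ^ k \<le> ?L m. 1 / real m) \<le> (4 * C / d\<^sup>2) * (1/2) ^ k" .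
    qed
    also have "\<dots> = D + (4 * C / d\<^sup>2) * (\<Sum>k<N. (1/2) ^ k)"
      by (simp add: sum_distrib_left)
    also have "\<dots> \<le> D + (4 * C / d\<^sup>2) * 2"
    proof (intro add_left_mono mult_left_mono)
      have "(\<Sum>k<N. (1/2::real) ^ k) = 2 - 2 * (1/2) ^ N" by (induction N) auto
      then show "(\<Sum>k<N. (1/2::real) ^ k) \<le> 2" by simp
    qed (use C(1) in auto)
    also have "\<dots> = E" unfolding E_def by simp
    finally show ?thesis .
  qed
  moreover have "E > 0" unfolding E_def using C D by (simp add: add_pos_nonneg)
  ultimately show ?thesis by blast
qed

end

section \<open>Upper bound for the counting function\<close>

text \<open>\<open>m\<close> is the longest initial segment of the sorted factorization that stays
  within \<open>x\<close>, and \<open>p\<close> is the prime that follows it.\<close>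

lemma chain_set_segment:
  assumes n: "n \<in> chain_set P \<theta>"
    and mono: "\<And>m k. m > 0 \<Longrightarrow> k > 0 \<Longrightarrow> \<theta> m \<le> \<theta> (m * k)"
    and x: "1 \<le> x" "x < real n"
  obtains m p where "m * p \<in> chain_set P \<theta>" "m * p dvd n" "m > 0" "prime p" "real m \<le> x"
    "x < real (m * p)" "real p \<le> \<theta> m" "\<forall>q\<in>prime_factors (n div (m * p)). p \<le> q"
    "\<forall>q\<in>prime_factors (m * p). q \<le> p"
proof -
  have n0: "n > 0" using n by (simp add: chain_set_def)
  \<comment> \<open>Initial segments are encoded as divisors none of whose primes exceeds a prime of
    the cofactor.\<close>
  define S where "S = {m. m dvd n \<and> real m \<le> x \<and> (\<forall>q\<in>prime_factors m. \<forall>p\<in>prime_factors (n div m). q \<le> p)}"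
  have fin: "finite S" by (rule finite_subset[of _ "{..n}"]) (use n0 in \<open>auto simp: S_def dest: dvd_imp_le\<close>)
  have "1 \<in> S" using x by (auto simp: S_def)
  define m where "m = Max S"
  have mS: "m \<in> S" unfolding m_def using fin \<open>1 \<in> S\<close> by (intro Max_in) auto
  define r where "r = n div m"
  have nm: "n = m * r" using mS unfolding r_def S_def by simp
  have m0: "m > 0" and r0: "r > 0" using n0 nm by auto
  have "r \<noteq> 1" using mS x nm by (auto simp: S_def)
  then have ne: "prime_factors r \<noteq> {}" using r0 by (auto simp: prime_factorization_empty_iff)
  define p where "p = Min (prime_factors r)"
  have pr: "p \<in> prime_factors r" unfolding p_def using ne by (intro Min_in) auto
  then have p: "prime p" "p dvd r" by auto
  have pmin: "p \<le> q" if "q \<in> prime_factors r" for q unfolding p_def using that by simp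
  have mp: "q \<le> p" if "q \<in> prime_factors m" for q using that mS pr unfolding S_def r_def by auto
  obtain r' where r': "r = p * r'" using p by (auto elim: dvdE)
  have r'0: "r' > 0" using r' r0 by auto
  have dv: "m * p dvd n" using nm r' by simp
  have div': "n div (m * p) = r'" using nm r' m0 p prime_gt_0_nat[of p] by simp
  have sub': "\<forall>q\<in>prime_factors (n div (m * p)). p \<le> q"
  proof
    fix q assume "q \<in> prime_factors (n div (m * p))"
    then have "q \<in> prime_factors r" unfolding div' using r' r0 by (auto simp: in_prime_factors_iff)
    then show "p \<le> q" by (rule pmin)
  qed
  have pp: "\<forall>q\<in>prime_factors (m * p). q \<le> p"
    using mp m0 p prime_factors_product[of m p] prime_gt_0_nat[of p] by (auto simp: prime_prime_factors)
  have big: "x < real (m * p)"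
  proof (rule ccontr)
    assume "\<not> x < real (m * p)"
    then have "m * p \<in> S" unfolding S_def using dv sub' pp by (auto intro: order.trans)
    then have "m * p \<le> m" unfolding m_def using fin by (intro Max_ge)
    then show False using m0 prime_gt_1_nat[OF p(1)] by simp
  qed
  have mult: "multiplicity q n = multiplicity q m" if "prime q" "q < p" for q
  proof -
    have "\<not> q dvd r" using pmin[of q] that r0 by (auto simp: in_prime_factors_iff)
    then show ?thesis unfolding nm using that m0 r0
      by (subst prime_elem_multiplicity_mult_distrib) (auto simp: not_dvd_imp_multiplicity_0)
  qed
  have mult': "multiplicity q (m * p) = multiplicity q n" if "prime q" "q < p" for q
  proof -
    have "\<not> q dvd p" using that p primes_dvd_imp_eq by blast
    then show ?thesis unfolding mult[OF that] using that m0 p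
      by (subst prime_elem_multiplicity_mult_distrib) (auto simp: not_dvd_imp_multiplicity_0)
  qed
  have chain: "q \<in> P \<and> real q \<le> \<theta> (low_part q n)" if "q \<in> prime_factors n" for q
    using n that by (auto simp: chain_set_def)
  have "m * p \<in> chain_set P \<theta>"
    unfolding chain_set_def
  proof safe
    show "0 < m * p" using m0 p prime_gt_0_nat by auto
    fix q assume q: "q \<in> prime_factors (m * p)"
    then have "q \<in> prime_factors n" using dv n0 by (auto simp: in_prime_factors_iff intro: dvd_trans)
    moreover have "low_part q (m * p) = low_part q n"
    proof (rule low_part_cong)
      fix s :: nat assume "prime s" "s < q"
      then show "multiplicity s (m * p) = multiplicity s n" using q pp by (intro mult') auto
    qed
    ultimately show "q \<in> P" "real q \<le> \<theta> (low_part q (m * p))" using chain by auto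
  qed
  moreover have "real p \<le> \<theta> m"
  proof -
    \<comment> \<open>If \<open>m\<close> already contains copies of \<open>p\<close>, the test of
      \<open>p\<close> was made against a smaller segment; it divides \<open>m\<close>, and
      \<open>\<theta>\<close> is monotone.\<close>
    have "low_part p n dvd m"
    proof (rule multiplicity_le_imp_dvd)
      fix q :: nat assume "prime q"
      then show "multiplicity q (low_part p n) \<le> multiplicity q m"
        using mult by (auto simp: multiplicity_low_part)
    qed auto
    then obtain k where k: "m = low_part p n * k" by (auto elim: dvdE)
    have "p \<in> prime_factors n" using pr nm n0 by (auto simp: in_prime_factors_iff)
    then have "real p \<le> \<theta> (low_part p n)" using chain by blast
    also have "\<dots> \<le> \<theta> m" unfolding k using m0 k by (intro mono) (auto intro: Nat.gr0I)
    finally show ?thesis .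
  qed
  moreover have "real m \<le> x" using mS by (simp add: S_def)
  ultimately show ?thesis using that[of m p] dv m0 p big sub' pp by blast
qed

section \<open>Sums over integers without small prime factors\<close>

context prime_density
begin

definition rough_upto :: "nat \<Rightarrow> real \<Rightarrow> nat set" where
  "rough_upto w Z = {r. r > 0 \<and> real r \<le> Z \<and> (\<forall>p\<in>prime_factors r. p \<in> P \<and> w \<le> p)}"

lemma finite_rough_upto [simp, intro]: "finite (rough_upto w Z)"
  by (rule finite_subset[of _ "{..nat \<lfloor>Z\<rfloor>}"]) (auto simp: rough_upto_def le_nat_floor)

text \<open>For constant \<open>\<theta> = Y\<close> every \<open>Y\<close>-smooth integer over the
  primes from \<open>w\<close> on is in the chain set, so the partition of unity bounds the sum by
  the inverse Euler product over the primes from \<open>w\<close> to \<open>Y\<close>, a quotient of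
  two Mertens products.\<close>

lemma sum_inverse_rough_le:
  "\<exists>C>0. \<forall>w\<ge>2. \<forall>Z\<ge>real w. (\<Sum>r\<in>rough_upto w Z. 1 / real r) \<le> C * (1 + ln Z) / ln (real w)"
proof -
  obtain c C where c: "c > 0" "C > 0" "\<And>y. y \<ge> 1 \<Longrightarrow> c / (1 + ln y) \<le> euler_prod P 1 y"
     "\<And>y. y \<ge> 1 \<Longrightarrow> euler_prod P 1 y \<le> C / (1 + ln y)"
    using euler_prod_1_bounds by blast
  have "(\<Sum>r\<in>rough_upto w Z. 1 / real r) \<le> C / c * (1 + ln Z) / ln (real w)"
    if w: "w \<ge> 2" and Z: "Z \<ge> real w" for w Z
  proof -
    define P' where "P' = {p \<in> P. w \<le> p}"
    define Y where "Y = nat \<lfloor>Z\<rfloor>"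
    have wY: "w \<le> Y" unfolding Y_def using Z by (simp add: le_nat_floor)
    have YZ: "real Y \<le> Z" unfolding Y_def using Z w by simp
    have Y1: "real Y \<ge> 1" using wY w by simp
    have "((\<lambda>m. real m powr (-1) * euler_prod P' 1 (min (real Y) (real Y))) has_sum 1)
        (chain_upto P' (\<lambda>_. real Y) Y)"
      by (rule has_sum_chain_upto) auto
    then have hs: "((\<lambda>m. real m powr (-1) * euler_prod P' 1 (real Y)) has_sum 1) (chain_upto P' (\<lambda>_. real Y) Y)"
      by simp
    have sub: "rough_upto w Z \<subseteq> chain_upto P' (\<lambda>_. real Y) Y"
    proof
      fix r assume r: "r \<in> rough_upto w Z"
      have "p \<le> Y" if "p \<in> prime_factors r" for p
      proof -
        have "p \<le> r" using that r by (auto simp: rough_upto_def dest!: in_prime_factors_imp_dvd dvd_imp_le)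
        moreover have "r \<le> Y" unfolding Y_def using r by (auto simp: rough_upto_def le_nat_floor)
        ultimately show ?thesis by simp
      qed
      then show "r \<in> chain_upto P' (\<lambda>_. real Y) Y"
        using r by (auto simp: chain_upto_def chain_set_def rough_upto_def P'_def)
    qed
    have pos: "euler_prod P' 1 (real Y) > 0" by (rule euler_prod_pos) simp
    have "(\<Sum>r\<in>rough_upto w Z. 1 / real r) * euler_prod P' 1 (real Y) =
        (\<Sum>r\<in>rough_upto w Z. real r powr (-1) * euler_prod P' 1 (real Y))"
      unfolding sum_distrib_right by (intro sum.cong refl) (auto simp: rough_upto_def powr_minus_divide)
    also have "\<dots> \<le> 1"
      by (rule finite_sum_le_has_sum[OF hs finite_rough_upto sub]) (use pos in auto)
    finally have 1: "(\<Sum>r\<in>rough_upto w Z. 1 / real r) * euler_prod P' 1 (real Y) \<le> 1" .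
    have split: "primes_le (real Y) = {p. p \<in> P' \<and> prime p \<and> real p \<le> real Y} \<union> primes_le (real (w - 1))"
      using wY w by (auto simp: P'_def)
    have 2: "euler_prod P 1 (real Y) = euler_prod P' 1 (real Y) * euler_prod P 1 (real (w - 1))"
      unfolding euler_prod_def split using w by (intro prod.union_disjoint) (auto simp: P'_def)
    have "ln (real w) \<le> ln (2 * real (w - 1))" using w by (intro ln_mono) (auto simp: of_nat_diff)
    also have "\<dots> = ln 2 + ln (real (w - 1))" by (rule ln_mult_pos) (use w in auto)
    finally have lw: "ln (real w) \<le> 1 + ln (real (w - 1))" using ln_2_less_1 by linarith
    have lw0: "ln (real w) > 0" using w by simp
    have lZ: "1 + ln (real Y) \<le> 1 + ln Z" "1 + ln (real Y) > 0" using YZ Y1 by (auto intro: add_pos_nonneg)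
    have lZ0: "1 + ln Z > 0" using lZ by linarith
    let ?S = "\<Sum>r\<in>rough_upto w Z. 1 / real r"
    have S0: "?S \<ge> 0" by (intro sum_nonneg) auto
    have "?S * (c / (1 + ln Z)) \<le> ?S * euler_prod P 1 (real Y)"
    proof (intro mult_left_mono S0)
      have "c / (1 + ln Z) \<le> c / (1 + ln (real Y))" using lZ lZ0 c by (intro divide_left_mono mult_pos_pos) auto
      also have "\<dots> \<le> euler_prod P 1 (real Y)" by (rule c(3)[OF Y1])
      finally show "c / (1 + ln Z) \<le> euler_prod P 1 (real Y)" .
    qed
    also have "\<dots> = (?S * euler_prod P' 1 (real Y)) * euler_prod P 1 (real (w - 1))" unfolding 2 by simp
    also have "\<dots> \<le> 1 * (C / ln (real w))"
    proof (rule mult_mono[OF 1])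
      have "euler_prod P 1 (real (w - 1)) \<le> C / (1 + ln (real (w - 1)))" using w by (intro c(4)) auto
      also have "\<dots> \<le> C / ln (real w)" using lw lw0 c by (intro divide_left_mono mult_pos_pos) auto
      finally show "euler_prod P 1 (real (w - 1)) \<le> C / ln (real w)" .
    qed (use euler_prod_pos[of 1 P "real (w - 1)"] in auto)
    finally have "?S \<le> C / ln (real w) / (c / (1 + ln Z))"
      by (subst pos_le_divide_eq) (use c lZ0 in auto)
    then show ?thesis by (simp add: mult_ac)
  qed
  moreover have "C / c > 0" using c by simp
  ultimately show ?thesis by blast
qed

text \<open>Write \<open>ln r\<close> as a von Mangoldt sum over \<open>d dvd r\<close> and put
  \<open>r = d r'\<close>: the cofactor \<open>r'\<close> is again rough and
  \<open>d \<le> Z / r'\<close>, so Chebyshev's bound applies to the sum over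
  \<open>d\<close>.\<close>

lemma sum_ln_rough_le:
  "(\<Sum>r\<in>rough_upto w Z. ln (real r)) \<le> 4 * Z * (\<Sum>r\<in>rough_upto w Z. 1 / real r)"
proof -
  let ?R = "rough_upto w Z"
  have Rpos: "r > 0" if "r \<in> ?R" for r using that by (auto simp: rough_upto_def)
  have "(\<Sum>r\<in>?R. ln (real r)) = (\<Sum>r\<in>?R. \<Sum>d | d dvd r. mangoldt d)"
    using Rpos mangoldt_sum[where ?'a = real] by (intro sum.cong refl) auto
  also have "\<dots> = (\<Sum>(r, d)\<in>Sigma ?R (\<lambda>r. {d. d dvd r}). mangoldt d)"
    using Rpos by (intro sum.Sigma) auto
  also have "\<dots> = (\<Sum>(r', d)\<in>(\<lambda>(r, d). (r div d, d)) ` Sigma ?R (\<lambda>r. {d. d dvd r}). mangoldt d)"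
  proof -
    have inj: "inj_on (\<lambda>(r, d). (r div d, d)) (Sigma ?R (\<lambda>r. {d. d dvd r}))"
      by (auto simp: inj_on_def) (metis dvd_div_mult_self)
    show ?thesis by (subst sum.reindex[OF inj]) (auto simp: case_prod_unfold o_def)
  qed
  also have "\<dots> \<le> (\<Sum>(r', d)\<in>Sigma ?R (\<lambda>r'. {1..nat \<lfloor>Z / real r'\<rfloor>}). mangoldt d)"
  proof (intro sum_mono2)
    show "(\<lambda>(r, d). (r div d, d)) ` Sigma ?R (\<lambda>r. {d. d dvd r}) \<subseteq> Sigma ?R (\<lambda>r'. {1..nat \<lfloor>Z / real r'\<rfloor>})"
    proof safe
      fix r d assume r: "r \<in> ?R" and d: "d dvd r"
      then obtain k where k: "r = d * k" by (auto elim: dvdE)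
      have dk: "d > 0" "k > 0" using Rpos[OF r] k by auto
      have rd: "r div d = k" using k dk by simp
      have Z: "real d * real k \<le> Z" using r k by (auto simp: rough_upto_def)
      have "real k \<le> real d * real k" using dk by (simp add: mult_le_cancel_right2)
      then have "real k \<le> Z" using Z by linarith
      then show "r div d \<in> ?R"
        using r dk unfolding rd k by (auto simp: rough_upto_def in_prime_factors_iff)
      have "real d \<le> Z / real k" using Z dk by (simp add: pos_le_divide_eq)
      then show "d \<in> {1..nat \<lfloor>Z / real (r div d)\<rfloor>}" using dk unfolding rd
        by (auto simp: le_nat_floor)
    qed
  qed (auto simp: mangoldt_nonneg)
  also have "\<dots> = (\<Sum>r'\<in>?R. chebyshev_psi (nat \<lfloor>Z / real r'\<rfloor>))"
    unfolding chebyshev_psi_def by (rule sum.Sigma[symmetric]) auto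
  also have "\<dots> \<le> (\<Sum>r'\<in>?R. 4 * (Z / real r'))"
  proof (intro sum_mono)
    fix r assume r: "r \<in> ?R"
    then have "Z / real r \<ge> 0" by (auto simp: rough_upto_def intro: divide_nonneg_nonneg order.trans)
    then have "real (nat \<lfloor>Z / real r\<rfloor>) \<le> Z / real r" by simp
    then show "chebyshev_psi (nat \<lfloor>Z / real r\<rfloor>) \<le> 4 * (Z / real r)"
      using chebyshev_psi_le[of "nat \<lfloor>Z / real r\<rfloor>"] by linarith
  qed
  also have "\<dots> = 4 * Z * (\<Sum>r\<in>?R. 1 / real r)" by (simp add: sum_distrib_left)
  finally show ?thesis .
qed

end

section \<open>The pointwise upper bound\<close>

context chain_density
begin

text \<open>Weighting by \<open>ln r\<close>, which is of order \<open>ln X\<close>, takes the place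
  of a sieve for the rough cofactor \<open>r\<close>. The weighted count for fixed \<open>m\<close>
  is \<open>O(X / m)\<close> times \<open>ln X / ln (w m)\<close>, exactly the weight summed in
  \<open>sum_window_gpf\<close>.\<close>

theorem chain_count_upper:
  "\<exists>C>0. \<exists>X\<^sub>0\<ge>2. \<forall>X\<ge>X\<^sub>0. real (card {n \<in> B. real n \<le> X}) \<le> C * (X / ln X)"
proof -
  obtain C where C: "C > 0" "\<And>w Z. w \<ge> 2 \<Longrightarrow> Z \<ge> real w \<Longrightarrow>
      (\<Sum>r\<in>rough_upto w Z. 1 / real r) \<le> C * (1 + ln Z) / ln (real w)"
    using sum_inverse_rough_le by blast
  obtain Q where Q: "Q > 0" "\<And>v. v \<ge> 1 \<Longrightarrow> (\<Sum>m | m \<in> B \<and> v \<le> ln (real m) \<and> ln (real m) \<le> 4 * v.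
      1 / real m * (v / ln (real (Max (prime_factors m))))) \<le> Q"
    using sum_window_gpf by blast
  have lK: "ln K \<ge> 0" using K_ge by simp
  \<comment> \<open>Chosen so that \<open>3 v / 4 - ln K - 1 \<ge> v / 2\<close>, the final step in
    the estimate of \<open>ln r\<close>.\<close>
  define v\<^sub>0 where "v\<^sub>0 = 4 * (ln K + 1)"
  have v0: "v\<^sub>0 \<ge> 4" unfolding v\<^sub>0_def using lK by simp
  define E where "E = 4 + 160 * C * Q"
  have "real (card {n \<in> B. real n \<le> X}) \<le> E * (X / ln X)" if X: "X \<ge> exp (4 * v\<^sub>0)" for X
  proof -
    have X0: "X > 0" using X exp_gt_zero[of "4 * v\<^sub>0"] by linarith
    define v where "v = ln X / 4"
    have vv0: "v \<ge> v\<^sub>0" unfolding v_def using X X0 by (simp add: ln_ge_iff mult.commute)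
    have v: "v \<ge> 4" using vv0 v0 by simp
    have Xv: "X = exp (4 * v)" unfolding v_def using X0 by simp
    define M where "M = {m. m \<in> B \<and> v \<le> ln (real m) \<and> ln (real m) \<le> 4 * v}"
    have finM: "finite M" unfolding M_def by (rule finite_subset[OF _ finite_B_ln_le[of "4 * v"]]) auto
    define w :: "nat \<Rightarrow> nat" where "w = (\<lambda>m. Max (prime_factors m))"
    define T where "T = Sigma M (\<lambda>m. rough_upto (w m) (X / real m))"
    have finT: "finite T" unfolding T_def using finM by auto
    \<comment> \<open>\<open>exp (3 v)\<close> is \<open>X\<close> to the power 3/4, so this part is
      absorbed trivially.\<close>
    define N1 where "N1 = {n \<in> B. real n \<le> exp (3 * v)}"
    define N2 where "N2 = {n \<in> B. exp (3 * v) < real n \<and> real n \<le> X}"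
    have M1: "m > 1" if "m \<in> M" for m
    proof (rule ccontr)
      assume "\<not> m > 1"
      then have "m = 1" using that B_pos[of m] unfolding M_def by auto
      then show False using that v unfolding M_def by auto
    qed
    have wm: "w m \<in> prime_factors m" "w m \<ge> 2" "w m \<le> m" if "m \<in> M" for m
    proof -
      have "prime_factors m \<noteq> {}" using M1[OF that] by (auto simp: prime_factorization_empty_iff)
      then show 1: "w m \<in> prime_factors m" unfolding w_def by (intro Max_in) auto
      then show "w m \<ge> 2" by (intro prime_ge_2_nat) auto
      show "w m \<le> m" using 1 M1[OF that] by (auto dest!: in_prime_factors_imp_dvd dvd_imp_le)
    qed
    have N2: "N2 \<subseteq> (\<lambda>(m, r). m * r) ` {(m, r) \<in> T. v / 2 \<le> ln (real r)}"
    proof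
      fix n assume "n \<in> N2"
      then have n: "n \<in> B" "exp (3 * v) < real n" "real n \<le> X" unfolding N2_def by auto
      have n0: "n > 0" by (rule B_pos[OF n(1)])
      have ex: "exp v \<le> exp (3 * v)" using v by simp
      \<comment> \<open>Cutting at \<open>exp v\<close>, the fourth root of \<open>X\<close>, keeps
        \<open>ln (m p)\<close> below about \<open>2 v\<close>, whereas \<open>ln n > 3 v\<close>;
        the difference is left for \<open>r\<close>.\<close>
      obtain m p where mp: "m * p \<in> B" "m * p dvd n" "m > 0" "prime p" "real m \<le> exp v"
        "exp v < real (m * p)" "real p \<le> \<theta> m" "\<forall>q\<in>prime_factors (n div (m * p)). p \<le> q"
        "\<forall>q\<in>prime_factors (m * p). q \<le> p"
        using chain_set_segment[OF n(1) \<theta>_mono, of "exp v"] v n(2) ex by (auto simp: less_le_trans)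
      define k where "k = m * p"
      define r where "r = n div k"
      have nk: "n = k * r" unfolding r_def k_def using mp(2) by simp
      have k0: "k > 0" "r > 0" using nk n0 by auto
      have "real k \<le> real n" using nk k0 by simp
      have lk1: "v \<le> ln (real k)" using mp(6) k0 unfolding k_def[symmetric] by (simp add: ln_ge_iff)
      have lk2: "ln (real k) \<le> 4 * v"
      proof -
        have "real k \<le> exp (4 * v)" using \<open>real k \<le> real n\<close> n(3) Xv by simp
        then show ?thesis using k0 by (metis ln_exp ln_mono of_nat_0_less_iff)
      qed
      have kM: "k \<in> M" unfolding M_def using mp(1) lk1 lk2 k_def by simp
      have pk: "p \<in> prime_factors k" using mp k0 by (auto simp: in_prime_factors_iff k_def)
      have wp: "w k = p" unfolding w_def using pk mp(9) unfolding k_def[symmetric] by (intro Max_eqI) auto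
      have "real r \<le> X / real k" using n(3) nk k0 by (simp add: field_simps)
      moreover have "q \<in> P \<and> w k \<le> q" if "q \<in> prime_factors r" for q
      proof
        show "w k \<le> q" unfolding wp using that mp(8) unfolding r_def k_def by blast
        have "q \<in> prime_factors n" using that nk n0 by (auto simp: in_prime_factors_iff)
        then show "q \<in> P" using n(1) by (auto simp: chain_set_def)
      qed
      ultimately have "r \<in> rough_upto (w k) (X / real k)" using k0 by (auto simp: rough_upto_def)
      moreover have "v / 2 \<le> ln (real r)"
      proof -
        have lm: "ln (real m) \<le> v" using mp(3,5) by (metis ln_exp ln_mono of_nat_0_less_iff)
        have lm0: "ln (real m) \<ge> 0" using mp(3) by simp
        have p0: "real p > 0" using mp(4) prime_gt_0_nat by simp
        have "ln (real p) \<le> ln (\<theta> m)" using mp(7) p0 by (intro ln_mono) auto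
        also have "\<dots> \<le> ln (K * real m * (1 + ln (real m)))"
          using \<theta>_le[OF mp(3)] mp(7) p0 by (intro ln_mono) auto
        also have "\<dots> = ln K + ln (real m) + ln (1 + ln (real m))"
          using K_ge mp(3) add_pos_nonneg[OF zero_less_one lm0] by (simp add: ln_mult)
        also have "\<dots> \<le> ln K + v + ln (1 + v)" using lm lm0 v K_ge by (intro add_mono ln_mono) auto
        finally have "ln (real p) \<le> ln K + v + ln (1 + v)" .
        then have "ln (real k) \<le> ln K + 2 * v + ln (1 + v)"
          unfolding k_def using lm mp(3) p0 by (simp add: ln_mult)
        moreover have "ln (1 + v) \<le> v / 4 + 1" using v by (intro ln_one_plus_le_quarter) auto
        moreover have "ln (exp (3 * v)) \<le> ln (real n)" using n(2) n0 by (intro ln_mono) auto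
        moreover have "ln (real n) = ln (real k) + ln (real r)" unfolding nk using k0 by (simp add: ln_mult)
        ultimately show ?thesis using vv0 unfolding v\<^sub>0_def by simp
      qed
      ultimately have "(k, r) \<in> {(m, r) \<in> T. v / 2 \<le> ln (real r)}" unfolding T_def using kM by auto
      then show "n \<in> (\<lambda>(m, r). m * r) ` {(m, r) \<in> T. v / 2 \<le> ln (real r)}"
        using nk by (intro image_eqI[of _ _ "(k, r)"]) auto
    qed
    have rpos: "r > 0" if "(m, r) \<in> T" for m r using that unfolding T_def by (auto simp: rough_upto_def)
    have "card N2 \<le> card ((\<lambda>(m, r). m * r) ` {(m, r) \<in> T. v / 2 \<le> ln (real r)})"
      by (intro card_mono N2 finite_imageI finite_subset[OF _ finT]) auto
    also have "\<dots> \<le> card {(m, r) \<in> T. v / 2 \<le> ln (real r)}"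
      by (intro card_image_le finite_subset[OF _ finT]) auto
    finally have "real (card N2) * (v / 2) \<le> (\<Sum>x\<in>{(m, r) \<in> T. v / 2 \<le> ln (real r)}. v / 2)"
      using v by simp
    also have "\<dots> \<le> (\<Sum>x\<in>{(m, r) \<in> T. v / 2 \<le> ln (real r)}. ln (real (snd x)))"
      by (intro sum_mono) auto
    also have "\<dots> \<le> (\<Sum>x\<in>T. ln (real (snd x)))"
      using rpos by (intro sum_mono2 finT) (auto simp: Suc_le_eq)
    also have "\<dots> = (\<Sum>m\<in>M. \<Sum>r\<in>rough_upto (w m) (X / real m). ln (real r))"
      unfolding T_def by (subst sum.Sigma) (auto simp: finM case_prod_unfold)
    also have "\<dots> \<le> (\<Sum>m\<in>M. (20 * C * X) * (1 / real m * (v / ln (real (w m)))))"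
    proof (intro sum_mono)
      fix m assume m: "m \<in> M"
      have mX: "real m \<le> X"
      proof -
        have "ln (real m) \<le> ln X" using m Xv unfolding M_def by simp
        then show ?thesis using M1[OF m] X0 by simp
      qed
      have wX: "real (w m) \<le> X" using wm(3)[OF m] mX by linarith
      have lw: "ln (real (w m)) > 0" using wm(2)[OF m] by simp
      have m1: "real m \<ge> 1" using M1[OF m] by simp
      have "(\<Sum>r\<in>rough_upto (w m) (X / real m). ln (real r)) \<le>
          4 * (X / real m) * (\<Sum>r\<in>rough_upto (w m) (X / real m). 1 / real r)" by (rule sum_ln_rough_le)
      also have "\<dots> \<le> 4 * (X / real m) * (\<Sum>r\<in>rough_upto (w m) X. 1 / real r)"
      proof (intro mult_left_mono sum_mono2)
        have "X / real m \<le> X / 1" using X0 m1 by (intro divide_left_mono) auto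
        then show "rough_upto (w m) (X / real m) \<subseteq> rough_upto (w m) X" by (auto simp: rough_upto_def)
      qed (use X0 in auto)
      also have "\<dots> \<le> 4 * (X / real m) * (C * (1 + ln X) / ln (real (w m)))"
        using X0 by (intro mult_left_mono C wm(2)[OF m] wX) auto
      also have "\<dots> \<le> 4 * (X / real m) * (C * (5 * v) / ln (real (w m)))"
      proof (intro mult_left_mono divide_right_mono)
        show "1 + ln X \<le> 5 * v" using v unfolding v_def by simp
      qed (use X0 lw C in auto)
      finally show "(\<Sum>r\<in>rough_upto (w m) (X / real m). ln (real r)) \<le>
        (20 * C * X) * (1 / real m * (v / ln (real (w m))))" by (simp add: mult_ac)
    qed
    also have "\<dots> = (20 * C * X) * (\<Sum>m\<in>M. 1 / real m * (v / ln (real (w m))))"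
      by (simp add: sum_distrib_left)
    also have "\<dots> \<le> (20 * C * X) * Q"
      using Q(2)[of v] v C X0 unfolding M_def w_def by (intro mult_left_mono) auto
    finally have c2: "real (card N2) \<le> 40 * C * Q * (X / v)" using v by (simp add: field_simps)
    have "N1 \<subseteq> {1..nat \<lfloor>exp (3 * v)\<rfloor>}" unfolding N1_def using B_pos by (auto simp: le_nat_floor Suc_le_eq)
    then have "card N1 \<le> card {1..nat \<lfloor>exp (3 * v)\<rfloor>}" by (intro card_mono) auto
    also have "\<dots> = nat \<lfloor>exp (3 * v)\<rfloor>" by simp
    finally have "real (card N1) \<le> real (nat \<lfloor>exp (3 * v)\<rfloor>)" by (simp only: of_nat_le_iff)
    also have "\<dots> \<le> exp (3 * v)" by simp
    also have "\<dots> \<le> X / v"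
    proof -
      have "v \<le> exp v" using exp_ge_add_one_self[of v] by linarith
      then have "exp (3 * v) * v \<le> exp (3 * v) * exp v" by (intro mult_left_mono) auto
      also have "\<dots> = X" unfolding Xv by (simp add: mult_exp_exp)
      finally show ?thesis using v by (simp add: field_simps)
    qed
    finally have c1: "real (card N1) \<le> X / v" .
    have "{n \<in> B. real n \<le> X} \<subseteq> N1 \<union> N2" unfolding N1_def N2_def by auto
    moreover have "finite (N1 \<union> N2)"
      using B_pos by (intro finite_subset[of "N1 \<union> N2" "{..nat \<lfloor>X\<rfloor>} \<union> {..nat \<lfloor>exp (3 * v)\<rfloor>}"])
        (auto simp: N1_def N2_def le_nat_floor)
    ultimately have "card {n \<in> B. real n \<le> X} \<le> card (N1 \<union> N2)" by (intro card_mono)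
    also have "\<dots> \<le> card N1 + card N2" by (rule card_Un_le)
    finally have "real (card {n \<in> B. real n \<le> X}) \<le> X / v + 40 * C * Q * (X / v)"
      using c1 c2 by linarith
    also have "\<dots> = E * (X / ln X)" unfolding E_def v_def by (simp add: algebra_simps add_divide_distrib)
    finally show ?thesis .
  qed
  moreover have "E > 0" unfolding E_def using C Q by (simp add: add_pos_pos)
  moreover have "exp (4 * v\<^sub>0) \<ge> 2" using exp_ge_add_one_self[of "4 * v\<^sub>0"] v0 by linarith
  ultimately show ?thesis by blast
qed

end

section \<open>Lower bound for the counting function\<close>

text \<open>Adding one prime factor at most doubles the number of admissible divisors, and does so
  only if the prime satisfies \<open>Q\<close>, in which case \<open>ln n\<close> grows by at least
  \<open>a\<close>.\<close>

lemma card_rough_divisors: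
  fixes Q :: "nat \<Rightarrow> bool"
  assumes "n > 0" "a \<ge> 0" and Q: "\<And>p. prime p \<Longrightarrow> Q p \<Longrightarrow> a \<le> ln (real p)"
  shows "\<exists>k. card {d. d dvd n \<and> (\<forall>p\<in>prime_factors d. Q p)} \<le> 2 ^ k \<and> real k * a \<le> ln (real n)"
  using \<open>n > 0\<close>
proof (induction n rule: prime_divisors_induct)
  case zero
  then show ?case by simp
next
  case (unit n)
  then have "{d. d dvd n \<and> (\<forall>p\<in>prime_factors d. Q p)} = {1}" by auto
  then show ?case using unit by (intro exI[of _ 0]) auto
next
  case (factor p n)
  then have n0: "n > 0" and p: "prime p" by auto
  let ?D = "\<lambda>n. {d. d dvd n \<and> (\<forall>p\<in>prime_factors d. Q p)}"
  obtain k where k: "card (?D n) \<le> 2 ^ k" "real k * a \<le> ln (real n)" using factor.IH n0 by blast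
  have fin: "finite (?D n)" by (rule finite_subset[OF _ finite_divisors_nat[OF n0]]) auto
  have lnp: "ln (real (p * n)) = ln (real p) + ln (real n)"
    using n0 prime_gt_0_nat[OF p] by (simp add: ln_mult)
  have lp0: "ln (real p) \<ge> 0" using prime_ge_1_nat[OF p] by simp
  show ?case
  proof (cases "Q p")
    case True
    have "?D (p * n) \<subseteq> ?D n \<union> (\<lambda>d. p * d) ` ?D n"
    proof
      fix d assume d: "d \<in> ?D (p * n)"
      show "d \<in> ?D n \<union> (\<lambda>d. p * d) ` ?D n"
      proof (cases "p dvd d")
        case True
        then obtain e where e: "d = p * e" by (auto elim: dvdE)
        have "e dvd n" using d e prime_gt_0_nat[OF p] by auto
        moreover have "\<forall>q\<in>prime_factors e. Q q"
          using d e n0 \<open>e dvd n\<close> prime_gt_0_nat[OF p] by (auto simp: in_prime_factors_iff)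
        ultimately show ?thesis using e by blast
      next
        case False
        then have "coprime p d" using p by (simp add: prime_imp_coprime)
        then have "d dvd n" using d by (simp add: coprime_commute coprime_dvd_mult_right_iff)
        then show ?thesis using d by blast
      qed
    qed
    then have "card (?D (p * n)) \<le> card (?D n \<union> (\<lambda>d. p * d) ` ?D n)" using fin by (intro card_mono) auto
    also have "\<dots> \<le> card (?D n) + card ((\<lambda>d. p * d) ` ?D n)" by (rule card_Un_le)
    also have "\<dots> \<le> 2 ^ k + 2 ^ k" using k(1) card_image_le[OF fin, of "\<lambda>d. p * d"] by linarith
    finally have "card (?D (p * n)) \<le> 2 ^ Suc k" by simp
    moreover have "real (Suc k) * a \<le> ln (real (p * n))"
      unfolding lnp using k(2) Q[OF p True] by (simp add: algebra_simps)
    ultimately show ?thesis by blast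
  next
    case False
    have "?D (p * n) \<subseteq> ?D n"
    proof
      fix d assume d: "d \<in> ?D (p * n)"
      then have "d > 0" using n0 prime_gt_0_nat[OF p] by (auto intro: Nat.gr0I)
      then have "\<not> p dvd d" using d False p by (auto simp: in_prime_factors_iff)
      then have "coprime p d" using p by (simp add: prime_imp_coprime)
      then have "d dvd n" using d by (simp add: coprime_commute coprime_dvd_mult_right_iff)
      then show "d \<in> ?D n" using d by blast
    qed
    then have "card (?D (p * n)) \<le> card (?D n)" using fin by (intro card_mono)
    then show ?thesis using k lnp lp0 by (intro exI[of _ k]) auto
  qed
qed

text \<open>Multiplication of pairs is at most \<open>M\<close> to one: a pair is determined by its
  product and by \<open>b\<close>, an admissible divisor of it.\<close>

lemma card_pairs_le_mult:
  fixes S :: "(nat \<times> nat) set" and N :: "nat set"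
  assumes "finite N" "\<And>a b. (a, b) \<in> S \<Longrightarrow> a * b \<in> N \<and> b > 0 \<and> (\<forall>p\<in>prime_factors b. Q p)"
    and "\<And>n. n \<in> N \<Longrightarrow> n > 0 \<and> card {d. d dvd n \<and> (\<forall>p\<in>prime_factors d. Q p)} \<le> M"
  shows "card S \<le> M * card N"
proof -
  let ?D = "\<lambda>n. {d. d dvd n \<and> (\<forall>p\<in>prime_factors d. Q p)}"
  have fin: "finite (?D n)" if "n \<in> N" for n
    by (rule finite_subset[OF _ finite_divisors_nat[of n]]) (use assms(3)[OF that] in auto)
  have "S \<subseteq> (\<lambda>(n, d). (n div d, d)) ` Sigma N ?D"
  proof
    fix x assume "x \<in> S"
    then obtain a b where x: "x = (a, b)" "(a, b) \<in> S" by (cases x) auto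
    with assms(2)[of a b] show "x \<in> (\<lambda>(n, d). (n div d, d)) ` Sigma N ?D"
      by (intro image_eqI[of _ _ "(a * b, b)"]) auto
  qed
  then have "card S \<le> card ((\<lambda>(n, d). (n div d, d)) ` Sigma N ?D)"
    using assms(1) fin by (intro card_mono) auto
  also have "\<dots> \<le> card (Sigma N ?D)" using assms(1) fin by (intro card_image_le) auto
  also have "\<dots> = (\<Sum>n\<in>N. card (?D n))" using assms(1) fin by (intro card_SigmaI) auto
  also have "\<dots> \<le> (\<Sum>n\<in>N. M)" using assms(3) by (intro sum_mono) auto
  finally show ?thesis by (simp add: mult.commute)
qed

text \<open>Consider a prime \<open>p\<close> new to \<open>m\<close>. If \<open>m\<close> has
  larger primes, the least such \<open>q\<close> already passed the test against a segment that
  divides the one now facing \<open>p\<close>, and \<open>p < q\<close>; otherwise all of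
  \<open>m\<close> lies in that segment, and \<open>p \<le> m \<le> \<theta> m\<close>.\<close>

lemma chain_set_mult:
  assumes m: "m \<in> chain_set P \<theta>" and mono: "\<And>m k. m > 0 \<Longrightarrow> k > 0 \<Longrightarrow> \<theta> m \<le> \<theta> (m * k)"
    and ge: "real m \<le> \<theta> m" and r: "r > 0" "\<And>p. p \<in> prime_factors r \<Longrightarrow> p \<in> P \<and> p \<le> m"
  shows "m * r \<in> chain_set P \<theta>"
proof -
  have m0: "m > 0" using m by (simp add: chain_set_def)
  have dvd_mono: "\<theta> a \<le> \<theta> b" if "a dvd b" "b > 0" for a b
    using that mono by (auto elim!: dvdE)
  have low: "real p \<le> \<theta> (low_part p (m * r))" if p: "p \<in> prime_factors (m * r)" for p
  proof (cases "p \<in> prime_factors m")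
    case True
    then have "real p \<le> \<theta> (low_part p m)" using m by (auto simp: chain_set_def)
    also have "\<dots> \<le> \<theta> (low_part p (m * r))" using m0 r by (intro dvd_mono low_part_dvd_mono) auto
    finally show ?thesis .
  next
    case False
    have pp: "prime p" "p \<in> prime_factors r"
      using p False m0 r prime_factors_product[of m r] by auto
    show ?thesis
    proof (cases "\<exists>q\<in>prime_factors m. q > p")
      case True
      define q where "q = Min {q \<in> prime_factors m. q > p}"
      have "q \<in> {q \<in> prime_factors m. q > p}" unfolding q_def using True by (intro Min_in) auto
      then have q: "q \<in> prime_factors m" "q > p" by auto
      have qmin: "q \<le> s" if "s \<in> prime_factors m" "s > p" for s unfolding q_def using that by (intro Min_le) auto
      have "low_part q m dvd low_part p (m * r)"
      proof (rule multiplicity_le_imp_dvd)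
        fix s :: nat assume s: "prime s"
        show "multiplicity s (low_part q m) \<le> multiplicity s (low_part p (m * r))"
        proof (cases "s < q \<and> s \<in> prime_factors m")
          case True
          have "s \<noteq> p" using True False by auto
          moreover have "\<not> s > p" using qmin[of s] True by auto
          ultimately have "s < p" by simp
          then show ?thesis using s m0 r by (auto simp: multiplicity_low_part intro!: dvd_imp_multiplicity_le)
        next
          case F: False
          then show ?thesis using s by (auto simp: multiplicity_low_part prime_factors_multiplicity)
        qed
      qed auto
      then have "\<theta> (low_part q m) \<le> \<theta> (low_part p (m * r))" by (intro dvd_mono) auto
      moreover have "real q \<le> \<theta> (low_part q m)" using m q by (auto simp: chain_set_def)
      ultimately show ?thesis using q by linarith
    next
      case F: False
      then have "s < p" if "s \<in> prime_factors m" for s using that False by (metis not_less_iff_gr_or_eq)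
      then have "m dvd low_part p (m * r)" using m0 r by (intro low_part_dvdI) auto
      then have "\<theta> m \<le> \<theta> (low_part p (m * r))" by (intro dvd_mono) auto
      moreover have "real p \<le> real m" using r(2)[OF pp(2)] by simp
      ultimately show ?thesis using ge by linarith
    qed
  qed
  have "p \<in> P" if "p \<in> prime_factors (m * r)" for p
    using that m r m0 prime_factors_product[of m r] by (auto simp: chain_set_def)
  with low m0 r show ?thesis by (auto simp: chain_set_def)
qed

section \<open>Integers with all primes in a band\<close>

context prime_density
begin

text \<open>The cofactors for the lower bound: primes up to \<open>exp t\<close> preserve the chain
  condition of larger \<open>m\<close>, and primes above \<open>exp (t / 4)\<close> keep the number
  of factorizations bounded.\<close>

definition band :: "real \<Rightarrow> real \<Rightarrow> nat set" where
  "band t z = {r. r > 0 \<and> real r \<le> exp z \<and> (\<forall>p\<in>prime_factors r. p \<in> P \<and> exp (t / 4) < real p \<and> real p \<le> exp t)}"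

lemma finite_band [simp, intro]: "finite (band t z)"
  by (rule finite_subset[of _ "{..nat \<lfloor>exp z\<rfloor>}"]) (auto simp: band_def le_nat_floor)

lemma sum_ln_over_interval:
  assumes "1 \<le> x" "x \<le> y"
  shows "ln y - ln x - 2 * C\<^sub>1 \<le> (\<Sum>p | p \<in> P \<and> prime p \<and> x < real p \<and> real p \<le> y. ln (real p) / real p)"
proof -
  have "primes_le y = primes_le x \<union> {p. p \<in> P \<and> prime p \<and> x < real p \<and> real p \<le> y}"
    using assms by auto
  then have "(\<Sum>p\<in>primes_le y. ln (real p) / real p) = (\<Sum>p\<in>primes_le x. ln (real p) / real p) +
      (\<Sum>p | p \<in> P \<and> prime p \<and> x < real p \<and> real p \<le> y. ln (real p) / real p)"
    by (simp only:) (intro sum.union_disjoint finite_subset[OF _ finite_euler_set[of P y]]; auto)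
  then show ?thesis using sum_ln_over_ge[of y] sum_ln_over_le[of x] assms by linarith
qed

text \<open>\<open>A\<close> is chosen so that Mertens' estimate leaves at least 1 on
  \<open>(Z / A, Z]\<close>, where each prime contributes at most \<open>A ln Z / Z\<close>.\<close>

lemma card_primes_interval:
  assumes A: "A = exp (2 * C\<^sub>1 + 1)" and Z: "Z \<ge> A"
  shows "Z / (A * ln Z) \<le> real (card {p. p \<in> P \<and> prime p \<and> Z / A < real p \<and> real p \<le> Z})"
proof -
  let ?I = "{p. p \<in> P \<and> prime p \<and> Z / A < real p \<and> real p \<le> Z}"
  have A1: "A \<ge> 1" "A > 1" unfolding A using C1_nonneg by auto
  have Z1: "Z > 1" "Z / A \<ge> 1" using Z A1 by auto
  have lZ: "ln Z > 0" using Z1 by simp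
  have "ln (Z / A) = ln Z - (2 * C\<^sub>1 + 1)" using Z1 A1 by (simp add: ln_div A)
  then have "1 = ln Z - ln (Z / A) - 2 * C\<^sub>1" by simp
  also have "\<dots> \<le> (\<Sum>p\<in>?I. ln (real p) / real p)"
    using Z1 A1 by (intro sum_ln_over_interval) (auto simp: field_simps)
  also have "\<dots> \<le> (\<Sum>p\<in>?I. ln Z / (Z / A))"
  proof (intro sum_mono frac_le)
    fix p assume "p \<in> ?I"
    then have p: "Z / A < real p" "real p \<le> Z" by auto
    then show "ln (real p) \<le> ln Z" using Z1 by (intro ln_mono) auto
    show "Z / A \<le> real p" "0 \<le> ln Z" "0 < Z / A" using p Z1 by auto
  qed
  also have "\<dots> = real (card ?I) * (A * ln Z / Z)" by (simp add: mult.commute)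
  finally show ?thesis using A1 Z1 lZ by (simp add: field_simps)
qed

text \<open>Primes suffice for \<open>z \<le> t\<close>; multiplying by one prime from
  \<open>(exp (t / 4), exp (t / 2)]\<close> extends the range of \<open>z\<close> by
  \<open>t / 4\<close>, and the multiplicity of the products depends only on
  \<open>k\<close>.\<close>

lemma card_band_ge:
  "\<exists>c>0. \<exists>t\<^sub>0>0. \<forall>t\<ge>t\<^sub>0. \<forall>z. t / 2 \<le> z \<longrightarrow> z \<le> t + real k * t / 4 \<longrightarrow> c * (exp z / t) \<le> real (card (band t z))"
proof (induction k)
  case 0
  define A where "A = exp (2 * C\<^sub>1 + 1)"
  have A1: "A > 1" unfolding A_def using C1_nonneg by simp
  define t\<^sub>0 where "t\<^sub>0 = 4 * (2 * C\<^sub>1 + 1)"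
  have t0: "t\<^sub>0 > 0" unfolding t\<^sub>0_def using C1_nonneg by simp
  have "(1 / A) * (exp z / t) \<le> real (card (band t z))" if t: "t \<ge> t\<^sub>0" and z: "t / 2 \<le> z" "z \<le> t" for t z
  proof -
    let ?I = "{p. p \<in> P \<and> prime p \<and> exp z / A < real p \<and> real p \<le> exp z}"
    have zA: "exp z / A = exp (z - (2 * C\<^sub>1 + 1))" unfolding A_def by (simp add: exp_diff)
    have "t / 4 \<ge> 2 * C\<^sub>1 + 1" using t unfolding t\<^sub>0_def by simp
    then have le: "t / 4 \<le> z - (2 * C\<^sub>1 + 1)" using z by linarith
    have z0: "z > 0" using z t t0 by linarith
    have "2 * C\<^sub>1 + 1 \<le> z" using le t t0 by linarith
    then have "A \<le> exp z" unfolding A_def by simp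
    then have "exp z / (A * ln (exp z)) \<le> real (card ?I)" by (intro card_primes_interval A_def)
    also have "\<dots> \<le> real (card (band t z))"
    proof (intro of_nat_mono card_mono finite_band subsetI)
      fix p assume p: "p \<in> ?I"
      have "exp (t / 4) \<le> exp z / A" "exp z \<le> exp t" unfolding zA using le z by simp_all
      moreover have "exp z / A < real p" "real p \<le> exp z" using p by auto
      ultimately have "exp (t / 4) < real p" "real p \<le> exp t" by linarith+
      then show "p \<in> band t z" using p prime_gt_0_nat by (auto simp: band_def prime_prime_factors)
    qed
    finally have "exp z / (A * z) \<le> real (card (band t z))" by simp
    moreover have "exp z / (A * t) \<le> exp z / (A * z)"
      using z z0 A1 by (intro divide_left_mono mult_left_mono mult_pos_pos) auto
    ultimately show ?thesis by simp
  qed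
  moreover have "1 / A > 0" using A1 by simp
  ultimately show ?case using t0 by (intro exI[of _ "1 / A"] conjI exI[of _ t\<^sub>0]) auto
next
  case (Suc k)
  then obtain c t\<^sub>1 where c: "c > 0" "t\<^sub>1 > 0" "\<And>t z. t \<ge> t\<^sub>1 \<Longrightarrow> t / 2 \<le> z \<Longrightarrow> z \<le> t + real k * t / 4 \<Longrightarrow>
      c * (exp z / t) \<le> real (card (band t z))" by blast
  define t\<^sub>0 where "t\<^sub>0 = max t\<^sub>1 (16 * C\<^sub>1)"
  \<comment> \<open>An element has at most \<open>k + 5\<close> prime factors: each has logarithm
    above \<open>t / 4\<close>, and together at most \<open>(k + 5) t / 4\<close>.\<close>
  define M :: nat where "M = 2 ^ (k + 5)"
  define c' where "c' = c / 4 / real M"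
  have M0: "real M \<ge> 1" unfolding M_def by simp
  have c': "c' > 0" "c' \<le> c" unfolding c'_def using c M0 by (auto simp: field_simps)
  have "c' * (exp z / t) \<le> real (card (band t z))"
    if t: "t \<ge> t\<^sub>0" and z: "t / 2 \<le> z" "z \<le> t + real (Suc k) * t / 4" for t z
  proof -
    have t0: "t > 0" "t \<ge> t\<^sub>1" "t \<ge> 16 * C\<^sub>1" using t c(2) unfolding t\<^sub>0_def by auto
    show ?thesis
    proof (cases "z \<le> t + real k * t / 4")
      case True
      have "c' * (exp z / t) \<le> c * (exp z / t)" using c' t0 by (intro mult_right_mono) auto
      also have "\<dots> \<le> real (card (band t z))" using True z t0 by (intro c) auto
      finally show ?thesis .
    next
      case False
      define I where "I = {p. p \<in> P \<and> prime p \<and> exp (t / 4) < real p \<and> real p \<le> exp (t / 2)}"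
      have finI: "finite I" unfolding I_def by (rule finite_subset[OF _ finite_euler_set[of P "exp (t / 2)"]]) auto
      have I: "q > 1" "t / 4 < ln (real q)" "ln (real q) \<le> t / 2" "prime q" "q \<in> P" "exp (t / 4) < real q" "real q \<le> exp t"
        if "q \<in> I" for q
      proof -
        show q: "prime q" "q > 1" "q \<in> P" "exp (t / 4) < real q" using that prime_gt_1_nat unfolding I_def by auto
        have q2: "real q \<le> exp (t / 2)" using that unfolding I_def by auto
        have "ln (exp (t / 4)) < ln (real q)" using q by (intro ln_less_cancel_iff[THEN iffD2]) auto
        then show "t / 4 < ln (real q)" by simp
        have "ln (real q) \<le> ln (exp (t / 2))" using q q2 by (intro ln_mono) auto
        then show "ln (real q) \<le> t / 2" by simp
        have "exp (t / 2) \<le> exp t" using t0 by simp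
        then show "real q \<le> exp t" using q2 by linarith
      qed
      define S where "S = Sigma I (\<lambda>q. band t (z - ln (real q)))"
      have "card S \<le> M * card (band t z)"
      proof (rule card_pairs_le_mult[where Q = "\<lambda>p. exp (t / 4) < real p"])
        fix q r assume "(q, r) \<in> S"
        then have q: "q \<in> I" and r: "r \<in> band t (z - ln (real q))" unfolding S_def by auto
        have "real r \<le> exp z / real q" using r I(1)[OF q] by (simp add: band_def exp_diff)
        then have "real (q * r) \<le> exp z" using I(1)[OF q] by (simp add: field_simps)
        moreover have "q * r > 0" using I(1)[OF q] r by (simp add: band_def)
        moreover have "p \<in> P \<and> exp (t / 4) < real p \<and> real p \<le> exp t" if "p \<in> prime_factors (q * r)" for p
        proof -
          have "p = q \<or> p \<in> prime_factors r"
            using that I(1,4)[OF q] r prime_factors_product[of q r] by (auto simp: band_def prime_prime_factors)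
          then show ?thesis using I[OF q] r by (auto simp: band_def)
        qed
        ultimately show "q * r \<in> band t z \<and> r > 0 \<and> (\<forall>p\<in>prime_factors r. exp (t / 4) < real p)"
          using r by (auto simp: band_def)
      next
        fix n assume n: "n \<in> band t z"
        then have n0: "n > 0" by (auto simp: band_def)
        have "t / 4 \<le> ln (real p)" if "prime p" "exp (t / 4) < real p" for p :: nat
          using that by (metis exp_gt_zero less_imp_le ln_exp ln_mono)
        then obtain j where j: "card {d. d dvd n \<and> (\<forall>p\<in>prime_factors d. exp (t / 4) < real p)} \<le> 2 ^ j"
            "real j * (t / 4) \<le> ln (real n)"
          using card_rough_divisors[of n "t / 4" "\<lambda>p. exp (t / 4) < real p"] n0 t0 by auto
        have "ln (real n) \<le> ln (exp z)" using n n0 by (intro ln_mono) (auto simp: band_def)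
        then have "real j * (t / 4) \<le> t + real (Suc k) * t / 4" using j z by simp
        also have "\<dots> = real (k + 5) * (t / 4)" by (simp add: algebra_simps add_divide_distrib)
        finally have "j \<le> k + 5" using t0 by simp
        then have "(2::nat) ^ j \<le> M" unfolding M_def by (intro power_increasing) auto
        then show "n > 0 \<and> card {d. d dvd n \<and> (\<forall>p\<in>prime_factors d. exp (t / 4) < real p)} \<le> M"
          using j n0 by simp
      qed auto
      then have "real (card S) \<le> real M * real (card (band t z))" by (metis of_nat_le_iff of_nat_mult)
      moreover have "c / 4 * (exp z / t) \<le> real (card S)"
      proof -
        \<comment> \<open>This is where \<open>t \<ge> 16 C\<^sub>1\<close> enters:
          \<open>(2 / t) (t / 4 - 2 C\<^sub>1) \<ge> 1 / 4\<close>.\<close>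
        have "1 / 4 \<le> (2 / t) * (ln (exp (t / 2)) - ln (exp (t / 4)) - 2 * C\<^sub>1)"
          using t0 by (simp add: field_simps)
        also have "\<dots> \<le> (2 / t) * (\<Sum>q\<in>I. ln (real q) / real q)"
          unfolding I_def using t0 by (intro mult_left_mono sum_ln_over_interval) auto
        also have "\<dots> = (\<Sum>q\<in>I. (2 / t) * (ln (real q) / real q))" by (simp add: sum_distrib_left)
        also have "\<dots> \<le> (\<Sum>q\<in>I. 1 / real q)"
        proof (intro sum_mono)
          fix q assume q: "q \<in> I"
          have "(2 / t) * ln (real q) \<le> (2 / t) * (t / 2)" using I(3)[OF q] t0 by (intro mult_left_mono) auto
          then have "(2 / t) * ln (real q) \<le> 1" using t0 by simp
          then have "(2 / t) * ln (real q) / real q \<le> 1 / real q" by (intro divide_right_mono) auto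
          then show "(2 / t) * (ln (real q) / real q) \<le> 1 / real q" by simp
        qed
        finally have "c * (exp z / t) * (1 / 4) \<le> c * (exp z / t) * (\<Sum>q\<in>I. 1 / real q)"
          using c t0 by (intro mult_left_mono) auto
        also have "\<dots> = (\<Sum>q\<in>I. c * (exp z / t) * (1 / real q))" by (simp add: sum_distrib_left)
        also have "\<dots> \<le> (\<Sum>q\<in>I. real (card (band t (z - ln (real q)))))"
        proof (intro sum_mono)
          fix q assume q: "q \<in> I"
          have eq: "c * (exp z / t) * (1 / real q) = c * (exp (z - ln (real q)) / t)"
            using I(1)[OF q] by (simp add: exp_diff)
          \<comment> \<open>Removing \<open>q\<close> lowers the exponent by more than
            \<open>t / 4\<close> and at most \<open>t / 2\<close>, back into the range of the
            induction hypothesis.\<close>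
          have "t / 2 \<le> z - ln (real q)"
          proof -
            have "real k * t / 4 \<ge> 0" using t0 by simp
            then show ?thesis using False I(3)[OF q] by linarith
          qed
          moreover have "z - ln (real q) \<le> t + real k * t / 4"
            using z(2) I(2)[OF q] by (simp add: algebra_simps add_divide_distrib)
          ultimately show "c * (exp z / t) * (1 / real q) \<le> real (card (band t (z - ln (real q))))"
            unfolding eq using t0 by (intro c)
        qed
        also have "\<dots> = real (card S)" unfolding S_def using finI by (subst card_SigmaI) auto
        finally show ?thesis by simp
      qed
      ultimately have "c / 4 * (exp z / t) \<le> real M * real (card (band t z))" by linarith
      then have "(c / 4 * (exp z / t)) / real M \<le> real (card (band t z))"
        using M0 by (subst pos_divide_le_eq) (auto simp: mult.commute)
      then show ?thesis unfolding c'_def by (simp add: mult_ac)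
    qed
  qed
  moreover have "t\<^sub>0 > 0" using c(2) unfolding t\<^sub>0_def by simp
  ultimately show ?case using c' by (intro exI[of _ c'] conjI exI[of _ t\<^sub>0]) auto
qed

end

section \<open>A window of positive mass and the pointwise lower bound\<close>

context chain_density
begin

text \<open>With \<open>\<epsilon> = 1 / V\<close>, summands with \<open>ln m < \<delta> V\<close>
  grow by nearly \<open>1 + \<epsilon>\<close>, because \<open>ln K\<close> exceeds the Mertens
  error by 1. As they cannot exceed total mass 1 afterwards, they fall short of it at
  \<open>s = 1\<close> by a multiple of \<open>\<epsilon>\<close>. The tail beyond
  \<open>A V\<close> is too small to fill this gap, so the window does.\<close>

theorem sum_window_ge:
  assumes \<theta>_eq: "\<And>m. \<theta> m = K * real m" and lnK: "ln K \<ge> C\<^sub>1 + 1"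
  shows "\<exists>\<delta> A c V\<^sub>0. 0 < \<delta> \<and> \<delta> < A \<and> 0 < c \<and> 0 < V\<^sub>0 \<and>
    (\<forall>V\<ge>V\<^sub>0. c \<le> (\<Sum>m | m \<in> B \<and> \<delta> * V \<le> ln (real m) \<and> ln (real m) < A * V. 1 / real m))"
proof -
  obtain CU where CU: "CU > 0" "\<And>y. y \<ge> 1 \<Longrightarrow> euler_prod P 1 y \<le> CU / (1 + ln y)"
    using euler_prod_1_bounds by blast
  obtain CT where CT: "CT > 0" "\<And>Y V. Y \<ge> 1 \<Longrightarrow> V \<ge> 1 \<Longrightarrow> infsum (wt Y) (far Y V) \<le> CT / V"
    using tail_bound by blast
  obtain D2 where D2: "D2 > 0" "\<And>Y V. Y \<ge> 1 \<Longrightarrow> V \<ge> 1 \<Longrightarrow> (\<Sum>m\<in>near Y V. wt Y m * (1 + ln (real m))\<^sup>2) \<le> D2 * V"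
    using sum_near_square by blast
  \<comment> \<open>The weight of \<open>m = 1\<close>, a lower bound for the near mass that is
    independent of \<open>V\<close>.\<close>
  define a where "a = euler_prod P 1 K"
  have a: "a > 0" unfolding a_def by (rule euler_prod_pos) simp
  have lK: "ln K \<ge> 0" using K_ge by simp
  define k where "k = 1 + ln K + C\<^sub>1"
  have k: "k \<ge> 1" unfolding k_def using lK C1_nonneg by simp
  \<comment> \<open>\<open>\<delta>\<close> limits the quadratic loss, and \<open>A\<close> the
    tail, to a quarter of the gain \<open>\<epsilon> a\<close>, which leaves
    \<open>\<epsilon> a / 2\<close> for the window.\<close>
  define \<delta> where "\<delta> = min 1 (a / (4 * k\<^sup>2 * D2))"
  have kD: "k\<^sup>2 * D2 > 0" using k D2 by simp
  have \<delta>: "0 < \<delta>" "\<delta> \<le> 1" unfolding \<delta>_def using a k D2 by auto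
  have \<delta>a: "k\<^sup>2 * D2 * \<delta> \<le> a / 4"
  proof -
    have "k\<^sup>2 * D2 * \<delta> \<le> k\<^sup>2 * D2 * (a / (4 * k\<^sup>2 * D2))" unfolding \<delta>_def using kD by (intro mult_left_mono) auto
    also have "\<dots> = a / 4" using k D2(1) by simp
    finally show ?thesis .
  qed
  define A where "A = max 2 (4 * CT / a)"
  have A: "A \<ge> 2" "CT / A \<le> a / 4"
  proof -
    show A2: "A \<ge> 2" unfolding A_def by simp
    have "4 * CT / a \<le> A" unfolding A_def by simp
    then show "CT / A \<le> a / 4" using a A2 by (simp add: field_simps)
  qed
  define c where "c = \<delta> * a / (2 * CU)"
  have c: "c > 0" unfolding c_def using \<delta> a CU by simp
  have "c \<le> (\<Sum>m | m \<in> B \<and> \<delta> * V \<le> ln (real m) \<and> ln (real m) < A * V. 1 / real m)"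
    if VV: "V \<ge> 1 / \<delta>" for V
  proof -
    have "1 / \<delta> \<ge> 1" using \<delta> by simp
    then have V: "V \<ge> 1" using VV by linarith
    define \<epsilon> where "\<epsilon> = 1 / V"
    have \<epsilon>: "\<epsilon> > 0" "\<epsilon> * V = 1" unfolding \<epsilon>_def using V by auto
    define W where "W = \<delta> * V"
    have W: "W \<ge> 1" unfolding W_def using VV \<delta> by (simp add: field_simps)
    have WA: "W < A * V" "A * V \<ge> 1" unfolding W_def using V A \<delta> by (auto intro: order.trans[OF _ mult_mono[of 1 A 1 V]])
    \<comment> \<open>Up to \<open>ln m = A V\<close> the truncation must not be felt, so that
      \<open>cut Y m\<close> is exactly \<open>K m\<close>.\<close>
    define Y where "Y = nat \<lceil>K * exp (A * V)\<rceil>"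
    have KY: "K * exp (A * V) \<le> real Y" unfolding Y_def by (simp add: of_nat_ceiling)
    have "1 \<le> K * exp (A * V)" using K_ge WA mult_mono[of 1 K 1 "exp (A * V)"] by simp
    then have Y: "Y \<ge> 1" using KY by linarith
    have cut: "cut Y m = K * real m" if "m > 0" "ln (real m) \<le> A * V" for m
    proof -
      have "real m = exp (ln (real m))" using that by simp
      also have "\<dots> \<le> exp (A * V)" using that(2) by (simp only: exp_le_cancel_iff)
      finally have "K * real m \<le> real Y" using KY K_ge mult_left_mono[of "real m" "exp (A * V)" K] by linarith
      then show ?thesis unfolding cut_def \<theta>_eq by simp
    qed
    have lncut: "ln (cut Y m) = ln K + ln (real m)" if "m > 0" "ln (real m) \<le> A * V" for m
      unfolding cut[OF that] using K_ge that by (simp add: ln_mult)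
    have near: "wt Y m * (1 + \<epsilon> - \<epsilon>\<^sup>2 * k\<^sup>2 * (1 + ln (real m))\<^sup>2) \<le> twt (1 + \<epsilon>) Y m" if m: "m \<in> near Y W" for m
    proof -
      have m0: "m > 0" and mW: "ln (real m) \<le> A * V" using m BY_pos WA by (auto simp: near_def)
      define L where "L = ln (real m)"
      have L: "L \<ge> 0" unfolding L_def using m0 by simp
      note cb = cut_bounds[OF m0 Y]
      have y: "ln (cut Y m) = ln K + L" using lncut[OF m0 mW] unfolding L_def .
      define x where "x = (\<epsilon> * (ln (cut Y m) - C\<^sub>1) - \<epsilon>\<^sup>2 * (ln (cut Y m) * (ln (cut Y m) + C\<^sub>1))) - ((1 + \<epsilon>) - 1) * ln (real m)"
      have tw: "wt Y m * exp x \<le> twt (1 + \<epsilon>) Y m"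
        unfolding x_def using cb \<epsilon> by (intro twt_ratio m0 euler_prod_right_lower) auto
      have kL: "ln K + L + C\<^sub>1 \<le> k * (1 + L)"
        using mult_right_mono[OF k L] unfolding k_def by (simp add: algebra_simps)
      have "(ln K + L) * (ln K + L + C\<^sub>1) \<le> (k * (1 + L)) * (k * (1 + L))"
      proof (intro mult_mono)
        show "ln K + L \<le> k * (1 + L)" using kL C1_nonneg by linarith
        show "0 \<le> k * (1 + L)" using k L by simp
      qed (use kL L lK C1_nonneg in auto)
      then have "\<epsilon>\<^sup>2 * ((ln K + L) * (ln K + L + C\<^sub>1)) \<le> \<epsilon>\<^sup>2 * (k\<^sup>2 * (1 + L)\<^sup>2)"
        by (intro mult_left_mono) (auto simp: power2_eq_square mult_ac)
      moreover have "\<epsilon> * (ln K - C\<^sub>1) \<ge> \<epsilon> * 1" using lnK \<epsilon> by (intro mult_left_mono) auto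
      ultimately have "\<epsilon> - \<epsilon>\<^sup>2 * k\<^sup>2 * (1 + L)\<^sup>2 \<le> x"
        unfolding x_def y L_def[symmetric] by (simp add: algebra_simps)
      then have "1 + \<epsilon> - \<epsilon>\<^sup>2 * k\<^sup>2 * (1 + L)\<^sup>2 \<le> exp x" using exp_ge_add_one_self[of x] by linarith
      then have "wt Y m * (1 + \<epsilon> - \<epsilon>\<^sup>2 * k\<^sup>2 * (1 + L)\<^sup>2) \<le> wt Y m * exp x" by (intro mult_left_mono wt_nonneg)
      then show ?thesis using tw unfolding L_def by linarith
    qed
    have t: "(twt (1 + \<epsilon>) Y has_sum 1) (BY Y)" using \<epsilon> by (intro twt_has_sum) auto
    have "0 \<le> infsum (twt (1 + \<epsilon>) Y) (far Y W)" using \<epsilon> by (intro infsum_nonneg twt_nonneg) auto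
    then have "sum (twt (1 + \<epsilon>) Y) (near Y W) \<le> 1" using far_near_split(1)[OF t, of W] by linarith
    moreover have "(\<Sum>m\<in>near Y W. wt Y m * (1 + \<epsilon> - \<epsilon>\<^sup>2 * k\<^sup>2 * (1 + ln (real m))\<^sup>2)) \<le> sum (twt (1 + \<epsilon>) Y) (near Y W)"
      by (intro sum_mono near)
    moreover have "(\<Sum>m\<in>near Y W. wt Y m * (1 + \<epsilon> - \<epsilon>\<^sup>2 * k\<^sup>2 * (1 + ln (real m))\<^sup>2)) =
        sum (wt Y) (near Y W) + \<epsilon> * sum (wt Y) (near Y W) - \<epsilon>\<^sup>2 * k\<^sup>2 * (\<Sum>m\<in>near Y W. wt Y m * (1 + ln (real m))\<^sup>2)"
      unfolding sum_distrib_left sum.distrib[symmetric] sum_subtractf[symmetric]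
      by (intro sum.cong) (auto simp: algebra_simps)
    moreover have "\<epsilon>\<^sup>2 * k\<^sup>2 * (\<Sum>m\<in>near Y W. wt Y m * (1 + ln (real m))\<^sup>2) \<le> \<epsilon>\<^sup>2 * k\<^sup>2 * (D2 * W)"
      by (intro mult_left_mono D2 Y W) auto
    moreover have "\<epsilon>\<^sup>2 * k\<^sup>2 * (D2 * W) = \<epsilon> * (k\<^sup>2 * D2 * \<delta>)"
      unfolding W_def using \<epsilon>(2) by (simp add: power2_eq_square mult_ac)
    moreover have "\<epsilon> * (k\<^sup>2 * D2 * \<delta>) \<le> \<epsilon> * (a / 4)" using \<delta>a \<epsilon> by (intro mult_left_mono) auto
    moreover have "\<epsilon> * a \<le> \<epsilon> * sum (wt Y) (near Y W)"
    proof (intro mult_left_mono)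
      have "1 \<in> near Y W" using W by (simp add: near_def)
      then have "wt Y 1 \<le> sum (wt Y) (near Y W)" by (intro member_le_sum) (auto simp: wt_nonneg)
      moreover have "cut Y 1 = K" using cut[of 1] WA by simp
      ultimately show "a \<le> sum (wt Y) (near Y W)" unfolding a_def wt_def by simp
    qed (use \<epsilon> in auto)
    ultimately have "sum (wt Y) (near Y W) + \<epsilon> * a - \<epsilon> * (a / 4) \<le> 1" by linarith
    moreover have "near Y (A * V) = near Y W \<union> {m \<in> BY Y. W \<le> ln (real m) \<and> ln (real m) < A * V}"
      using WA by (auto simp: near_def)
    moreover have "{m \<in> BY Y. W \<le> ln (real m) \<and> ln (real m) < A * V} =
        {m. m \<in> B \<and> W \<le> ln (real m) \<and> ln (real m) < A * V}" (is "_ = ?mid")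
    proof -
      have "m \<in> BY Y" if "m \<in> B" "ln (real m) < A * V" for m
      proof (rule mem_BY[OF that(1)])
        have m0: "m > 0" using B_pos that by blast
        have "cut Y m = K * real m" using that m0 by (intro cut) auto
        then have "K * real m \<le> real Y" unfolding cut_def by linarith
        moreover have "1 * real m \<le> K * real m" using K_ge by (intro mult_right_mono) auto
        ultimately show "real m \<le> real Y" by linarith
      qed
      then show ?thesis by (auto simp: chain_upto_def)
    qed
    ultimately have n1: "near Y (A * V) = near Y W \<union> ?mid"
      and n2: "sum (wt Y) (near Y W) + \<epsilon> * a - \<epsilon> * (a / 4) \<le> 1" by auto
    have finmid: "finite ?mid" by (rule finite_subset[OF _ finite_B_ln_le[of "A * V"]]) auto
    have "sum (wt Y) (near Y (A * V)) = sum (wt Y) (near Y W) + sum (wt Y) ?mid"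
      unfolding n1 by (intro sum.union_disjoint finite_near finmid) (auto simp: near_def)
    moreover have "infsum (wt Y) (far Y (A * V)) + sum (wt Y) (near Y (A * V)) = 1"
      by (rule far_near_split(1)[OF wt_has_sum])
    moreover have "infsum (wt Y) (far Y (A * V)) \<le> CT / (A * V)" using Y WA by (intro CT)
    moreover have "CT / (A * V) = \<epsilon> * (CT / A)" unfolding \<epsilon>_def by simp
    moreover have "\<epsilon> * (CT / A) \<le> \<epsilon> * (a / 4)" using A \<epsilon> by (intro mult_left_mono) auto
    moreover have "\<epsilon> * (a / 4) = \<epsilon> * a / 4" by simp
    ultimately have mid: "\<epsilon> * a / 2 \<le> sum (wt Y) ?mid" using n2 by linarith
    have "sum (wt Y) ?mid \<le> (\<Sum>m\<in>?mid. CU / W * (1 / real m))"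
    proof (intro sum_mono)
      fix m assume m: "m \<in> ?mid"
      then have m0: "m > 0" using B_pos by blast
      note cb = cut_bounds[OF m0 Y]
      have "1 + ln (cut Y m) \<ge> W" using lncut[of m] m m0 lK by simp
      then have "CU / (1 + ln (cut Y m)) \<le> CU / W" using CU W by (intro divide_left_mono mult_pos_pos) auto
      then have "euler_prod P 1 (cut Y m) \<le> CU / W" using CU(2)[OF cb(1)] by linarith
      then have "euler_prod P 1 (cut Y m) / real m \<le> CU / W / real m" by (intro divide_right_mono) auto
      then show "wt Y m \<le> CU / W * (1 / real m)" unfolding wt_def by simp
    qed
    also have "\<dots> = CU / W * (\<Sum>m\<in>?mid. 1 / real m)" by (simp add: sum_distrib_left)
    finally have "\<epsilon> * a / 2 \<le> CU / W * (\<Sum>m\<in>?mid. 1 / real m)" using mid by linarith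
    then have "W / CU * (\<epsilon> * a / 2) \<le> W / CU * (CU / W * (\<Sum>m\<in>?mid. 1 / real m))"
      using W CU by (intro mult_left_mono) auto
    moreover have "W / CU * (CU / W * (\<Sum>m\<in>?mid. 1 / real m)) = (\<Sum>m\<in>?mid. 1 / real m)" using W CU by simp
    moreover have "W / CU * (\<epsilon> * a / 2) = c" unfolding W_def c_def \<epsilon>_def using V by simp
    ultimately show ?thesis unfolding W_def by simp
  qed
  moreover have "\<delta> < A" "1 / \<delta> > 0" using \<delta> A by auto
  ultimately show ?thesis using \<delta> c by (intro exI[of _ \<delta>] exI[of _ A] exI[of _ c] exI[of _ "1 / \<delta>"]) auto
qed

text \<open>Window members \<open>m \<ge> exp t\<close> are multiplied by band elements, whose
  primes are at most \<open>exp t\<close>; the products stay in the chain set. Each \<open>m\<close>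
  receives at least order \<open>X / (m t)\<close> cofactors, and the sum of \<open>1 / m\<close> is
  bounded below.\<close>

theorem chain_count_lower:
  assumes \<theta>_eq: "\<And>m. \<theta> m = K * real m" and lnK: "ln K \<ge> C\<^sub>1 + 1"
  shows "\<exists>c>0. \<exists>X\<^sub>0\<ge>2. \<forall>X\<ge>X\<^sub>0. c * (X / ln X) \<le> real (card {n \<in> B. real n \<le> X})"
proof -
  obtain \<delta> A c V\<^sub>0 where w: "0 < \<delta>" "\<delta> < A" "0 < c" "0 < V\<^sub>0" "\<And>V. V \<ge> V\<^sub>0 \<Longrightarrow>
      c \<le> (\<Sum>m | m \<in> B \<and> \<delta> * V \<le> ln (real m) \<and> ln (real m) < A * V. 1 / real m)"
    using sum_window_ge[OF assms] by blast
  define R where "R = A / \<delta>"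
  have R: "R > 1" unfolding R_def using w by simp
  \<comment> \<open>Makes the range of the band estimate reach \<open>ln X - ln m\<close>, which is
    at most \<open>R t\<close>.\<close>
  define k where "k = nat \<lceil>4 * R\<rceil>"
  have k: "4 * R \<le> real k" unfolding k_def by (simp add: of_nat_ceiling)
  obtain c\<^sub>2 t\<^sub>0 where b: "c\<^sub>2 > 0" "t\<^sub>0 > 0" "\<And>t z. t \<ge> t\<^sub>0 \<Longrightarrow> t / 2 \<le> z \<Longrightarrow> z \<le> t + real k * t / 4 \<Longrightarrow>
      c\<^sub>2 * (exp z / t) \<le> real (card (band t z))"
    using card_band_ge[of k] by blast
  \<comment> \<open>Bounds the number of prime factors above \<open>exp (t / 4)\<close> of an
    integer up to \<open>X\<close>, as \<open>ln X = (R + 1) t\<close>.\<close>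
  define j\<^sub>0 where "j\<^sub>0 = nat \<lceil>4 * (R + 1)\<rceil>"
  define M :: nat where "M = 2 ^ j\<^sub>0"
  have M: "real M > 0" unfolding M_def by simp
  define E where "E = c * c\<^sub>2 * (R + 1) / real M"
  have E: "E > 0" unfolding E_def using w b R M by simp
  define t\<^sub>1 where "t\<^sub>1 = max (max t\<^sub>0 (\<delta> * V\<^sub>0)) 1"
  have "E * (X / ln X) \<le> real (card {n \<in> B. real n \<le> X})" if X: "X \<ge> exp ((R + 1) * t\<^sub>1)" for X
  proof -
    have X0: "X > 0" using X exp_gt_zero[of "(R + 1) * t\<^sub>1"] by linarith
    \<comment> \<open>The window becomes \<open>t \<le> ln m < R t\<close>, which leaves more than
      \<open>t\<close> for the logarithm of the cofactor.\<close>
    define t where "t = ln X / (R + 1)"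
    have lnX: "ln X = (R + 1) * t" unfolding t_def using R by simp
    have "(R + 1) * t\<^sub>1 \<le> ln X" using X X0 by (simp add: ln_ge_iff)
    then have tt: "t \<ge> t\<^sub>1" unfolding lnX using R by simp
    then have t: "t \<ge> t\<^sub>0" "t \<ge> \<delta> * V\<^sub>0" "t \<ge> 1" unfolding t\<^sub>1_def by auto
    define V where "V = t / \<delta>"
    have V: "V \<ge> V\<^sub>0" "\<delta> * V = t" "A * V = R * t" unfolding V_def R_def using t w by (auto simp: field_simps)
    define W where "W = {m. m \<in> B \<and> t \<le> ln (real m) \<and> ln (real m) < R * t}"
    have finW: "finite W" unfolding W_def by (rule finite_subset[OF _ finite_B_ln_le[of "R * t"]]) auto
    have sumW: "c \<le> (\<Sum>m\<in>W. 1 / real m)" using w(5)[OF V(1)] unfolding V W_def .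
    define N where "N = {n \<in> B. real n \<le> X}"
    have finN: "finite N" unfolding N_def by (rule finite_subset[of _ "{..nat \<lfloor>X\<rfloor>}"]) (auto simp: le_nat_floor)
    define S where "S = Sigma W (\<lambda>m. band t (ln X - ln (real m)))"
    have Wm: "m > 0" "t \<le> ln (real m)" "ln (real m) < R * t" "m \<in> B" "exp t \<le> real m" if "m \<in> W" for m
    proof -
      show m: "m > 0" "t \<le> ln (real m)" "ln (real m) < R * t" "m \<in> B" using that B_pos unfolding W_def by auto
      show "exp t \<le> real m" using m by (metis exp_le_cancel_iff exp_ln of_nat_0_less_iff)
    qed
    have "card S \<le> M * card N"
    proof (rule card_pairs_le_mult[where Q = "\<lambda>p. exp (t / 4) < real p"])
      fix m r assume "(m, r) \<in> S"
      then have m: "m \<in> W" and r: "r \<in> band t (ln X - ln (real m))" unfolding S_def by auto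
      have "real r \<le> X / real m" using r Wm(1)[OF m] X0 by (simp add: band_def exp_diff)
      then have "real (m * r) \<le> X" using Wm(1)[OF m] by (simp add: field_simps)
      moreover have "m * r \<in> B"
      proof (rule chain_set_mult[OF Wm(4)[OF m] \<theta>_mono])
        show "real m \<le> \<theta> m" by (rule \<theta>_ge[OF Wm(1)[OF m]])
        show "r > 0" using r by (simp add: band_def)
        fix p assume "p \<in> prime_factors r"
        then have "p \<in> P" "real p \<le> exp t" using r by (auto simp: band_def)
        moreover from this have "real p \<le> real m" using Wm(5)[OF m] by linarith
        ultimately show "p \<in> P \<and> p \<le> m" by simp
      qed
      ultimately show "m * r \<in> N \<and> r > 0 \<and> (\<forall>p\<in>prime_factors r. exp (t / 4) < real p)"
        using r by (auto simp: N_def band_def)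
    next
      fix n assume n: "n \<in> N"
      then have n0: "n > 0" using B_pos by (auto simp: N_def)
      have "t / 4 \<le> ln (real p)" if "prime p" "exp (t / 4) < real p" for p :: nat
        using that by (metis exp_gt_zero less_imp_le ln_exp ln_mono)
      then obtain j where j: "card {d. d dvd n \<and> (\<forall>p\<in>prime_factors d. exp (t / 4) < real p)} \<le> 2 ^ j"
          "real j * (t / 4) \<le> ln (real n)"
        using card_rough_divisors[of n "t / 4" "\<lambda>p. exp (t / 4) < real p"] n0 t by auto
      have "ln (real n) \<le> ln X" using n n0 by (intro ln_mono) (auto simp: N_def)
      moreover have "(4 * (R + 1)) * (t / 4) = ln X" unfolding lnX by simp
      ultimately have "real j * (t / 4) \<le> (4 * (R + 1)) * (t / 4)" using j(2) by linarith
      then have "real j \<le> 4 * (R + 1)" using t by (simp add: mult_le_cancel_right)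
      then have "j \<le> j\<^sub>0" unfolding j\<^sub>0_def by linarith
      then have "(2::nat) ^ j \<le> M" unfolding M_def by (intro power_increasing) auto
      then show "n > 0 \<and> card {d. d dvd n \<and> (\<forall>p\<in>prime_factors d. exp (t / 4) < real p)} \<le> M"
        using j n0 by simp
    qed (rule finN)
    then have S1: "real (card S) \<le> real M * real (card N)" by (metis of_nat_le_iff of_nat_mult)
    have "c\<^sub>2 * (X / t) * c \<le> c\<^sub>2 * (X / t) * (\<Sum>m\<in>W. 1 / real m)"
      using b X0 t by (intro mult_left_mono sumW) auto
    also have "\<dots> = (\<Sum>m\<in>W. c\<^sub>2 * (X / t) * (1 / real m))" by (simp add: sum_distrib_left)
    also have "\<dots> \<le> (\<Sum>m\<in>W. real (card (band t (ln X - ln (real m)))))"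
    proof (intro sum_mono)
      fix m assume m: "m \<in> W"
      have eq: "c\<^sub>2 * (X / t) * (1 / real m) = c\<^sub>2 * (exp (ln X - ln (real m)) / t)"
        using Wm(1)[OF m] X0 by (simp add: exp_diff)
      have "t / 2 \<le> ln X - ln (real m)" using Wm(3)[OF m] t unfolding lnX by (simp add: algebra_simps)
      moreover have "ln X - ln (real m) \<le> t + real k * t / 4"
      proof -
        have "(4 * R) * t \<le> real k * t" using k t by (intro mult_right_mono) auto
        moreover have "(R + 1) * t = R * t + t" by (simp add: algebra_simps)
        ultimately show ?thesis using Wm(2)[OF m] t unfolding lnX by linarith
      qed
      ultimately show "c\<^sub>2 * (X / t) * (1 / real m) \<le> real (card (band t (ln X - ln (real m))))"
        unfolding eq using t by (intro b)
    qed
    also have "\<dots> = real (card S)" unfolding S_def using finW by (subst card_SigmaI) auto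
    finally have "c\<^sub>2 * (X / t) * c \<le> real M * real (card N)" using S1 by linarith
    then have "c\<^sub>2 * (X / t) * c / real M \<le> real (card N)"
      using M by (subst pos_divide_le_eq) (auto simp: mult.commute)
    moreover have "c\<^sub>2 * (X / t) * c / real M = E * (X / ln X)"
      unfolding E_def lnX using R t by (simp add: mult_ac)
    ultimately show ?thesis unfolding N_def by simp
  qed
  moreover have "exp ((R + 1) * t\<^sub>1) \<ge> 2"
  proof -
    have "1 * 1 \<le> (R + 1) * t\<^sub>1" using R unfolding t\<^sub>1_def by (intro mult_mono) auto
    then show ?thesis using exp_ge_add_one_self[of "(R + 1) * t\<^sub>1"] by linarith
  qed
  ultimately show ?thesis using E by blast
qed

end

section \<open>Practical numbers for the unitary totient\<close>

lemma unitary_totient_1 [simp]: "unitary_totient (Suc 0) = 1"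
  by (simp add: unitary_totient_def)

lemma prime_power_ge_2:
  fixes p n :: nat
  assumes "p \<in> prime_factors n"
  shows "p \<le> p ^ multiplicity p n" "2 \<le> p ^ multiplicity p n"
proof -
  have p: "prime p" "multiplicity p n > 0" using assms by (auto simp: prime_factors_multiplicity)
  then show 1: "p \<le> p ^ multiplicity p n" using prime_gt_0_nat[of p] by (intro self_le_power) auto
  then show "2 \<le> p ^ multiplicity p n" using prime_ge_2_nat[OF p(1)] by linarith
qed

lemma unitary_totient_pos [simp]: "unitary_totient n > 0"
  unfolding unitary_totient_def using prime_power_ge_2(2) by (intro prod_pos) fastforce

lemma unitary_totient_le: "n > 0 \<Longrightarrow> unitary_totient n \<le> n"
proof -
  assume "n > 0"
  have "unitary_totient n \<le> (\<Prod>p\<in>prime_factors n. p ^ multiplicity p n)"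
    unfolding unitary_totient_def by (intro prod_mono) auto
  also have "\<dots> = n" using \<open>n > 0\<close> by (simp add: prod_prime_factors)
  finally show ?thesis .
qed

text \<open>All other factors are at least 1, so the factor of \<open>q\<close> alone gives the
  bound.\<close>

lemma unitary_totient_ge:
  assumes "q \<in> prime_factors n"
  shows "q - 1 \<le> unitary_totient n"
proof -
  define R where "R = (\<Prod>p\<in>prime_factors n - {q}. p ^ multiplicity p n - 1)"
  have "unitary_totient n = (q ^ multiplicity q n - 1) * R"
    unfolding unitary_totient_def R_def using assms by (intro prod.remove) auto
  moreover have "R > 0"
    unfolding R_def using prime_power_ge_2(2) by (intro prod_pos) fastforce
  ultimately have "q ^ multiplicity q n - 1 \<le> unitary_totient n" by simp
  then show ?thesis using prime_power_ge_2(1)[OF assms] by linarith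
qed

lemma unitary_totient_mult_prime_power:
  assumes "prime p" "\<not> p dvd d" "k > 0"
  shows "unitary_totient (d * p ^ k) = unitary_totient d * (p ^ k - 1)"
proof -
  have d: "d > 0" using assms by (auto intro: Nat.gr0I)
  have pf: "prime_factors (d * p ^ k) = insert p (prime_factors d)"
    using d assms prime_gt_0_nat[of p]
    by (auto simp: in_prime_factors_iff prime_dvd_mult_iff prime_dvd_power_iff primes_dvd_imp_eq)
  have "multiplicity q (d * p ^ k) = multiplicity q d" if "q \<in> prime_factors d" for q
  proof -
    have q: "prime q" "q \<noteq> p" using that assms by auto
    then have "\<not> q dvd p ^ k" using assms by (metis prime_dvd_power primes_dvd_imp_eq)
    then show ?thesis using q d assms by (subst prime_elem_multiplicity_mult_distrib)
      (auto simp: not_dvd_imp_multiplicity_0)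
  qed
  moreover have "multiplicity p (d * p ^ k) = k"
    using d assms by (subst prime_elem_multiplicity_mult_distrib)
      (auto simp: multiplicity_same_power not_dvd_imp_multiplicity_0)
  moreover have "p \<notin> prime_factors d" using assms by auto
  ultimately show ?thesis unfolding unitary_totient_def pf by simp
qed

text \<open>The new divisors carry the full power \<open>p ^ Suc e\<close>, and their cofactors
  range over the divisors of \<open>m\<close> itself; hence practicality of \<open>m\<close> enters
  the extension step, besides that of \<open>m p ^ e\<close>.\<close>

lemma divisors_mult_prime_power_Suc:
  fixes p m :: nat
  assumes p: "prime p" "\<not> p dvd m"
  shows "{d. d dvd m * p ^ Suc e} = {d. d dvd m * p ^ e} \<union> (\<lambda>d. d * p ^ Suc e) ` {d. d dvd m}"
    and "{d. d dvd m * p ^ e} \<inter> (\<lambda>d. d * p ^ Suc e) ` {d. d dvd m} = {}"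
proof -
  have m: "m > 0" using p by (auto intro: Nat.gr0I)
  have cop: "coprime p m" using p by (simp add: prime_imp_coprime)
  show "{d. d dvd m * p ^ Suc e} = {d. d dvd m * p ^ e} \<union> (\<lambda>d. d * p ^ Suc e) ` {d. d dvd m}"
  proof (intro equalityI subsetI)
    fix d assume "d \<in> {d. d dvd m * p ^ Suc e}"
    then have d: "d dvd m * p ^ Suc e" by simp
    have "m * p ^ Suc e \<noteq> 0" using m prime_gt_0_nat[OF p(1)] by simp
    with d have d0: "d \<noteq> 0" by (metis dvd_0_left_iff)
    obtain y where y: "d = p ^ multiplicity p d * y" "\<not> p dvd y"
      using multiplicity_decompose'[of d p] d0 p by (auto simp: prime_elem_not_unit)
    define j where "j = multiplicity p d"
    have dj: "d = p ^ j * y" using y j_def by simp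
    have "coprime p y" using y p by (simp add: prime_imp_coprime)
    then have "coprime y (p ^ Suc e)" by (metis coprime_commute coprime_power_right_iff)
    moreover have "y dvd m * p ^ Suc e" using d dj by (metis dvd_mult_right)
    ultimately have ym: "y dvd m" by (simp only: coprime_dvd_mult_left_iff)
    have "p ^ j dvd m * p ^ Suc e" using d dj by (metis dvd_mult_left)
    moreover have "coprime (p ^ j) m" using cop by simp
    ultimately have "p ^ j dvd p ^ Suc e" by (simp only: coprime_dvd_mult_right_iff)
    then have j: "j \<le> Suc e" using prime_gt_1_nat[OF p(1)] by (rule power_dvd_imp_le)
    show "d \<in> {d. d dvd m * p ^ e} \<union> (\<lambda>d. d * p ^ Suc e) ` {d. d dvd m}"
    proof (cases "j = Suc e")
      case True
      then show ?thesis using dj ym by (auto simp: mult.commute)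
    next
      case False
      then have "p ^ j dvd p ^ e" using j by (intro le_imp_power_dvd) auto
      then have "d dvd m * p ^ e" unfolding dj using ym by (metis mult.commute mult_dvd_mono)
      then show ?thesis by simp
    qed
  next
    fix d assume "d \<in> {d. d dvd m * p ^ e} \<union> (\<lambda>d. d * p ^ Suc e) ` {d. d dvd m}"
    moreover have "m * p ^ e dvd m * p ^ Suc e" by (intro mult_dvd_mono le_imp_power_dvd) auto
    ultimately show "d \<in> {d. d dvd m * p ^ Suc e}"
      by (auto intro: dvd_trans simp del: power_Suc)
  qed
  have False if "d dvd m" "d * p ^ Suc e dvd m * p ^ e" for d
  proof -
    have "p ^ Suc e dvd m * p ^ e" using that by (metis dvd_mult_right)
    then have "p * p ^ e dvd m * p ^ e" by simp
    then have "p dvd m" using prime_gt_0_nat[OF p(1)] by simp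
    then show False using p by simp
  qed
  then show "{d. d dvd m * p ^ e} \<inter> (\<lambda>d. d * p ^ Suc e) ` {d. d dvd m} = {}" by blast
qed

lemma sum_unitary_totient_shift:
  assumes p: "prime p" "\<not> p dvd m" and D: "D \<subseteq> {d. d dvd m}"
  shows "sum unitary_totient ((\<lambda>d. d * p ^ Suc e) ` D) = sum unitary_totient D * (p ^ Suc e - 1)"
proof -
  have "inj_on (\<lambda>d. d * p ^ Suc e) D" using prime_gt_0_nat[OF p(1)] by (auto simp: inj_on_def)
  then have "sum unitary_totient ((\<lambda>d. d * p ^ Suc e) ` D) = (\<Sum>d\<in>D. unitary_totient (d * p ^ Suc e))"
    by (simp add: sum.reindex o_def)
  also have "\<dots> = (\<Sum>d\<in>D. unitary_totient d * (p ^ Suc e - 1))"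
  proof (intro sum.cong refl unitary_totient_mult_prime_power p)
    fix d assume "d \<in> D"
    then have "d dvd m" using D by auto
    then show "\<not> p dvd d" using p dvd_trans by blast
  qed auto
  finally show ?thesis by (simp only: sum_distrib_right)
qed

lemma divisor_sum_mult_prime_power_Suc:
  assumes p: "prime p" "\<not> p dvd m"
  shows "divisor_sum unitary_totient (m * p ^ Suc e) =
    divisor_sum unitary_totient (m * p ^ e) + divisor_sum unitary_totient m * (p ^ Suc e - 1)"
proof -
  have m: "m > 0" using p by (auto intro: Nat.gr0I)
  have "m * p ^ e > 0" using m prime_gt_0_nat[OF p(1)] by simp
  then show ?thesis
    unfolding divisor_sum_def divisors_mult_prime_power_Suc(1)[OF p]
    using m divisors_mult_prime_power_Suc(2)[OF p, of e] sum_unitary_totient_shift[OF p order.refl]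
    by (subst sum.union_disjoint) auto
qed

lemma f_practicalD:
  assumes "f_practical f n" "t \<le> divisor_sum f n"
  shows "\<exists>D. D \<subseteq> {d. d dvd n} \<and> sum f D = t"
proof (cases "t = 0")
  case True
  then show ?thesis by (intro exI[of _ "{}"]) auto
next
  case False
  then show ?thesis using assms by (auto simp: f_practical_def)
qed

text \<open>The new divisors supply \<open>i (p ^ Suc e - 1)\<close> for every \<open>i\<close> up
  to the divisor sum of \<open>m\<close>. The old ones fill the gaps if the largest remainder,
  \<open>p ^ Suc e - 2\<close>, is within their reach; this explains the \<open>+ 2\<close>.\<close>

lemma practical_mult_prime:
  assumes p: "prime p" "\<not> p dvd m"
    and prac: "f_practical unitary_totient m" "f_practical unitary_totient (m * p ^ e)"
    and le: "p ^ Suc e \<le> divisor_sum unitary_totient (m * p ^ e) + 2"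
  shows "f_practical unitary_totient (m * p ^ Suc e)"
  unfolding f_practical_def
proof (intro conjI allI impI)
  let ?S = "divisor_sum unitary_totient"
  show "0 < m * p ^ Suc e" using prac(2) prime_gt_0_nat[OF p(1)] by (auto simp: f_practical_def)
  fix t assume "1 \<le> t \<and> t \<le> ?S (m * p ^ Suc e)"
  then have t: "t \<le> ?S (m * p ^ e) + ?S m * (p ^ Suc e - 1)"
    using divisor_sum_mult_prime_power_Suc[OF p] by simp
  define q where "q = p ^ Suc e - 1"
  have "1 < p ^ Suc e" using prime_gt_1_nat[OF p(1)] by (intro one_less_power) auto
  then have q: "q > 0" "q \<le> ?S (m * p ^ e) + 1" using le unfolding q_def by linarith+
  \<comment> \<open>The quotient is capped at the divisor sum of \<open>m\<close>. When the cap is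
    active, the rest may exceed \<open>q\<close>, but the bound on \<open>t\<close> keeps it within
    reach of the old divisors.\<close>
  define i where "i = min (?S m) (t div q)"
  have iq: "i * q \<le> t" unfolding i_def
    by (meson div_times_less_eq_dividend min.cobounded2 mult_le_mono1 order_trans)
  have "t - i * q \<le> ?S (m * p ^ e)"
  proof (cases "t div q \<le> ?S m")
    case True
    then have "t - i * q = t mod q" unfolding i_def by (simp add: minus_div_mult_eq_mod)
    then show ?thesis using q mod_less_divisor[OF q(1), of t] by linarith
  next
    case False
    then show ?thesis using t unfolding i_def q_def by simp
  qed
  then obtain D1 where D1: "D1 \<subseteq> {d. d dvd m * p ^ e}" "sum unitary_totient D1 = t - i * q"
    using f_practicalD[OF prac(2)] by blast
  have "i \<le> ?S m" unfolding i_def by simp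
  then obtain D2 where D2: "D2 \<subseteq> {d. d dvd m}" "sum unitary_totient D2 = i"
    using f_practicalD[OF prac(1)] by blast
  let ?D = "D1 \<union> (\<lambda>d. d * p ^ Suc e) ` D2"
  have fin: "finite D1" "finite D2"
    using D1 D2 prac by (auto simp: f_practical_def intro: finite_subset[OF _ finite_divisors_nat])
  have "D1 \<inter> (\<lambda>d. d * p ^ Suc e) ` D2 = {}"
    using divisors_mult_prime_power_Suc(2)[OF p, of e] D1 D2 by blast
  then have "sum unitary_totient ?D = sum unitary_totient D1 + sum unitary_totient ((\<lambda>d. d * p ^ Suc e) ` D2)"
    using fin by (intro sum.union_disjoint) auto
  also have "\<dots> = (t - i * q) + i * q"
    using sum_unitary_totient_shift[OF p D2(1), of e] D1 D2 unfolding q_def by simp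
  also have "\<dots> = t" using iq by simp
  finally have "sum unitary_totient ?D = t" .
  moreover have "?D \<subseteq> {d. d dvd m * p ^ Suc e}"
    using divisors_mult_prime_power_Suc(1)[OF p, of e] D1 D2 by blast
  ultimately show "\<exists>D. D \<subseteq> {d. d dvd m * p ^ Suc e} \<and> sum unitary_totient D = t" by blast
qed

text \<open>The divisor sum of \<open>m p ^ e\<close> keeps pace with \<open>p ^ e\<close>, so the
  single condition on \<open>p\<close> yields the hypothesis of the extension step for all
  exponents.\<close>

lemma practical_mult_prime_power:
  assumes p: "prime p" "\<not> p dvd m" and prac: "f_practical unitary_totient m"
    and le: "p \<le> divisor_sum unitary_totient m"
  shows "f_practical unitary_totient (m * p ^ e) \<and>
    divisor_sum unitary_totient m * p ^ e \<le> divisor_sum unitary_totient (m * p ^ e)"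
proof (induction e)
  case 0
  then show ?case using prac by simp
next
  case (Suc e)
  let ?S = "divisor_sum unitary_totient"
  have "p * p ^ e \<le> ?S m * p ^ e" using le by simp
  then have "p ^ Suc e \<le> ?S (m * p ^ e)" using Suc unfolding power_Suc by linarith
  then have "f_practical unitary_totient (m * p ^ Suc e)"
    using Suc p prac by (intro practical_mult_prime) auto
  moreover have "?S m * p ^ Suc e \<le> ?S (m * p ^ Suc e)"
  proof -
    have "?S m * 1 \<le> ?S m * p ^ e" using prime_gt_0_nat[OF p(1)] by (intro mult_left_mono) auto
    then have "?S m \<le> ?S (m * p ^ e)" using Suc by linarith
    moreover have "?S m * p ^ Suc e = ?S m + ?S m * (p ^ Suc e - 1)"
      using prime_gt_0_nat[OF p(1)] by (simp add: diff_mult_distrib2)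
    ultimately show ?thesis using divisor_sum_mult_prime_power_Suc[OF p, of e] by linarith
  qed
  ultimately show ?case by blast
qed

lemma practical_1: "f_practical unitary_totient (Suc 0)" "divisor_sum unitary_totient (Suc 0) = 1"
proof -
  show S: "divisor_sum unitary_totient (Suc 0) = 1" by (simp add: divisor_sum_def)
  show "f_practical unitary_totient (Suc 0)"
    unfolding f_practical_def S by (auto intro!: exI[of _ "{1}"])
qed

text \<open>The seed of all extensions by \<open>practical_mult_prime_power\<close>: starting from
  1, the prime 2 could not be attached, as its condition would read
  \<open>2 \<le> 1\<close>.\<close>

lemma practical_15: "f_practical unitary_totient 15" "divisor_sum unitary_totient 15 = 15"
proof -
  have p: "prime (3::nat)" "prime (5::nat)" by simp_all
  have S3: "divisor_sum unitary_totient 3 = 3"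
    using divisor_sum_mult_prime_power_Suc[OF p(1), of 1 0] practical_1 by simp
  have P3: "f_practical unitary_totient 3"
    using practical_mult_prime[OF p(1), of 1 0] practical_1 by simp
  have n5: "\<not> (5::nat) dvd 3" by simp
  show "divisor_sum unitary_totient 15 = 15"
    using divisor_sum_mult_prime_power_Suc[OF p(2) n5, of 0] S3 by simp
  show "f_practical unitary_totient 15"
    using practical_mult_prime[OF p(2) n5, of 0] S3 P3 by simp
qed

lemma practical_15_2_power:
  "f_practical unitary_totient (15 * 2 ^ j) \<and> 15 * 2 ^ j \<le> divisor_sum unitary_totient (15 * 2 ^ j)"
  using practical_mult_prime_power[of 2 15 j] practical_15 by simp

text \<open>Induction by removing the full power of the largest prime. Powers of 2 merge with the
  prefactor; any other largest prime satisfies \<open>p \<le> K m \<le> 2 ^ k m\<close>, which the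
  divisor sum of the smaller number dominates.\<close>

lemma practical_of_chain:
  fixes k :: nat and K :: real
  assumes K: "K \<le> 2 ^ k" and n: "n \<in> chain_set {p. prime p \<and> p \<noteq> 3 \<and> p \<noteq> 5} (\<lambda>m. K * real m)"
  shows "f_practical unitary_totient (15 * 2 ^ k * n) \<and>
    15 * 2 ^ k * n \<le> divisor_sum unitary_totient (15 * 2 ^ k * n)"
  using n
proof (induction n rule: less_induct)
  case (less n)
  have n0: "n > 0" using less.prems by (simp add: chain_set_def)
  show ?case
  proof (cases "prime_factors n \<subseteq> {2}")
    case True
    have two: "prime (2::nat)" by simp
    have "low_part 2 n * 2 ^ multiplicity 2 n = n" using True n0 by (intro low_part_mult_top) auto
    moreover have "low_part 2 n = 1"
    proof -
      have "{q. q \<in> prime_factors n \<and> q < 2} = {}" using True by auto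
      then show ?thesis unfolding low_part_def by (simp only: prod.empty)
    qed
    ultimately have "n = 2 ^ multiplicity 2 n" by simp
    then have "15 * 2 ^ k * n = 15 * 2 ^ (k + multiplicity 2 n)" by (simp add: power_add)
    then show ?thesis using practical_15_2_power by metis
  next
    case False
    define p where "p = Max (prime_factors n)"
    have ne: "prime_factors n \<noteq> {}" using False by auto
    have p: "p \<in> prime_factors n" unfolding p_def using ne by (intro Max_in) auto
    have pmax: "q \<le> p" if "q \<in> prime_factors n" for q unfolding p_def using that by simp
    have pp: "prime p" "p \<noteq> 3" "p \<noteq> 5" "real p \<le> K * real (low_part p n)"
      using p less.prems by (auto simp: chain_set_def)
    obtain q where q: "q \<in> prime_factors n" "q \<noteq> 2" using False by auto
    have "q > 2" using q prime_ge_2_nat[of q] by (auto simp: order_le_less)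
    then have p2: "p \<noteq> 2" using pmax[OF q(1)] by auto
    define m where "m = low_part p n"
    have nm: "n = m * p ^ multiplicity p n" unfolding m_def using n0 pp pmax by (intro low_part_mult_top[symmetric]) auto
    have m0: "m > 0" unfolding m_def by simp
    have mult: "multiplicity p n > 0" using p by (auto simp: prime_factors_multiplicity)
    have "1 < p ^ multiplicity p n" using prime_gt_1_nat[OF pp(1)] mult by (intro one_less_power) auto
    then have "m < n" using nm m0 by (metis mult.right_neutral mult_less_cancel1)
    moreover have "m \<in> chain_set {p. prime p \<and> p \<noteq> 3 \<and> p \<noteq> 5} (\<lambda>m. K * real m)"
      unfolding m_def using less.prems by (rule low_part_mem_chain_set)
    ultimately have IH: "f_practical unitary_totient (15 * 2 ^ k * m)"
        "15 * 2 ^ k * m \<le> divisor_sum unitary_totient (15 * 2 ^ k * m)"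
      using less.IH by auto
    have "\<not> p dvd m"
    proof
      assume "p dvd m"
      then have "p \<in> prime_factors m" using m0 pp by (auto simp: in_prime_factors_iff)
      then show False unfolding m_def by (simp add: prime_factors_low_part)
    qed
    moreover have "\<not> p dvd 15"
    proof
      assume "p dvd 15"
      then have "p dvd 3 * 5" by simp
      then have "p dvd 3 \<or> p dvd 5" using pp(1) prime_dvd_mult_iff by blast
      then show False using pp primes_dvd_imp_eq[of p 3] primes_dvd_imp_eq[of p 5] by auto
    qed
    moreover have "\<not> p dvd 2 ^ k"
      using pp(1) p2 prime_dvd_power[of p 2 k] primes_dvd_imp_eq[of p 2] by auto
    ultimately have nd: "\<not> p dvd 15 * 2 ^ k * m" using pp(1) prime_dvd_mult_iff by blast
    have "real p \<le> 2 ^ k * real m" using order.trans[OF pp(4) mult_right_mono[OF K, of "real (low_part p n)"]]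
      unfolding m_def by simp
    then have "real p \<le> real (2 ^ k * m)" by simp
    then have "p \<le> 2 ^ k * m" by (simp only: of_nat_le_iff)
    also have "\<dots> \<le> 15 * 2 ^ k * m" by simp
    also note IH(2)
    finally have "f_practical unitary_totient (15 * 2 ^ k * m * p ^ multiplicity p n) \<and>
      divisor_sum unitary_totient (15 * 2 ^ k * m) * p ^ multiplicity p n
        \<le> divisor_sum unitary_totient (15 * 2 ^ k * m * p ^ multiplicity p n)"
      using pp(1) nd IH(1) by (intro practical_mult_prime_power)
    moreover have "15 * 2 ^ k * m * p ^ multiplicity p n \<le>
        divisor_sum unitary_totient (15 * 2 ^ k * m) * p ^ multiplicity p n"
      using IH(2) by (intro mult_right_mono) auto
    ultimately have "f_practical unitary_totient (15 * 2 ^ k * m * p ^ multiplicity p n) \<and>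
      15 * 2 ^ k * m * p ^ multiplicity p n
        \<le> divisor_sum unitary_totient (15 * 2 ^ k * m * p ^ multiplicity p n)" by linarith
    moreover have "15 * 2 ^ k * m * p ^ multiplicity p n = 15 * 2 ^ k * n"
      using nm by (metis mult.assoc)
    ultimately show ?thesis by (simp only:)
  qed
qed

section \<open>The chain condition for practical numbers\<close>

lemma harm_le: "n > 0 \<Longrightarrow> harm n \<le> 1 + ln (real n)"
proof (induction n rule: nat_induct_non_zero)
  case (Suc n)
  have "(real (Suc n) - real n) / real (Suc n) \<le> ln (real (Suc n)) - ln (real n)"
    using Suc.hyps by (intro ln_diff_bounds) auto
  then show ?case using Suc by (simp add: harm_Suc inverse_eq_divide)
qed (simp add: harm_def)

text \<open>\<open>unitary_totient d \<le> d\<close> reduces this to the ordinary sum of divisors,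
  which is \<open>n\<close> times a part of the harmonic sum.\<close>

lemma divisor_sum_unitary_totient_le:
  assumes "n > 0"
  shows "real (divisor_sum unitary_totient n) \<le> real n * (1 + ln (real n))"
proof -
  have "real (divisor_sum unitary_totient n) \<le> (\<Sum>d | d dvd n. real d)"
    unfolding divisor_sum_def of_nat_sum using assms
    by (intro sum_mono of_nat_mono unitary_totient_le) (auto intro: Nat.gr0I)
  also have "\<dots> = (\<Sum>d | d dvd n. real n / real d)"
  proof (rule sum.reindex_bij_witness[of _ "\<lambda>d. n div d" "\<lambda>d. n div d"])
    fix d assume "d \<in> {d. d dvd n}"
    then obtain e where e: "n = d * e" by (auto elim: dvdE)
    with assms have "d > 0" "e > 0" by auto
    then show "n div (n div d) = d" "n div d \<in> {d. d dvd n}" "real n / real (n div d) = real d"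
      using e by auto
  qed (use assms in \<open>auto elim!: dvdE\<close>)
  also have "\<dots> \<le> (\<Sum>d=1..n. real n / real d)"
    using assms by (intro sum_mono2) (auto dest: dvd_imp_le intro: Nat.gr0I simp: Suc_le_eq)
  also have "\<dots> = real n * harm n" unfolding harm_def by (simp add: sum_distrib_left divide_inverse)
  also have "\<dots> \<le> real n * (1 + ln (real n))" using harm_le[OF assms] by (intro mult_left_mono) auto
  finally show ?thesis .
qed

text \<open>Only divisors of \<open>low_part p n\<close> have totient smaller than \<open>p - 1\<close>, so the first integer they
  cannot represent must be at least \<open>p - 1\<close>.\<close>

lemma chain_of_practical:
  assumes "f_practical unitary_totient n"
  shows "n \<in> chain_set {p. prime p} (\<lambda>m. 3 * real m * (1 + ln (real m)))"
proof -
  have n0: "n > 0" using assms by (simp add: f_practical_def)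
  have "real p \<le> 3 * real (low_part p n) * (1 + ln (real (low_part p n)))" if p: "p \<in> prime_factors n" for p
  proof -
    define l where "l = low_part p n"
    have l0: "l > 0" unfolding l_def by simp
    have ln: "l dvd n" unfolding l_def using n0 by (rule low_part_dvd)
    have pp: "prime p" "p dvd n" using p by auto
    have "p \<notin> prime_factors l" unfolding l_def by (simp add: prime_factors_low_part)
    then have pl: "\<not> p dvd l" using pp l0 by (auto simp: in_prime_factors_iff)
    let ?S = "divisor_sum unitary_totient"
    have "p \<le> ?S l + 2"
    proof (rule ccontr)
      assume "\<not> p \<le> ?S l + 2"
      then have big: "?S l + 1 < p - 1" by linarith
      \<comment> \<open>\<open>p\<close> divides \<open>n\<close> but not \<open>l\<close>, so
        \<open>?S l + 1\<close> is at most the divisor sum of \<open>n\<close> and has to be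
        represented.\<close>
      have "?S l + unitary_totient p = sum unitary_totient (insert p {d. d dvd l})"
        unfolding divisor_sum_def using l0 pl by simp
      also have "\<dots> \<le> ?S n" unfolding divisor_sum_def
        using n0 pp ln by (intro sum_mono2) (auto intro: dvd_trans)
      finally have "?S l + 1 \<le> ?S n" using unitary_totient_pos[of p] by linarith
      then obtain D where D: "D \<subseteq> {d. d dvd n}" "sum unitary_totient D = ?S l + 1"
        using f_practicalD[OF assms] by blast
      have finD: "finite D" using D n0 by (auto intro: finite_subset[OF _ finite_divisors_nat])
      have "D \<subseteq> {d. d dvd l}"
      proof
        fix d assume d: "d \<in> D"
        show "d \<in> {d. d dvd l}"
        proof (rule ccontr)
          assume nd: "d \<notin> {d. d dvd l}"
          have "\<exists>q\<in>prime_factors d. \<not> q < p"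
          proof (rule ccontr)
            assume "\<not> (\<exists>q\<in>prime_factors d. \<not> q < p)"
            then have "d dvd l" unfolding l_def using d D n0 by (intro low_part_dvdI) auto
            then show False using nd by simp
          qed
          then obtain q where q: "q \<in> prime_factors d" "p \<le> q" by auto
          then have "p - 1 \<le> unitary_totient d" using unitary_totient_ge[OF q(1)] by linarith
          moreover have "unitary_totient d \<le> sum unitary_totient D"
            using finD d by (intro member_le_sum) auto
          ultimately show False using D big by linarith
        qed
      qed
      then have "sum unitary_totient D \<le> ?S l" unfolding divisor_sum_def using l0 by (intro sum_mono2) auto
      then show False using D by simp
    qed
    then have "real p \<le> real (?S l) + 2" by linarith
    also have "\<dots> \<le> real l * (1 + ln (real l)) + 2 * (real l * (1 + ln (real l)))"
    proof (intro add_mono divisor_sum_unitary_totient_le l0)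
      have "1 * 1 \<le> real l * (1 + ln (real l))" using l0 by (intro mult_mono) auto
      then show "2 \<le> 2 * (real l * (1 + ln (real l)))" by simp
    qed
    finally show ?thesis unfolding l_def by simp
  qed
  then show ?thesis using n0 by (auto simp: chain_set_def)
qed

section \<open>The two bounds for the counting function\<close>

lemma practical_count_upper:
  "\<exists>C>0. \<exists>X\<^sub>0\<ge>2. \<forall>X\<ge>X\<^sub>0. real (practical_count unitary_totient X) \<le> C * (X / ln X)"
proof -
  obtain C where C: "\<And>y. y \<ge> 1 \<Longrightarrow>
      \<bar>(\<Sum>p | prime p \<and> real p \<le> y. ln (real p) / real p) - ln y\<bar> \<le> C"
    using sum_ln_prime_over by blast
  have "C \<ge> 0" using C[of 1] by linarith
  interpret chain_density "{p. prime p}" C "\<lambda>m. 3 * real m * (1 + ln (real m))" 3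
  proof
    show "C \<ge> 0" by fact
    show "\<bar>(\<Sum>p | p \<in> {p. prime p} \<and> prime p \<and> real p \<le> y. ln (real p) / real p) - ln y\<bar> \<le> C" if "y \<ge> 1" for y
      using C[OF that] by simp
    fix m :: nat assume m: "m > 0"
    show "3 * real m * (1 + ln (real m)) \<le> 3 * real (m * k) * (1 + ln (real (m * k)))" if "k > 0" for k
    proof -
      have "real m * 1 \<le> real m * real k" using that by (intro mult_left_mono) auto
      then have mk: "real m \<le> real (m * k)" by simp
      then have "ln (real m) \<le> ln (real (m * k))" using m by (intro ln_mono) auto
      with mk m show ?thesis by (intro mult_mono) auto
    qed
    have "ln (real m) \<ge> 0" using m by simp
    then have "real m * 1 \<le> real m * (3 * (1 + ln (real m)))" by (intro mult_left_mono) auto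
    then show "real m \<le> 3 * real m * (1 + ln (real m))" by (simp add: algebra_simps)
  qed auto
  obtain u X\<^sub>0 where u: "u > 0" "X\<^sub>0 \<ge> 2" "\<And>X. X \<ge> X\<^sub>0 \<Longrightarrow> real (card {n \<in> B. real n \<le> X}) \<le> u * (X / ln X)"
    using chain_count_upper by blast
  have "real (practical_count unitary_totient X) \<le> u * (X / ln X)" if "X \<ge> X\<^sub>0" for X
  proof -
    have "practical_count unitary_totient X \<le> card {n \<in> B. real n \<le> X}"
      unfolding practical_count_def
    proof (rule card_mono)
      show "finite {n \<in> B. real n \<le> X}"
        by (rule finite_subset[of _ "{..nat \<lfloor>X\<rfloor>}"]) (auto simp: le_nat_floor)
    qed (auto intro: chain_of_practical)
    then show ?thesis using u(3)[OF that] by linarith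
  qed
  then show ?thesis using u(1,2) by blast
qed

lemma practical_count_lower:
  "\<exists>c>0. \<exists>X\<^sub>0\<ge>2. \<forall>X\<ge>X\<^sub>0. c * (X / ln X) \<le> real (practical_count unitary_totient X)"
proof -
  obtain C where C: "\<And>y. y \<ge> 1 \<Longrightarrow>
      \<bar>(\<Sum>p | prime p \<and> real p \<le> y. ln (real p) / real p) - ln y\<bar> \<le> C"
    using sum_ln_prime_over by blast
  have C0: "C \<ge> 0" using C[of 1] by linarith
  \<comment> \<open>Dropping 3 and 5 lowers Mertens' sum by at most these two terms.\<close>
  define D where "D = C + (\<Sum>p\<in>{3, 5 :: nat}. ln (real p) / real p)"
  have D0: "D \<ge> 0" unfolding D_def using C0 by simp
  \<comment> \<open>Exactly the hypothesis \<open>ln K \<ge> C\<^sub>1 + 1\<close> of the lower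
    bound.\<close>
  define K where "K = exp (D + 1)"
  have K1: "K \<ge> 1" unfolding K_def using D0 by simp
  define P :: "nat set" where "P = {p. prime p \<and> p \<noteq> 3 \<and> p \<noteq> 5}"
  interpret chain_density P D "\<lambda>m. K * real m" K
  proof
    show "\<bar>(\<Sum>p | p \<in> P \<and> prime p \<and> real p \<le> y. ln (real p) / real p) - ln y\<bar> \<le> D" if y: "y \<ge> 1" for y
    proof -
      let ?A = "{p. p \<in> P \<and> prime p \<and> real p \<le> y}" and ?E = "{p. prime p \<and> real p \<le> y}"
      have "(\<Sum>p\<in>?E. ln (real p) / real p) = (\<Sum>p\<in>?A. ln (real p) / real p) + (\<Sum>p\<in>?E - ?A. ln (real p) / real p)"
        by (subst sum.subset_diff[of ?A ?E]) auto
      moreover have "(\<Sum>p\<in>?E - ?A. ln (real p) / real p) \<le> (\<Sum>p\<in>{3, 5 :: nat}. ln (real p) / real p)"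
        by (intro sum_mono2) (auto simp: P_def)
      moreover have "0 \<le> (\<Sum>p\<in>?E - ?A. ln (real p) / real p)"
        using prime_ge_1_nat by (intro sum_nonneg divide_nonneg_nonneg) auto
      ultimately show ?thesis using C[OF y] unfolding D_def by linarith
    qed
    fix m :: nat assume m: "m > 0"
    show "K * real m \<le> K * real (m * k)" if "k > 0" for k
      using K1 that mult_left_mono[of 1 "real k" "real m"] by (intro mult_left_mono) auto
    show "real m \<le> K * real m" using K1 mult_right_mono[of 1 K "real m"] by simp
    show "K * real m \<le> K * real m * (1 + ln (real m))"
      using K1 m mult_left_mono[of 1 "1 + ln (real m)" "K * real m"] by simp
  qed (use D0 K1 in auto)
  obtain c X\<^sub>0 where c: "c > 0" "X\<^sub>0 \<ge> 2" "\<And>X. X \<ge> X\<^sub>0 \<Longrightarrow> c * (X / ln X) \<le> real (card {n \<in> B. real n \<le> X})"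
    using chain_count_lower unfolding K_def by auto
  obtain k where k: "K < 2 ^ k" using real_arch_pow[of 2 K] by auto
  define N :: nat where "N = 15 * 2 ^ k"
  have "N > 0" unfolding N_def by simp
  then have N: "real N \<ge> 1" by simp
  \<comment> \<open>Multiplication by \<open>N\<close> embeds the chain set up to
    \<open>X / N\<close> into the practical numbers up to \<open>X\<close>, so only the constant
    changes.\<close>
  have "c / real N * (X / ln X) \<le> real (practical_count unitary_totient X)" if X: "X \<ge> real N * X\<^sub>0" for X
  proof -
    define Z where "Z = X / real N"
    have Z: "Z \<ge> X\<^sub>0" unfolding Z_def using X N by (simp add: field_simps)
    have Z2: "Z \<ge> 2" using Z c by linarith
    have XZ: "X = real N * Z" unfolding Z_def using N by simp
    have "Z \<le> X" unfolding XZ using N Z2 mult_right_mono[of 1 "real N" Z] by simp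
    then have "ln Z \<le> ln X" using Z2 by (intro ln_mono) auto
    moreover have "0 < ln Z" using Z2 by simp
    ultimately have lnZ: "0 < ln Z" "0 < ln X" "ln Z \<le> ln X" by linarith+
    have "inj_on (\<lambda>n. N * n) {n \<in> B. real n \<le> Z}" using N by (auto simp: inj_on_def)
    then have "card {n \<in> B. real n \<le> Z} = card ((\<lambda>n. N * n) ` {n \<in> B. real n \<le> Z})"
      by (simp add: card_image)
    also have "\<dots> \<le> practical_count unitary_totient X"
      unfolding practical_count_def
    proof (intro card_mono subsetI)
      show "finite {n. 1 \<le> n \<and> real n \<le> X \<and> f_practical unitary_totient n}"
        by (rule finite_subset[of _ "{..nat \<lfloor>X\<rfloor>}"]) (auto simp: le_nat_floor)
      fix j assume "j \<in> (\<lambda>n. N * n) ` {n \<in> B. real n \<le> Z}"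
      then obtain n where n: "j = N * n" "n \<in> B" "real n \<le> Z" by auto
      have "f_practical unitary_totient j"
        using practical_of_chain[of K k n] k n(2) unfolding n(1) N_def P_def by simp
      moreover from this have "j > 0" by (simp add: f_practical_def)
      moreover have "real j \<le> X" unfolding n(1) XZ using n(3) by (simp add: mult_left_mono)
      ultimately show "j \<in> {n. 1 \<le> n \<and> real n \<le> X \<and> f_practical unitary_totient n}" by simp
    qed
    finally have "real (card {n \<in> B. real n \<le> Z}) \<le> real (practical_count unitary_totient X)"
      by (simp only: of_nat_le_iff)
    moreover have "c / real N * (X / ln X) \<le> c * (Z / ln Z)"
    proof -
      have "c / real N * (X / ln X) = c * (Z / ln X)" unfolding Z_def by simp
      also have "\<dots> \<le> c * (Z / ln Z)"
        using c lnZ Z2 by (intro mult_left_mono divide_left_mono mult_pos_pos) auto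
      finally show ?thesis .
    qed
    ultimately show ?thesis using c(3)[OF Z] by linarith
  qed
  moreover have "c / real N > 0" using c N by simp
  moreover have "real N * X\<^sub>0 \<ge> 2" using c N mult_mono[of 1 "real N" 2 X\<^sub>0] by simp
  ultimately show ?thesis by blast
qed

theorem theorem1p8:
  "\<exists>l u :: real. l > 0 \<and> u > 0 \<and>
     (\<forall>X::real. X \<ge> 2 \<longrightarrow>
        l * (X / ln X) \<le> real (practical_count unitary_totient X) \<and>
        real (practical_count unitary_totient X) \<le> u * (X / ln X))"
proof -
  obtain u X\<^sub>1 where u: "u > 0" "X\<^sub>1 \<ge> 2"
      "\<And>X. X \<ge> X\<^sub>1 \<Longrightarrow> real (practical_count unitary_totient X) \<le> u * (X / ln X)"
    using practical_count_upper by blast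
  obtain l X\<^sub>2 where l: "l > 0" "X\<^sub>2 \<ge> 2"
      "\<And>X. X \<ge> X\<^sub>2 \<Longrightarrow> l * (X / ln X) \<le> real (practical_count unitary_totient X)"
    using practical_count_lower by blast
  have fin: "finite {n. 1 \<le> n \<and> real n \<le> X \<and> f_practical unitary_totient n}" for X
    by (rule finite_subset[of _ "{..nat \<lfloor>X\<rfloor>}"]) (auto simp: le_nat_floor)
  \<comment> \<open>For \<open>X\<close> between 2 and the thresholds the count lies between 1, as 1
    is practical, and \<open>X\<close>; this affects only the constants.\<close>
  have upper: "real (practical_count unitary_totient X) \<le> max u (ln X\<^sub>1) * (X / ln X)" if X: "X \<ge> 2" for X
  proof (cases "X \<ge> X\<^sub>1")
    case True
    have "u * (X / ln X) \<le> max u (ln X\<^sub>1) * (X / ln X)" using X by (intro mult_right_mono) auto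
    then show ?thesis using u(3)[OF True] by linarith
  next
    case False
    have "practical_count unitary_totient X \<le> card {1..nat \<lfloor>X\<rfloor>}"
      unfolding practical_count_def by (intro card_mono) (auto simp: le_nat_floor)
    then have "practical_count unitary_totient X \<le> nat \<lfloor>X\<rfloor>" by simp
    moreover have "real (nat \<lfloor>X\<rfloor>) \<le> X" using X by simp
    ultimately have "real (practical_count unitary_totient X) \<le> X"
      by (meson of_nat_le_iff order.trans)
    also have "X = ln X * (X / ln X)" using X by simp
    also have "\<dots> \<le> max u (ln X\<^sub>1) * (X / ln X)"
    proof (intro mult_right_mono)
      have "ln X \<le> ln X\<^sub>1" using False X by (intro ln_mono) auto
      then show "ln X \<le> max u (ln X\<^sub>1)" by linarith
    qed (use X in auto)
    finally show ?thesis .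
  qed
  have lower: "min l (ln 2 / X\<^sub>2) * (X / ln X) \<le> real (practical_count unitary_totient X)" if X: "X \<ge> 2" for X
  proof (cases "X \<ge> X\<^sub>2")
    case True
    have "min l (ln 2 / X\<^sub>2) * (X / ln X) \<le> l * (X / ln X)" using X by (intro mult_right_mono) auto
    then show ?thesis using l(3)[OF True] by linarith
  next
    case False
    have "min l (ln 2 / X\<^sub>2) * (X / ln X) \<le> (ln 2 / X\<^sub>2) * (X\<^sub>2 / ln 2)"
    proof (intro mult_mono frac_le)
      show "ln 2 \<le> ln X" using X by simp
    qed (use X False l in auto)
    also have "\<dots> = 1" using l by simp
    also have "1 \<le> real (practical_count unitary_totient X)"
    proof -
      have "1 \<in> {n. 1 \<le> n \<and> real n \<le> X \<and> f_practical unitary_totient n}" using X practical_1 by simp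
      then have "practical_count unitary_totient X > 0"
        unfolding practical_count_def using fin[of X] by (subst card_gt_0_iff) blast
      then show ?thesis by simp
    qed
    finally show ?thesis .
  qed
  show ?thesis
    using upper lower u(1) l(1,2)
    by (intro exI[of _ "min l (ln 2 / X\<^sub>2)"] exI[of _ "max u (ln X\<^sub>1)"]) auto
qed

end
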